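(* Let $p>1$, $q=p/(p-1)$, let $K\subset\mathbb{R}$ be a compact set, and let $\mu\in\mathcal{P}_p(\mathbb{R}^N)$ be a successively $\mathcal{W}_p$-continuous martingale measure (i.e. $\int x_{t+1}\,\mu_{x_{1:t}}(dx_{t+1})=x_t$ $\mu$-a.s. for $t=1,\dots,N-1$) for which there is a constant $C'$ with $\int\|x_{t+1:N}\|^p\,\bar\mu_{x_{1:t}}(dx_{t+1:N})\le C'(1+\|x_{1:t}\|^p)$ for all $x_{1:t}\in\mathbb{R}^t$, $t=1,\dots,N-1$. Let $f:\mathbb{R}^N\times K^N\to\mathbb{R}$ be a lower semicontinuous function which satisfies: (1) The map $x\mapsto f(x,\alpha)$ is differentiable, $(x,\alpha)\mapsto\nabla_xf(x,\alpha)$ is continuous, and $\|\nabla_xf(x,\alpha)\|\le C(1+\|x\|^{p-1-\varepsilon})$ for some $\varepsilon>0$ and a constant $C>0$. (2) The mapping $\alpha\mapsto f(x,\alpha)$ is $\varepsilon(x)$-strongly convex for all $x\in\operatorname{spt}(\mu)$, where $\mu(\varepsilon(x)>0)=1$, meaning that $$f(x,\widetilde\alpha)-f(x,\alpha)\ge\langle\nabla_\alpha f(x,\alpha),\widetilde\alpha-\alpha\rangle+\tfrac12\varepsilon(x)\|\widetilde\alpha-\alpha\|^2$$ for any $x\in\operatorname{spt}(\mu)$ and $\alpha,\widetilde\alpha\in K^N$. For $\delta>0$ let $$V^{\mathcal{M}}(\delta):=\inf_{\alpha\in\mathcal{A}}\ \sup_{\gamma\in\Pi^{\mathcal{M}}_{\mathrm{bc},\delta}(\mu,\cdot)}\int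 f(y,\alpha(x,y))\,\gamma(dx,dy),$$ and let $V^{\mathcal{M}}(0):=\inf_\alpha\int f(x,\alpha(x))\,\mu(dx)$, the infimum being over predictable controls $\alpha:\mathbb{R}^N\to K^N$; let $\mathcal{A}^*=\operatorname{argmin}(V^{\mathcal{M}}(0))$ be the set of minimizers of the latter problem. Then the sensitivity $\Upsilon^{\mathcal{M}}:=\lim_{\delta\to0+}\frac{V^{\mathcal{M}}(\delta)-V^{\mathcal{M}}(0)}{\delta}$ is given by $$\Upsilon^{\mathcal{M}}=\inf_{\alpha\in\mathcal{A}^*}\Bigg[\inf_{\lambda_1\in\mathbb{R}}\Big\|\int\partial_1f(x,\alpha)\,\bar\mu_{x_1}(dx_{2:N})+\lambda_1\Big\|_{L^q(\mu^1(dx_1))}+\sum_{t=2}^N\int\inf_{\lambda_t\in\mathbb{R}}\Big\|\int\partial_tf(x,\alpha)\,\bar\mu_{x_{1:t}}(dx_{t+1:N})+\lambda_t\Big\|_{L^q(\mu_{x_{1:t-1}}(dx_t))}\mu(dx_{1:t-1})\Bigg],$$ where $\alpha=\alpha(x)$ and $\partial_t$ denotes the partial derivative in $x_t$.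
   Context: Fix $N\in\mathbb{N}$. For $x\in\mathbb{R}^k$ let $\|x\|=(\sum_{t=1}^k|x_t|^p)^{1/p}$ and $x_{s:t}=(x_s,\dots,x_t)$. $\mathcal{P}(\mathbb{R}^k)$ is the set of Borel probability measures, $\mathcal{P}_p(\mathbb{R}^k)$ those with finite $p$-th moment, $\operatorname{spt}(\mu)$ the support of $\mu$, and $\mathcal{W}_p$ the $p$-Wasserstein distance. For $\mu\in\mathcal{P}_p(\mathbb{R}^N)$ write the disintegration $\mu=\mu^1\otimes\mu_{x_1}\otimes\dots\otimes\mu_{x_{1:N-1}}$, where $\mu^1$ is the first marginal, $\mu_{x_{1:t}}\in\mathcal{P}(\mathbb{R})$ is the conditional distribution of the $(t+1)$-st coordinate given that the first $t$ coordinates equal $x_{1:t}$, $\mu_{x_{1:0}}:=\mu^1$, and let $\bar\mu_{x_{1:t}}=\mu_{x_{1:t}}\otimes\dots\otimes\mu_{x_{1:N-1}}$ be the conditional distribution of the coordinates $t+1,\dots,N$ (for $t=N$ the integral against $\bar\mu_{x_{1:N}}$ is omitted). $\mu(dx_{1:t-1})$ denotes integration against the law of the first $t-1$ coordinates. $\mu$ is successively $\mathcal{W}_p$-continuous if $\mathbb{R}^t\ni x_{1:t}\mapsto\mu_{x_{1:t}}$ is continuous with respect to $\mathcal{W}_p$ for each $t=1,\dots,N-1$ (this version of the kernels is used). For $\pi\in\mathcal{P}(\mathbb{R}^2)$ set $\mathcal{C}_p(\pi)=(\int|x-y|^p\,\pi(dx,dy))^{1/p}$. For $\eta\in\mathcal{P}(\mathbb{R})$,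 $\Pi^{\mathcal{M}}_\delta(\eta,\cdot)$ is the set of $\pi\in\mathcal{P}(\mathbb{R}^2)$ with first marginal $\eta$, $\mathcal{C}_p(\pi)<\delta$ and $\int(x-y)\,\pi(dx,dy)=0$. For two measures, $\Pi(\mu,\nu)$ denotes the set of couplings. $\Pi^{\mathcal{M}}_\delta(\mu,\cdot)$, for $\mu$ on $\mathbb{R}^N$, is the set of measures $\gamma=\gamma^1\otimes\gamma_{x_1,y_1}\otimes\dots\otimes\gamma_{x_{1:N-1},y_{1:N-1}}$ on $\mathbb{R}^N\times\mathbb{R}^N$ with Borel measurable kernels (giving the conditional law of $(x_{s+1},y_{s+1})$ given $(x_{1:s},y_{1:s})$) such that $\gamma_{x_{1:s-1},y_{1:s-1}}\in\Pi^{\mathcal{M}}_\delta(\mu_{x_{1:s-1}},\cdot)$ for $s=1,\dots,N$ (with $\gamma_{x_{1:0},y_{1:0}}:=\gamma^1$). Such a $\gamma$ with second marginal $\nu$ is bicausal if $\gamma^1\in\Pi(\mu^1,\nu^1)$ and $\gamma_{x_{1:t},y_{1:t}}\in\Pi(\mu_{x_{1:t}},\nu_{y_{1:t}})$ for $\gamma$-a.e. $(x,y)$, $t=1,\dots,N-1$. Set $\Pi^{\mathcal{M}}_{\mathrm{bc},\delta}(\mu,\cdot):=\{\gamma\in\Pi^{\mathcal{M}}_\delta(\mu,\cdot):\gamma\text{ is bicausal}\}$. $\mathcal{A}$ is the set of predictable controls: Borel measurable $\alpha=(\alpha_1,\dots,\alpha_N):\mathbb{R}^N\times\mathbb{R}^N\to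 K^N$ such that $\alpha_t(x,y)$ depends only on $(x_{1:t-1},y_{1:t-1})$. Predictable controls $\alpha:\mathbb{R}^N\to K^N$ are Borel maps with $\alpha_t(x)$ depending only on $x_{1:t-1}$.
   Formalization: K is additionally assumed convex, as strong convexity of α ↦ f(x,α) on K^N presupposes; for non-convex compact K, such as {0,1} or [-1,0]∪[1,2], the stated formula can fail because optimal controls need not be unique. *)

theory Defs
  imports "HOL-Probability.Probability"
begin

(* R^t consists of the extensional functions on {1..t}. Its sigma-algebra is the product of the
   Borel sigma-algebras; topological notions refer to the subspace topology inherited from the
   product topology on "nat => real". Both are the Euclidean ones. The only point of R^0 is
   "origin0". *)

abbreviation Rn :: "nat \<Rightarrow> (nat \<Rightarrow> real) measure" where
  "Rn t \<equiv> PiM {1..t} (\<lambda>_. borel)"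

abbreviation origin0 :: "nat \<Rightarrow> real" where
  "origin0 \<equiv> (\<lambda>_. undefined)"

abbreviation first_coords :: "nat \<Rightarrow> (nat \<Rightarrow> real) \<Rightarrow> (nat \<Rightarrow> real)" where
  "first_coords t x \<equiv> restrict x {1..t}"

definition pnorm :: "real \<Rightarrow> nat set \<Rightarrow> (nat \<Rightarrow> real) \<Rightarrow> real" where
  "pnorm p I x = (\<Sum>i\<in>I. \<bar>x i\<bar> powr p) powr (1 / p)"

definition Pp :: "real \<Rightarrow> nat \<Rightarrow> (nat \<Rightarrow> real) measure set" where
  "Pp p k = {\<mu> \<in> space (prob_algebra (Rn k)).
     (\<integral>\<^sup>+ x. ennreal (pnorm p {1..k} x powr p) \<partial>\<mu>) < \<infinity>}"

definition Pp_line :: "real \<Rightarrow> real measure set" where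
  "Pp_line p = {\<eta> \<in> space (prob_algebra borel). (\<integral>\<^sup>+ x. ennreal (\<bar>x\<bar> powr p) \<partial>\<eta>) < \<infinity>}"

definition spt :: "'a::topological_space measure \<Rightarrow> 'a set" where
  "spt \<mu> = {x \<in> space \<mu>. \<forall>U. open U \<longrightarrow> x \<in> U \<longrightarrow> emeasure \<mu> (U \<inter> space \<mu>) > 0}"

definition eroot :: "real \<Rightarrow> ennreal \<Rightarrow> ennreal" where
  "eroot p v = (if v = \<infinity> then \<infinity> else ennreal (enn2real v powr (1 / p)))"

definition Lnorm :: "real \<Rightarrow> 'a measure \<Rightarrow> ('a \<Rightarrow> real) \<Rightarrow> ennreal" where
  "Lnorm q M g = eroot q (\<integral>\<^sup>+ x. ennreal (\<bar>g x\<bar> powr q) \<partial>M)"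


subsection \<open>Couplings and the Wasserstein distance on the line\<close>

definition couplings :: "real measure \<Rightarrow> real measure \<Rightarrow> (real \<times> real) measure set" where
  "couplings \<eta> \<theta> = {\<pi> \<in> space (prob_algebra borel). distr \<pi> borel fst = \<eta> \<and> distr \<pi> borel snd = \<theta>}"

definition Cp :: "real \<Rightarrow> (real \<times> real) measure \<Rightarrow> ennreal" where
  "Cp p \<pi> = Lnorm p \<pi> (\<lambda>(x, y). x - y)"

definition Wp :: "real \<Rightarrow> real measure \<Rightarrow> real measure \<Rightarrow> ennreal" where
  "Wp p \<eta> \<theta> = (INF \<pi>\<in>couplings \<eta> \<theta>. Cp p \<pi>)"

(* A finite Cp makes x - y integrable under the measure, as p > 1. *)
definition mart_couplings :: "real \<Rightarrow> real \<Rightarrow> real measure \<Rightarrow> (real \<times> real) measure set" where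
  "mart_couplings p \<delta> \<eta> = {\<pi> \<in> space (prob_algebra borel).
     distr \<pi> borel fst = \<eta> \<and> Cp p \<pi> < ennreal \<delta> \<and> (\<integral>(x, y). x - y \<partial>\<pi>) = 0}"


subsection \<open>Disintegrations\<close>

(* For a family k of kernels, k t x is the law of the (t+1)-st coordinate given that the first t
   coordinates equal x. The measure "cond_path k t m x" is the law of the first t + m coordinates
   given that the first t of them equal x: the product of the Dirac measure at x with
   k t x, ..., k (t+m-1). For t + m = N this is the conditional law of the coordinates t+1, ..., N,
   carried on R^N by keeping the prefix x. *)
primrec cond_path ::
  "(nat \<Rightarrow> (nat \<Rightarrow> real) \<Rightarrow> real measure) \<Rightarrow> nat \<Rightarrow> nat \<Rightarrow> (nat \<Rightarrow> real) \<Rightarrow> (nat \<Rightarrow> real) measure" where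
  "cond_path k t 0 x = return (Rn t) x"
| "cond_path k t (Suc m) x = cond_path k t m x \<bind>
     (\<lambda>z. distr (k (t + m) z) (Rn (Suc (t + m))) (\<lambda>r. z(Suc (t + m) := r)))"

definition disintegration ::
  "nat \<Rightarrow> (nat \<Rightarrow> real) measure \<Rightarrow> (nat \<Rightarrow> (nat \<Rightarrow> real) \<Rightarrow> real measure) \<Rightarrow> bool" where
  "disintegration N \<mu> k \<longleftrightarrow>
     (\<forall>t<N. k t \<in> Rn t \<rightarrow>\<^sub>M prob_algebra borel) \<and> \<mu> = cond_path k 0 N origin0"

primrec joint_path ::
  "(nat \<Rightarrow> (nat \<Rightarrow> real) \<times> (nat \<Rightarrow> real) \<Rightarrow> (real \<times> real) measure) \<Rightarrow> nat
     \<Rightarrow> ((nat \<Rightarrow> real) \<times> (nat \<Rightarrow> real)) measure" where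
  "joint_path g 0 = return (Rn 0 \<Otimes>\<^sub>M Rn 0) (origin0, origin0)"
| "joint_path g (Suc m) = joint_path g m \<bind>
     (\<lambda>(x, y). distr (g m (x, y)) (Rn (Suc m) \<Otimes>\<^sub>M Rn (Suc m))
        (\<lambda>(a, b). (x(Suc m := a), y(Suc m := b))))"

definition joint_disintegration ::
  "nat \<Rightarrow> ((nat \<Rightarrow> real) \<times> (nat \<Rightarrow> real)) measure
     \<Rightarrow> (nat \<Rightarrow> (nat \<Rightarrow> real) \<times> (nat \<Rightarrow> real) \<Rightarrow> (real \<times> real) measure) \<Rightarrow> bool" where
  "joint_disintegration N \<gamma> g \<longleftrightarrow>
     (\<forall>t<N. g t \<in> (Rn t \<Otimes>\<^sub>M Rn t) \<rightarrow>\<^sub>M prob_algebra borel) \<and> \<gamma> = joint_path g N"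

(* A property of the kernels k, since the continuous version is the one that is used. *)
definition succ_Wp_continuous ::
  "real \<Rightarrow> nat \<Rightarrow> (nat \<Rightarrow> (nat \<Rightarrow> real) \<Rightarrow> real measure) \<Rightarrow> bool" where
  "succ_Wp_continuous p N k \<longleftrightarrow>
     (\<forall>t\<in>{1..<N}. \<forall>x\<in>space (Rn t). k t x \<in> Pp_line p \<and>
        ((\<lambda>x'. Wp p (k t x') (k t x)) \<longlongrightarrow> 0) (at x within space (Rn t)))"

definition martingale_measure ::
  "nat \<Rightarrow> (nat \<Rightarrow> real) measure \<Rightarrow> (nat \<Rightarrow> (nat \<Rightarrow> real) \<Rightarrow> real measure) \<Rightarrow> bool" where
  "martingale_measure N \<mu> k \<longleftrightarrow>
     (\<forall>t\<in>{1..<N}. AE x in \<mu>. (\<integral>r. r \<partial>(k t (first_coords t x))) = x t)"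


subsection \<open>Admissible perturbations\<close>

(* In the next three definitions k is the disintegration of the reference measure. *)

definition Pi_mart ::
  "real \<Rightarrow> nat \<Rightarrow> (nat \<Rightarrow> (nat \<Rightarrow> real) \<Rightarrow> real measure) \<Rightarrow> real
     \<Rightarrow> ((nat \<Rightarrow> real) \<times> (nat \<Rightarrow> real)) measure set" where
  "Pi_mart p N k \<delta> = {\<gamma>. \<exists>g. joint_disintegration N \<gamma> g \<and>
     (\<forall>s<N. \<forall>x\<in>space (Rn s). \<forall>y\<in>space (Rn s). g s (x, y) \<in> mart_couplings p \<delta> (k s x))}"

(* The instance t = 0 concerns the first marginals. *)
definition bicausal ::
  "nat \<Rightarrow> (nat \<Rightarrow> (nat \<Rightarrow> real) \<Rightarrow> real measure) \<Rightarrow> ((nat \<Rightarrow> real) \<times> (nat \<Rightarrow> real)) measure \<Rightarrow> bool" where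
  "bicausal N k \<gamma> \<longleftrightarrow>
     (\<exists>g l. joint_disintegration N \<gamma> g \<and> disintegration N (distr \<gamma> (Rn N) snd) l \<and>
        (\<forall>t<N. AE (x, y) in \<gamma>.
           g t (first_coords t x, first_coords t y) \<in> couplings (k t (first_coords t x)) (l t (first_coords t y))))"

definition Pi_mart_bc ::
  "real \<Rightarrow> nat \<Rightarrow> (nat \<Rightarrow> (nat \<Rightarrow> real) \<Rightarrow> real measure) \<Rightarrow> real
     \<Rightarrow> ((nat \<Rightarrow> real) \<times> (nat \<Rightarrow> real)) measure set" where
  "Pi_mart_bc p N k \<delta> = {\<gamma> \<in> Pi_mart p N k \<delta>. bicausal N k \<gamma>}"


subsection \<open>Controls and value functions\<close>

abbreviation Kn :: "real set \<Rightarrow> nat \<Rightarrow> (nat \<Rightarrow> real) set" where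
  "Kn K N \<equiv> PiE {1..N} (\<lambda>_. K)"

definition joint_controls ::
  "real set \<Rightarrow> nat \<Rightarrow> ((nat \<Rightarrow> real) \<Rightarrow> (nat \<Rightarrow> real) \<Rightarrow> (nat \<Rightarrow> real)) set" where
  "joint_controls K N = {\<alpha>. (\<lambda>(x, y). \<alpha> x y) \<in> (Rn N \<Otimes>\<^sub>M Rn N) \<rightarrow>\<^sub>M Rn N \<and>
     (\<forall>x\<in>space (Rn N). \<forall>y\<in>space (Rn N). \<alpha> x y \<in> Kn K N) \<and>
     (\<forall>t\<in>{1..N}. \<forall>x\<in>space (Rn N). \<forall>y\<in>space (Rn N). \<forall>x'\<in>space (Rn N). \<forall>y'\<in>space (Rn N).
        first_coords (t - 1) x = first_coords (t - 1) x' \<longrightarrow> first_coords (t - 1) y = first_coords (t - 1) y' \<longrightarrow>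
        \<alpha> x y t = \<alpha> x' y' t)}"

definition controls :: "real set \<Rightarrow> nat \<Rightarrow> ((nat \<Rightarrow> real) \<Rightarrow> (nat \<Rightarrow> real)) set" where
  "controls K N = {\<alpha>. \<alpha> \<in> Rn N \<rightarrow>\<^sub>M Rn N \<and>
     (\<forall>x\<in>space (Rn N). \<alpha> x \<in> Kn K N) \<and>
     (\<forall>t\<in>{1..N}. \<forall>x\<in>space (Rn N). \<forall>x'\<in>space (Rn N).
        first_coords (t - 1) x = first_coords (t - 1) x' \<longrightarrow> \<alpha> x t = \<alpha> x' t)}"

definition V_mart ::
  "real \<Rightarrow> nat \<Rightarrow> real set \<Rightarrow> (nat \<Rightarrow> (nat \<Rightarrow> real) \<Rightarrow> real measure)
     \<Rightarrow> ((nat \<Rightarrow> real) \<Rightarrow> (nat \<Rightarrow> real) \<Rightarrow> real) \<Rightarrow> real \<Rightarrow> ereal" where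
  "V_mart p N K k f \<delta> = (INF \<alpha>\<in>joint_controls K N. SUP \<gamma>\<in>Pi_mart_bc p N k \<delta>.
     ereal (\<integral>(x, y). f y (\<alpha> x y) \<partial>\<gamma>))"

definition V_zero ::
  "nat \<Rightarrow> real set \<Rightarrow> (nat \<Rightarrow> real) measure \<Rightarrow> ((nat \<Rightarrow> real) \<Rightarrow> (nat \<Rightarrow> real) \<Rightarrow> real) \<Rightarrow> ereal" where
  "V_zero N K \<mu> f = (INF \<alpha>\<in>controls K N. ereal (\<integral>x. f x (\<alpha> x) \<partial>\<mu>))"

definition optimal_controls ::
  "nat \<Rightarrow> real set \<Rightarrow> (nat \<Rightarrow> real) measure \<Rightarrow> ((nat \<Rightarrow> real) \<Rightarrow> (nat \<Rightarrow> real) \<Rightarrow> real)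
     \<Rightarrow> ((nat \<Rightarrow> real) \<Rightarrow> (nat \<Rightarrow> real)) set" where
  "optimal_controls N K \<mu> f =
     {\<alpha>. is_arg_min (\<lambda>\<beta>. \<integral>x. f x (\<beta> x) \<partial>\<mu>) (\<lambda>\<beta>. \<beta> \<in> controls K N) \<alpha>}"


subsection \<open>Regularity of the cost function\<close>

definition lower_semicontinuous_on :: "'a::topological_space set \<Rightarrow> ('a \<Rightarrow> real) \<Rightarrow> bool" where
  "lower_semicontinuous_on S F \<longleftrightarrow> (\<forall>x\<in>S. \<forall>c < F x. \<forall>\<^sub>F y in at x within S. c < F y)"

(* Frechet differentiability relative to S; the type "nat => real" is not a normed space, so
   has_derivative does not apply. *)
definition has_gradient_within ::
  "nat \<Rightarrow> ((nat \<Rightarrow> real) \<Rightarrow> real) \<Rightarrow> (nat \<Rightarrow> real) \<Rightarrow> (nat \<Rightarrow> real) \<Rightarrow> (nat \<Rightarrow> real) set \<Rightarrow> bool" where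
  "has_gradient_within N F G x S \<longleftrightarrow>
     ((\<lambda>y. (F y - F x - (\<Sum>i=1..N. G i * (y i - x i))) / pnorm 2 {1..N} (\<lambda>i. y i - x i))
        \<longlongrightarrow> 0) (at x within S)"

definition partial ::
  "nat \<Rightarrow> ((nat \<Rightarrow> real) \<Rightarrow> (nat \<Rightarrow> real) \<Rightarrow> real) \<Rightarrow> (nat \<Rightarrow> real) \<Rightarrow> (nat \<Rightarrow> real) \<Rightarrow> real" where
  "partial t f x a = deriv (\<lambda>r. f (x(t := r)) a) (x t)"

definition grad_x ::
  "nat \<Rightarrow> ((nat \<Rightarrow> real) \<Rightarrow> (nat \<Rightarrow> real) \<Rightarrow> real) \<Rightarrow> (nat \<Rightarrow> real) \<Rightarrow> (nat \<Rightarrow> real) \<Rightarrow> (nat \<Rightarrow> real)" where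
  "grad_x N f x a = (\<lambda>t\<in>{1..N}. partial t f x a)"

(* As in convex_on, the domain K^N of a strongly convex function is convex, which for nonempty K^N
   (and N > 0) means that K is convex. The gradient inequality alone would not do: for a two-point
   set K it does not even force minimizers to be unique. The gradient is taken relative to K^N and
   is thus one-sided at the boundary. *)
definition strongly_convex_on ::
  "real \<Rightarrow> nat \<Rightarrow> real set \<Rightarrow> real \<Rightarrow> ((nat \<Rightarrow> real) \<Rightarrow> real) \<Rightarrow> bool" where
  "strongly_convex_on p N K e F \<longleftrightarrow> convex K \<and>
     (\<exists>G. \<forall>a\<in>Kn K N. has_gradient_within N F (G a) a (Kn K N) \<and>
        (\<forall>b\<in>Kn K N. F b - F a \<ge>
           (\<Sum>i=1..N. G a i * (b i - a i)) + 1 / 2 * e * (pnorm p {1..N} (\<lambda>i. b i - a i))\<^sup>2))"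

end

(* The conditional expectation of the partial derivative in x_t given x_1, ..., x_t is the only part
   of the gradient seen by a causal displacement of the t-th coordinate. Under the martingale
   constraint this part matters only modulo functions of x_1, ..., x_(t-1), and Hoelder duality for
   mean-zero displacements of L^p-size delta produces the infimum over lambda_t. Keeping an optimal
   control under every perturbation gives the upper bound.

   For the lower bound the displacement is the extremal function of this duality, perturbed slightly
   such that it becomes injective. Then the past of y and the past of x carry the same information,
   so the coupling is bicausal and every control of (x, y) is a control of x alone. By strong
   convexity, nearly optimal responses to the vanishing perturbation converge to the optimal control,
   so they cannot avoid the first-order loss. *)

theory Submission
  imports Defs
begin


section \<open>Hoelder duality on a probability space\<close>

text \<open>The upper bound must hold for all admissible couplings at once. The first-order
  remainder is therefore estimated pointwise by p-th moments alone, with a coefficient that is small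
  against \<delta>; this is what growth of the gradient below the order p - 1 buys. In the lower
  bound the obstacle is that the extremal displacement may merge points. Then the past of y no
  longer determines the past of x, hence not the conditional law of the next step, and bicausality
  can fail. Storing each coordinate of x in y below a mesh of size \<delta>^2 repairs this at a cost
  of order \<delta>^2, which a slightly shorter step absorbs. Since the coupling is built from
  kernels, the constraints on size and mean have to hold at every prefix and not only at almost
  every one. The lower bound is shown by contradiction along a sequence of sizes tending to zero.
  All displacements are built from one fixed optimal control, so only the responses vary, and their
  almost sure convergence along a subsequence suffices to pass to the limit.\<close>

lemma abs_add_powr_le:
  fixes a b r :: real
  assumes "r \<ge> 0"
  shows "\<bar>a + b\<bar> powr r \<le> 2 powr r * (\<bar>a\<bar> powr r + \<bar>b\<bar> powr r)"
proof -
  \<comment> \<open>The sum is at most twice the larger term. Unlike convexity this also covers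
    exponents below one, such as p - 1 for p < 2.\<close>
  have "\<bar>a + b\<bar> powr r \<le> (2 * max \<bar>a\<bar> \<bar>b\<bar>) powr r"
    using assms by (intro powr_mono2) auto
  also have "\<dots> = 2 powr r * max \<bar>a\<bar> \<bar>b\<bar> powr r" by (simp add: powr_mult)
  also have "\<dots> \<le> 2 powr r * (\<bar>a\<bar> powr r + \<bar>b\<bar> powr r)"
    by (auto simp: max_def)
  finally show ?thesis .
qed

locale conjugate_exponents =
  fixes p q :: real
  assumes p_gt_1: "p > 1" and q_eq: "q = p / (p - 1)"
begin

lemma q_gt_1: "q > 1"
  using p_gt_1 by (simp add: q_eq field_simps)

lemma inverse_sum: "1 / p + 1 / q = 1"
  using p_gt_1 by (simp add: q_eq field_simps)

lemma q_minus_1_times_p: "(q - 1) * p = q"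
  using p_gt_1 by (simp add: q_eq field_simps)

lemma p_minus_1_times_q: "(p - 1) * q = p"
  using p_gt_1 by (simp add: q_eq field_simps)

lemma Young:
  assumes "a \<ge> 0" "b \<ge> 0"
  shows "a * b \<le> a powr q / q + b powr p / p"
  using Youngs_inequality[of q p a b] p_gt_1 q_gt_1 inverse_sum assms by (simp add: add.commute)

lemma Young_weak:
  assumes "a \<ge> 0" "b \<ge> 0"
  shows "a * b \<le> a powr q + b powr p"
proof -
  have "a powr q / q \<le> a powr q" "b powr p / p \<le> b powr p"
    using p_gt_1 q_gt_1 by (simp_all add: divide_le_eq mult_le_cancel_left1)
  then show ?thesis using Young[OF assms] by linarith
qed

lemma Hoelder_integrable:
  fixes u v :: "'a \<Rightarrow> real"
  assumes [measurable]: "u \<in> borel_measurable M" "v \<in> borel_measurable M"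
    and u: "integrable M (\<lambda>x. \<bar>u x\<bar> powr q)" and v: "integrable M (\<lambda>x. \<bar>v x\<bar> powr p)"
  shows "integrable M (\<lambda>x. u x * v x)"
proof (rule Bochner_Integration.integrable_bound)
  show "integrable M (\<lambda>x. \<bar>u x\<bar> powr q + \<bar>v x\<bar> powr p)" using u v by simp
  show "AE x in M. norm (u x * v x) \<le> norm (\<bar>u x\<bar> powr q + \<bar>v x\<bar> powr p)"
    using Young_weak[of "\<bar>u x\<bar>" "\<bar>v x\<bar>" for x] by (auto simp: abs_mult)
qed measurable

lemma Hoelder:
  fixes u v :: "'a \<Rightarrow> real"
  assumes [measurable]: "u \<in> borel_measurable M" "v \<in> borel_measurable M"
    and u: "integrable M (\<lambda>x. \<bar>u x\<bar> powr q)" and v: "integrable M (\<lambda>x. \<bar>v x\<bar> powr p)"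
  shows "(\<integral>x. \<bar>u x * v x\<bar> \<partial>M)
    \<le> (\<integral>x. \<bar>u x\<bar> powr q \<partial>M) powr (1 / q) * (\<integral>x. \<bar>v x\<bar> powr p \<partial>M) powr (1 / p)"
proof -
  define A B where "A = (\<integral>x. \<bar>u x\<bar> powr q \<partial>M)" and "B = (\<integral>x. \<bar>v x\<bar> powr p \<partial>M)"
  have AB: "A \<ge> 0" "B \<ge> 0" by (simp_all add: A_def B_def)
  show ?thesis
  proof (cases "A = 0 \<or> B = 0")
    case True
    have "AE x in M. u x * v x = 0"
    proof (cases "A = 0")
      case True
      then have "AE x in M. \<bar>u x\<bar> powr q = 0"
        using integral_nonneg_eq_0_iff_AE[OF u] by (simp add: A_def)
      then show ?thesis by eventually_elim simp
    next
      case False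
      then have "AE x in M. \<bar>v x\<bar> powr p = 0"
        using integral_nonneg_eq_0_iff_AE[OF v] True by (simp add: B_def)
      then show ?thesis by eventually_elim simp
    qed
    then have "(\<integral>x. \<bar>u x * v x\<bar> \<partial>M) = (\<integral>x. 0 \<partial>M)"
      by (intro integral_cong_AE) auto
    then show ?thesis by (simp del: abs_mult)
  next
    case False
    then have pos: "A > 0" "B > 0" using AB by auto
    let ?a = "A powr (1 / q)" and ?b = "B powr (1 / p)"
    have ab: "?a > 0" "?b > 0" using pos by auto
    have pw: "?a powr q = A" "?b powr p = B"
      using p_gt_1 q_gt_1 pos by (simp_all add: powr_powr)
    have *: "\<bar>u x * v x\<bar> \<le> ?a * ?b * (\<bar>u x\<bar> powr q / (q * A) + \<bar>v x\<bar> powr p / (p * B))" for x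
    proof -
      have "(\<bar>u x\<bar> / ?a) * (\<bar>v x\<bar> / ?b) \<le> (\<bar>u x\<bar> / ?a) powr q / q + (\<bar>v x\<bar> / ?b) powr p / p"
        by (rule Young) auto
      also have "\<dots> = \<bar>u x\<bar> powr q / (q * A) + \<bar>v x\<bar> powr p / (p * B)"
        using ab pw by (simp add: powr_divide mult.commute)
      finally have "\<bar>u x\<bar> * \<bar>v x\<bar> / (?a * ?b) \<le> \<bar>u x\<bar> powr q / (q * A) + \<bar>v x\<bar> powr p / (p * B)" by simp
      then show ?thesis using ab by (simp add: abs_mult pos_divide_le_eq mult.commute)
    qed
    have "(\<integral>x. \<bar>u x * v x\<bar> \<partial>M)
        \<le> (\<integral>x. ?a * ?b * (\<bar>u x\<bar> powr q / (q * A) + \<bar>v x\<bar> powr p / (p * B)) \<partial>M)"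
      using Hoelder_integrable[OF assms] u v by (intro integral_mono * ) auto
    also have "\<dots> = ?a * ?b * (1 / q + 1 / p)"
      using u v pos by (simp add: A_def[symmetric] B_def[symmetric])
    finally show ?thesis using inverse_sum by (simp add: A_def B_def add.commute)
  qed
qed

text \<open>The duality map of L^q, i.e. the derivative of |u|^q / q. It attains equality in
  Hoelder's inequality: the product with u is |u|^q, and so is its p-th power.\<close>

definition spow :: "real \<Rightarrow> real" where
  "spow u = sgn u * \<bar>u\<bar> powr (q - 1)"

lemma spow_measurable [measurable]: "spow \<in> borel_measurable borel"
  unfolding spow_def by measurable

lemma abs_spow: "\<bar>spow u\<bar> = \<bar>u\<bar> powr (q - 1)"
  by (cases "u = 0") (simp_all add: spow_def abs_mult abs_sgn_eq)

lemma spow_mult_self: "u * spow u = \<bar>u\<bar> powr q"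
proof (cases "u = 0")
  case False
  have "u * sgn u = \<bar>u\<bar>" by (simp add: sgn_if)
  then have "u * spow u = \<bar>u\<bar> powr 1 * \<bar>u\<bar> powr (q - 1)"
    using False by (simp add: spow_def mult.assoc[symmetric])
  also have "\<dots> = \<bar>u\<bar> powr (1 + (q - 1))" by (rule powr_add[symmetric])
  finally show ?thesis by simp
qed simp

lemma abs_spow_powr: "\<bar>spow u\<bar> powr p = \<bar>u\<bar> powr q"
  by (simp add: abs_spow powr_powr q_minus_1_times_p)

lemma spow_minus: "spow (- u) = - spow u"
  by (simp add: spow_def sgn_minus)

lemma spow_strict_mono: "u < v \<Longrightarrow> spow u < spow v"
proof -
  have *: "spow u < spow v" if "0 \<le> u" "u < v" for u v
    using that q_gt_1 by (auto simp: spow_def sgn_if intro!: powr_less_mono2)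
  assume "u < v"
  consider "0 \<le> u" | "v \<le> 0" | "u < 0" "0 < v" by linarith
  then show ?thesis
  proof cases
    case 1 then show ?thesis using * \<open>u < v\<close> by auto
  next
    case 2 then show ?thesis using *[of "-v" "-u"] \<open>u < v\<close> by (auto simp: spow_minus)
  next
    case 3 then show ?thesis by (auto simp: spow_def sgn_if intro: less_trans[of _ 0])
  qed
qed

lemma spow_continuous: "isCont spow u"
proof -
  consider "u > 0" | "u < 0" | "u = 0" by linarith
  then show ?thesis
  proof cases
    case 1
    have "isCont (\<lambda>u. u powr (q - 1)) u" using 1 by (intro continuous_intros) auto
    moreover have "\<forall>\<^sub>F x in nhds u. x powr (q - 1) = spow x"
      using eventually_nhds_in_open[of "{0<..}" u] 1
      by (auto elim!: eventually_mono simp: spow_def)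
    ultimately show ?thesis by (rule isCont_cong[THEN iffD1, rotated])
  next
    case 2
    have "isCont (\<lambda>u. - ((- u) powr (q - 1))) u" using 2 by (intro continuous_intros) auto
    moreover have "\<forall>\<^sub>F x in nhds u. - ((- x) powr (q - 1)) = spow x"
      using eventually_nhds_in_open[of "{..<0}" u] 2
      by (auto elim!: eventually_mono simp: spow_def)
    ultimately show ?thesis by (rule isCont_cong[THEN iffD1, rotated])
  next
    case 3
    have "((\<lambda>x. \<bar>x\<bar> powr (q - 1)) \<longlongrightarrow> 0 powr (q - 1)) (at 0)"
      using q_gt_1 by (intro tendsto_powr' tendsto_rabs_zero tendsto_intros) auto
    then have "((\<lambda>x. \<bar>spow x\<bar>) \<longlongrightarrow> 0) (at 0)" by (simp add: abs_spow)
    then have "(spow \<longlongrightarrow> 0) (at 0)" using tendsto_rabs_zero_cancel by blast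
    then show ?thesis by (simp add: 3 isCont_def spow_def)
  qed
qed

lemma powr_q_add_le: "\<bar>a + b\<bar> powr q \<le> 2 powr q * (\<bar>a\<bar> powr q + \<bar>b\<bar> powr q)" for a b :: real
  using q_gt_1 by (intro abs_add_powr_le) simp

lemma abs_powr_le_one_plus: "\<bar>u\<bar> powr (q - 1) \<le> 1 + \<bar>u\<bar> powr q" for u :: real
proof (cases "\<bar>u\<bar> \<ge> 1")
  case True
  then have "\<bar>u\<bar> powr (q - 1) \<le> \<bar>u\<bar> powr q" by (intro powr_mono) auto
  then show ?thesis by simp
next
  case False
  then have "\<bar>u\<bar> powr (q - 1) \<le> 1" using q_gt_1 by (intro powr_le1) auto
  then show ?thesis by (simp add: add_increasing2)
qed

end

section \<open>Best approximation by constants in L^q and the extremal direction of mean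
  zero\<close>

locale shifted_Lq = conjugate_exponents p q + prob_space M
  for p q :: real and M :: "'a measure" +
  fixes g :: "'a \<Rightarrow> real"
  assumes g_measurable [measurable]: "g \<in> borel_measurable M"
    and g_integrable: "integrable M (\<lambda>x. \<bar>g x\<bar> powr q)"
begin

text \<open>Up to the factor q this is the derivative of the q-th moment of g + c in c, so its zero
  is the optimal constant.\<close>

definition shift_moment :: "real \<Rightarrow> real" where
  "shift_moment c = (\<integral>x. spow (g x + c) \<partial>M)"

lemma integrable_shifted: "integrable M (\<lambda>x. \<bar>g x + c\<bar> powr q)"
proof (rule Bochner_Integration.integrable_bound)
  show "integrable M (\<lambda>x. 2 powr q * (\<bar>g x\<bar> powr q + \<bar>c\<bar> powr q))" using g_integrable by simp
  show "AE x in M. norm (\<bar>g x + c\<bar> powr q) \<le> norm (2 powr q * (\<bar>g x\<bar> powr q + \<bar>c\<bar> powr q))"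
    using powr_q_add_le by auto
qed measurable

lemma integrable_spow: "integrable M (\<lambda>x. spow (g x + c))"
proof (rule Bochner_Integration.integrable_bound)
  show "integrable M (\<lambda>x. 1 + \<bar>g x + c\<bar> powr q)" using integrable_shifted by simp
  show "AE x in M. norm (spow (g x + c)) \<le> norm (1 + \<bar>g x + c\<bar> powr q)"
    using abs_powr_le_one_plus by (auto simp: abs_spow)
qed measurable

lemma shift_moment_strict_mono: "c < d \<Longrightarrow> shift_moment c < shift_moment d"
  unfolding shift_moment_def
  by (rule integral_less_AE_space) (auto simp: integrable_spow spow_strict_mono emeasure_space_1)

lemma shift_moment_continuous: "isCont shift_moment c"
proof -
  have "(\<lambda>n. shift_moment (X n)) \<longlonglongrightarrow> shift_moment c" if X: "X \<longlonglongrightarrow> c" for X :: "nat \<Rightarrow> real"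
  proof -
    obtain B where B: "\<And>n. \<bar>X n\<bar> \<le> B"
      using X by (metis Bseq_def convergentI convergent_imp_Bseq real_norm_def)
    show ?thesis unfolding shift_moment_def
    proof (rule integral_dominated_convergence)
      show "integrable M (\<lambda>x. 1 + (\<bar>\<bar>g x\<bar> + B\<bar>) powr q)"
      proof -
        have "integrable M (\<lambda>x. 2 powr q * (\<bar>\<bar>g x\<bar>\<bar> powr q + \<bar>B\<bar> powr q))"
          using g_integrable by simp
        then have "integrable M (\<lambda>x. \<bar>\<bar>g x\<bar> + B\<bar> powr q)"
          by (rule Bochner_Integration.integrable_bound)
            (use powr_q_add_le[of "\<bar>g x\<bar>" B for x] in auto)
        then show ?thesis by simp
      qed
      show "AE x in M. (\<lambda>n. spow (g x + X n)) \<longlonglongrightarrow> spow (g x + c)"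
      proof (rule AE_I2)
        fix x
        have "(\<lambda>n. g x + X n) \<longlonglongrightarrow> g x + c" using X by (intro tendsto_intros)
        then show "(\<lambda>n. spow (g x + X n)) \<longlonglongrightarrow> spow (g x + c)"
          by (rule isCont_tendsto_compose[OF spow_continuous])
      qed
      show "AE x in M. norm (spow (g x + X n)) \<le> 1 + \<bar>\<bar>g x\<bar> + B\<bar> powr q" for n
      proof (rule AE_I2)
        fix x
        have "\<bar>spow (g x + X n)\<bar> \<le> 1 + \<bar>g x + X n\<bar> powr q"
          using abs_powr_le_one_plus by (simp add: abs_spow)
        also have "\<dots> \<le> 1 + \<bar>\<bar>g x\<bar> + B\<bar> powr q"
          using B[of n] q_gt_1 by (intro add_left_mono powr_mono2) auto
        finally show "norm (spow (g x + X n)) \<le> 1 + \<bar>\<bar>g x\<bar> + B\<bar> powr q" by simp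
      qed
    qed measurable
  qed
  then show ?thesis by (auto simp: continuous_at_sequentially comp_def)
qed

text \<open>\<open>spow\<close> is homogeneous of degree q - 1. Factoring out a large shift n leaves
  the mean of \<open>spow\<close> at g / n + 1, which tends to 1 by dominated convergence.\<close>

lemma shift_moment_pos: "\<exists>c. shift_moment c > 0"
proof -
  have "(\<lambda>n. \<integral>x. spow (g x / real (Suc n) + 1) \<partial>M) \<longlonglongrightarrow> (\<integral>x. 1 \<partial>M)"
  proof (rule integral_dominated_convergence)
    show "integrable M (\<lambda>x. 1 + \<bar>\<bar>g x\<bar> + 1\<bar> powr q)"
    proof -
      have "integrable M (\<lambda>x. 2 powr q * (\<bar>\<bar>g x\<bar>\<bar> powr q + \<bar>1\<bar> powr q))"
        using g_integrable by simp
      then have "integrable M (\<lambda>x. \<bar>\<bar>g x\<bar> + 1\<bar> powr q)"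
        by (rule Bochner_Integration.integrable_bound)
          (use powr_q_add_le[of "\<bar>g x\<bar>" 1 for x] in auto)
      then show ?thesis by simp
    qed
    show "AE x in M. (\<lambda>n. spow (g x / real (Suc n) + 1)) \<longlonglongrightarrow> 1"
    proof (rule AE_I2)
      fix x
      have "(\<lambda>n. g x / real (Suc n) + 1) \<longlonglongrightarrow> 0 + 1"
        by (intro tendsto_add LIMSEQ_Suc[OF lim_const_over_n] tendsto_const)
      then have "(\<lambda>n. spow (g x / real (Suc n) + 1)) \<longlonglongrightarrow> spow (0 + 1)"
        by (rule isCont_tendsto_compose[OF spow_continuous])
      then show "(\<lambda>n. spow (g x / real (Suc n) + 1)) \<longlonglongrightarrow> 1" by (simp add: spow_def)
    qed
    show "AE x in M. norm (spow (g x / real (Suc n) + 1)) \<le> 1 + \<bar>\<bar>g x\<bar> + 1\<bar> powr q" for n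
    proof (rule AE_I2)
      fix x
      have "\<bar>g x / real (Suc n)\<bar> \<le> \<bar>g x\<bar>"
        by (simp add: abs_divide divide_le_eq mult_le_cancel_left1)
      then have le: "\<bar>g x / real (Suc n) + 1\<bar> \<le> \<bar>\<bar>g x\<bar> + 1\<bar>" by linarith
      have "\<bar>spow (g x / real (Suc n) + 1)\<bar> \<le> 1 + \<bar>g x / real (Suc n) + 1\<bar> powr q"
        using abs_powr_le_one_plus by (simp add: abs_spow)
      also have "\<dots> \<le> 1 + \<bar>\<bar>g x\<bar> + 1\<bar> powr q"
        using le q_gt_1 by (intro add_left_mono powr_mono2) auto
      finally show "norm (spow (g x / real (Suc n) + 1)) \<le> 1 + \<bar>\<bar>g x\<bar> + 1\<bar> powr q" by simp
    qed
  qed measurable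
  then have "\<forall>\<^sub>F n in sequentially. (\<integral>x. spow (g x / real (Suc n) + 1) \<partial>M) > 0"
    by (rule order_tendstoD) (simp add: prob_space)
  then obtain n where n: "(\<integral>x. spow (g x / real (Suc n) + 1) \<partial>M) > 0"
    by (auto simp: eventually_sequentially)
  have "spow (g x + real (Suc n)) = real (Suc n) powr (q - 1) * spow (g x / real (Suc n) + 1)" for x
  proof -
    have "g x + real (Suc n) = real (Suc n) * (g x / real (Suc n) + 1)" by (simp add: field_simps)
    then have "spow (g x + real (Suc n)) = spow (real (Suc n) * (g x / real (Suc n) + 1))" by simp
    then show ?thesis
      by (simp add: spow_def sgn_mult abs_mult powr_mult del: of_nat_Suc)
  qed
  then have "shift_moment (real (Suc n))
      = real (Suc n) powr (q - 1) * (\<integral>x. spow (g x / real (Suc n) + 1) \<partial>M)"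
    by (simp add: shift_moment_def del: of_nat_Suc)
  then show ?thesis using n by (intro exI[of _ "real (Suc n)"]) (simp del: of_nat_Suc)
qed

lemma shift_moment_root: "\<exists>!c. shift_moment c = 0"
proof -
  obtain b where b: "shift_moment b > 0" using shift_moment_pos by blast
  \<comment> \<open>As \<open>spow\<close> is odd, a positive value for -g is a negative value for
    g; the intermediate value theorem then applies.\<close>
  interpret neg: shifted_Lq p q M "\<lambda>x. - g x"
    by unfold_locales (use g_integrable in auto)
  obtain a where "neg.shift_moment a > 0" using neg.shift_moment_pos by blast
  moreover have "neg.shift_moment a = - shift_moment (- a)"
  proof -
    have "spow (- g x + a) = - spow (g x + - a)" for x
      using spow_minus[of "g x - a"] by simp
    then show ?thesis by (simp add: neg.shift_moment_def shift_moment_def)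
  qed
  ultimately have a: "shift_moment (- a) < 0" by simp
  have ab: "- a \<le> b"
    using shift_moment_strict_mono[of b "- a"] a b by (cases "- a \<le> b") auto
  have "\<exists>c. - a \<le> c \<and> c \<le> b \<and> shift_moment c = 0"
    by (rule IVT) (use a b ab shift_moment_continuous in auto)
  then obtain c where "shift_moment c = 0" by blast
  moreover have "d = c" if "shift_moment d = 0" "shift_moment c = 0" for c d
    using that shift_moment_strict_mono[of c d] shift_moment_strict_mono[of d c]
    by (cases c d rule: linorder_cases) auto
  ultimately show ?thesis by blast
qed

definition best_shift :: real where
  "best_shift = (THE c. shift_moment c = 0)"

lemma shift_moment_best_shift: "shift_moment best_shift = 0"
  unfolding best_shift_def by (rule theI'[OF shift_moment_root])

text \<open>Turns a comparison with the implicitly defined shift into a sign condition on an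
  integral. This is what later makes the shift measurable in the prefix.\<close>

lemma best_shift_le_iff: "best_shift \<le> c \<longleftrightarrow> 0 \<le> shift_moment c"
  using shift_moment_strict_mono[of c best_shift] shift_moment_strict_mono[of best_shift c]
    shift_moment_best_shift
  by (cases c best_shift rule: linorder_cases) auto

definition residual_moment :: real where
  "residual_moment = (\<integral>x. \<bar>g x + best_shift\<bar> powr q \<partial>M)"

text \<open>The Hoelder extremal of g + \<open>best_shift\<close>, scaled to p-th moment one. If the
  residual vanishes, the factor is 0 because \<open>0 powr r = 0\<close>, and so is the direction;
  hence the moment is only bounded by one.\<close>

definition dual_direction :: "'a \<Rightarrow> real" where
  "dual_direction x = spow (g x + best_shift) * residual_moment powr (- (1 / p))"

lemma dual_direction_measurable [measurable]: "dual_direction \<in> borel_measurable M"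
  unfolding dual_direction_def by measurable

lemma residual_moment_nonneg: "residual_moment \<ge> 0"
  by (simp add: residual_moment_def)

lemma integral_dual_direction: "(\<integral>x. dual_direction x \<partial>M) = 0"
  using shift_moment_best_shift by (simp add: dual_direction_def shift_moment_def)

lemma abs_dual_direction_powr:
  "\<bar>dual_direction x\<bar> powr p = \<bar>g x + best_shift\<bar> powr q * residual_moment powr (- 1)"
  using p_gt_1 by (simp add: dual_direction_def abs_mult powr_mult abs_spow_powr powr_powr)

lemma integrable_dual_direction_powr: "integrable M (\<lambda>x. \<bar>dual_direction x\<bar> powr p)"
  unfolding abs_dual_direction_powr using integrable_shifted by simp

lemma integral_dual_direction_powr: "(\<integral>x. \<bar>dual_direction x\<bar> powr p \<partial>M) \<le> 1"
proof -
  have "(\<integral>x. \<bar>dual_direction x\<bar> powr p \<partial>M) = residual_moment * residual_moment powr (- 1)"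
    unfolding abs_dual_direction_powr by (simp add: residual_moment_def)
  then show ?thesis using residual_moment_nonneg by (simp add: powr_minus_divide)
qed

lemma integrable_dual_direction: "integrable M dual_direction"
  unfolding dual_direction_def using integrable_spow by simp

lemma integrable_mult_dual: "integrable M (\<lambda>x. (g x + c) * dual_direction x)"
  by (rule Hoelder_integrable) (auto simp: integrable_shifted integrable_dual_direction_powr)

text \<open>As the direction has mean zero, every constant pairs to zero with it and c may be
  replaced by the best shift. What remains is the residual moment times its power -1/p, and 1 - 1/p
  = 1/q.\<close>

lemma integral_mult_dual_direction:
  "(\<integral>x. (g x + c) * dual_direction x \<partial>M) = residual_moment powr (1 / q)"
proof -
  have "(\<integral>x. (g x + c) * dual_direction x \<partial>M)
      = (\<integral>x. (g x + best_shift) * dual_direction x + (c - best_shift) * dual_direction x \<partial>M)"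
    by (simp add: algebra_simps)
  also have "\<dots> = (\<integral>x. (g x + best_shift) * dual_direction x \<partial>M)"
    using integrable_dual_direction by (subst Bochner_Integration.integral_add)
      (auto simp: integrable_mult_dual integral_dual_direction)
  also have "\<dots> = (\<integral>x. \<bar>g x + best_shift\<bar> powr q * residual_moment powr (- (1 / p)) \<partial>M)"
    by (simp add: dual_direction_def mult.assoc[symmetric] spow_mult_self)
  also have "\<dots> = residual_moment powr 1 * residual_moment powr (- (1 / p))"
    using residual_moment_nonneg by (simp add: residual_moment_def)
  also have "\<dots> = residual_moment powr (1 / q)"
    unfolding powr_add[symmetric] using inverse_sum by (simp add: eq_diff_eq[symmetric])
  finally show ?thesis .
qed

text \<open>Optimality of the shift by duality: the pairing with \<open>dual_direction\<close> has
  the same value for every c, and Hoelder bounds it by the norm of g + c.\<close>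

lemma residual_moment_le:
  "residual_moment powr (1 / q) \<le> (\<integral>x. \<bar>g x + c\<bar> powr q \<partial>M) powr (1 / q)"
proof -
  have "residual_moment powr (1 / q) \<le> (\<integral>x. \<bar>(g x + c) * dual_direction x\<bar> \<partial>M)"
    unfolding integral_mult_dual_direction[of c, symmetric] by (rule integral_abs_bound[THEN order_trans[OF abs_ge_self]])
  also have "\<dots> \<le> (\<integral>x. \<bar>g x + c\<bar> powr q \<partial>M) powr (1 / q)
      * (\<integral>x. \<bar>dual_direction x\<bar> powr p \<partial>M) powr (1 / p)"
    by (rule Hoelder) (auto simp: integrable_shifted integrable_dual_direction_powr)
  also have "\<dots> \<le> (\<integral>x. \<bar>g x + c\<bar> powr q \<partial>M) powr (1 / q) * 1"
    using integral_dual_direction_powr p_gt_1 by (intro mult_left_mono powr_le1) auto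
  finally show ?thesis by simp
qed

lemma Lnorm_eq:
  assumes "u \<in> borel_measurable M" "integrable M (\<lambda>x. \<bar>u x\<bar> powr q)"
  shows "Lnorm q M u = ennreal ((\<integral>x. \<bar>u x\<bar> powr q \<partial>M) powr (1 / q))"
  using assms by (simp add: Lnorm_def nn_integral_eq_integral eroot_def)

lemma INF_Lnorm:
  "(INF c. Lnorm q M (\<lambda>x. g x + c)) = ennreal (residual_moment powr (1 / q))"
proof (rule antisym)
  show "(INF c. Lnorm q M (\<lambda>x. g x + c)) \<le> ennreal (residual_moment powr (1 / q))"
    by (rule INF_lower2[of best_shift]) (auto simp: Lnorm_eq integrable_shifted residual_moment_def)
  show "ennreal (residual_moment powr (1 / q)) \<le> (INF c. Lnorm q M (\<lambda>x. g x + c))"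
    by (rule INF_greatest) (auto simp: Lnorm_eq integrable_shifted intro!: ennreal_leI residual_moment_le)
qed

end


section \<open>Disintegrations\<close>

(* keeps the index sets {1..t} in the form in which they occur in Rn *)
declare One_nat_def [simp del]

text \<open>Fubini for \<open>bind\<close> from integrability against the composed measure alone.
  The identity for nonnegative functions is applied to both signs, and finiteness of the outer
  integrals gives integrability of the inner ones almost everywhere.\<close>

lemma integral_bind_integrable:
  fixes f :: "'b \<Rightarrow> real"
  assumes K: "K \<in> M \<rightarrow>\<^sub>M subprob_algebra B" and ne: "space M \<noteq> {}"
    and int: "integrable (M \<bind> K) f"
  shows "AE x in M. integrable (K x) f"
    and "integrable M (\<lambda>x. \<integral>y. f y \<partial>K x)"
    and "(\<integral>y. f y \<partial>(M \<bind> K)) = (\<integral>x. \<integral>y. f y \<partial>K x \<partial>M)"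
proof -
  have [measurable_cong]: "sets (M \<bind> K) = sets B"
    by (rule sets_bind_measurable[OF K ne])
  have f [measurable]: "f \<in> borel_measurable B"
    using borel_measurable_integrable[OF int] by simp
  note [measurable] = K
  \<comment> \<open>As \<open>ennreal\<close> cuts off at zero, \<open>P f\<close> integrates the
    positive part of f and \<open>P\<close> of -f the negative part.\<close>
  define P where "P h x = (\<integral>\<^sup>+y. ennreal (h y) \<partial>K x)" for h and x
  have [measurable]: "(\<lambda>x. P f x) \<in> borel_measurable M" "(\<lambda>x. P (\<lambda>y. - f y) x) \<in> borel_measurable M"
    unfolding P_def by (rule measurable_compose[OF K nn_integral_measurable_subprob_algebra]; measurable)+
  have bind: "(\<integral>\<^sup>+y. ennreal (f y) \<partial>(M \<bind> K)) = (\<integral>\<^sup>+x. P f x \<partial>M)"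
      "(\<integral>\<^sup>+y. ennreal (- f y) \<partial>(M \<bind> K)) = (\<integral>\<^sup>+x. P (\<lambda>y. - f y) x \<partial>M)"
    unfolding P_def by (rule nn_integral_bind[OF _ K]; measurable)+
  have fin: "(\<integral>\<^sup>+x. P f x \<partial>M) < \<infinity>" "(\<integral>\<^sup>+x. P (\<lambda>y. - f y) x \<partial>M) < \<infinity>"
    using int unfolding real_integrable_def bind by (auto simp: top.not_eq_extremum)
  have AEf: "AE x in M. P f x < \<infinity>" "AE x in M. P (\<lambda>y. - f y) x < \<infinity>"
    using nn_integral_PInf_AE[of "P f" M] nn_integral_PInf_AE[of "P (\<lambda>y. - f y)" M] fin
    by (auto simp: top.not_eq_extremum)
  have setsK: "x \<in> space M \<Longrightarrow> sets (K x) = sets B" for x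
    using sets_kernel[OF K] .
  show AEi: "AE x in M. integrable (K x) f"
    using AEf AE_space
  proof eventually_elim
    case (elim x)
    then show ?case unfolding real_integrable_def
      using f by (auto simp: P_def measurable_cong_sets[OF setsK refl])
  qed
  have int1: "integrable M (\<lambda>x. enn2real (P f x))" "integrable M (\<lambda>x. enn2real (P (\<lambda>y. - f y) x))"
  proof -
    have "(\<integral>\<^sup>+x. ennreal (enn2real (P f x)) \<partial>M) \<le> (\<integral>\<^sup>+x. P f x \<partial>M)"
      by (intro nn_integral_mono) (simp add: ennreal_enn2real_if)
    then show "integrable M (\<lambda>x. enn2real (P f x))"
      using fin by (intro integrableI_nonneg) auto
    have "(\<integral>\<^sup>+x. ennreal (enn2real (P (\<lambda>y. - f y) x)) \<partial>M) \<le> (\<integral>\<^sup>+x. P (\<lambda>y. - f y) x \<partial>M)"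
      by (intro nn_integral_mono) (simp add: ennreal_enn2real_if)
    then show "integrable M (\<lambda>x. enn2real (P (\<lambda>y. - f y) x))"
      using fin by (intro integrableI_nonneg) auto
  qed
  have val: "(\<integral>x. enn2real (P h x) \<partial>M) = enn2real (\<integral>\<^sup>+x. P h x \<partial>M)"
    if "AE x in M. P h x < \<infinity>" and [measurable]: "P h \<in> borel_measurable M" for h
  proof -
    have "(\<integral>\<^sup>+x. ennreal (enn2real (P h x)) \<partial>M) = (\<integral>\<^sup>+x. P h x \<partial>M)"
      using that(1) by (intro nn_integral_cong_AE) (auto elim!: eventually_mono)
    then show ?thesis by (subst integral_eq_nn_integral) auto
  qed
  have eq: "AE x in M. enn2real (P f x) - enn2real (P (\<lambda>y. - f y) x) = (\<integral>y. f y \<partial>K x)"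
    using AEi by eventually_elim (simp add: real_lebesgue_integral_def P_def)
  have meas: "(\<lambda>x. \<integral>y. f y \<partial>K x) \<in> borel_measurable M"
    by (rule measurable_compose[OF K integral_measurable_subprob_algebra]) measurable
  show "integrable M (\<lambda>x. \<integral>y. f y \<partial>K x)"
    using integrable_cong_AE[OF _ meas eq] int1 by simp
  have "(\<integral>x. \<integral>y. f y \<partial>K x \<partial>M) = (\<integral>x. enn2real (P f x) - enn2real (P (\<lambda>y. - f y) x) \<partial>M)"
    using eq meas by (intro integral_cong_AE) auto
  also have "\<dots> = (\<integral>y. f y \<partial>(M \<bind> K))"
    using int1 AEf by (simp add: val real_lebesgue_integral_def[OF int] bind)
  finally show "(\<integral>y. f y \<partial>(M \<bind> K)) = (\<integral>x. \<integral>y. f y \<partial>K x \<partial>M)" by simp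
qed

section \<open>Prefixes and one-coordinate extensions of paths\<close>

lemma space_Rn: "space (Rn t) = extensional {1..t}"
  by (simp add: space_PiM PiE_UNIV_domain PiE_def)

lemma origin0_in_space [simp]: "origin0 \<in> space (Rn 0)"
  by (simp add: space_Rn)

lemma space_Rn_nonempty [simp]: "space (Rn t) \<noteq> {}"
  by (simp add: space_PiM PiE_eq_empty_iff)

lemma upd_measurable' [measurable]: "(\<lambda>(z, r). z(Suc t := r)) \<in> Rn t \<Otimes>\<^sub>M borel \<rightarrow>\<^sub>M Rn (Suc t)"
  unfolding split_beta' by (rule measurable_fun_upd[where J = "{1..t}"]) auto

lemma upd_measurable [measurable (raw)]:
  assumes "f \<in> M \<rightarrow>\<^sub>M Rn t" "h \<in> borel_measurable M"
  shows "(\<lambda>x. (f x)(Suc t := h x)) \<in> M \<rightarrow>\<^sub>M Rn (Suc t)"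
  by (rule measurable_fun_upd[where J = "{1..t}"]) (use assms in auto)

lemma coord_measurable:
  assumes "1 \<le> t" "t \<le> n" "f \<in> M \<rightarrow>\<^sub>M Rn n"
  shows "(\<lambda>x. f x t) \<in> borel_measurable M"
proof -
  have "(\<lambda>x. x t) \<in> borel_measurable (Rn n)"
    using measurable_component_singleton[of t "{1..n}" "\<lambda>_. borel"] assms by simp
  then show ?thesis by (rule measurable_compose[OF assms(3)])
qed

lemma first_coords_measurable [measurable (raw)]:
  assumes "t \<le> n" "f \<in> M \<rightarrow>\<^sub>M Rn n"
  shows "(\<lambda>x. first_coords t (f x)) \<in> M \<rightarrow>\<^sub>M Rn t"
  by (rule measurable_restrict, rule coord_measurable[OF _ _ assms(2)]) (use assms(1) in auto)

lemma first_coords_in_space: "first_coords t x \<in> space (Rn t)"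
  by (simp add: space_Rn)

lemma first_coords_id: "x \<in> space (Rn t) \<Longrightarrow> first_coords t x = x"
  by (auto simp: space_Rn extensional_restrict)

lemma first_coords_upd [simp]: "first_coords t (x(Suc t := r)) = first_coords t x"
  by (auto simp: restrict_def)

lemma first_coords_first_coords: "s \<le> t \<Longrightarrow> first_coords s (first_coords t x) = first_coords s x"
  by (auto simp: restrict_def fun_eq_iff)

lemma first_coords_Suc: "(first_coords t x)(Suc t := x (Suc t)) = first_coords (Suc t) x"
  by (auto simp: restrict_def fun_eq_iff le_Suc_eq)

lemma kernel_space:
  assumes "K \<in> M \<rightarrow>\<^sub>M prob_algebra B" "x \<in> space M"
  shows "prob_space (K x)" "sets (K x) = sets B" "space (K x) = space B"
  using measurable_space[OF assms] by (auto simp: space_prob_algebra dest: sets_eq_imp_space_eq)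

section \<open>Path laws generated by a family of kernels\<close>

locale kernels =
  fixes N :: nat and \<kappa> :: "nat \<Rightarrow> (nat \<Rightarrow> real) \<Rightarrow> real measure"
  assumes kernel: "\<And>t. t < N \<Longrightarrow> \<kappa> t \<in> Rn t \<rightarrow>\<^sub>M prob_algebra borel"
begin

definition step :: "nat \<Rightarrow> (nat \<Rightarrow> real) \<Rightarrow> (nat \<Rightarrow> real) measure" where
  "step t z = distr (\<kappa> t z) (Rn (Suc t)) (\<lambda>r. z(Suc t := r))"

lemma step_measurable: "t < N \<Longrightarrow> step t \<in> Rn t \<rightarrow>\<^sub>M prob_algebra (Rn (Suc t))"
  unfolding step_def by (rule measurable_distr_prob_space2[OF kernel]) auto

lemma cond_path_step: "cond_path \<kappa> t (Suc m) x = cond_path \<kappa> t m x \<bind> step (t + m)"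
  by (simp add: step_def[abs_def])

lemma cond_path_measurable:
  "t + m \<le> N \<Longrightarrow> cond_path \<kappa> t m \<in> Rn t \<rightarrow>\<^sub>M prob_algebra (Rn (t + m))"
proof (induction m)
  case 0
  have "cond_path \<kappa> t 0 = return (Rn t)" by (auto simp: fun_eq_iff)
  then show ?case by simp
next
  case (Suc m)
  have "(\<lambda>x. cond_path \<kappa> t m x \<bind> step (t + m)) \<in> Rn t \<rightarrow>\<^sub>M prob_algebra (Rn (Suc (t + m)))"
    using Suc by (intro measurable_bind_prob_space[OF Suc.IH step_measurable]) auto
  moreover have "cond_path \<kappa> t (Suc m) = (\<lambda>x. cond_path \<kappa> t m x \<bind> step (t + m))"
    by (rule ext) (rule cond_path_step)
  ultimately show ?case by simp
qed

lemma cond_path_space: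
  assumes "t + m \<le> N" "x \<in> space (Rn t)"
  shows "prob_space (cond_path \<kappa> t m x)" "sets (cond_path \<kappa> t m x) = sets (Rn (t + m))"
    "space (cond_path \<kappa> t m x) = space (Rn (t + m))"
  using kernel_space[OF cond_path_measurable[OF assms(1)] assms(2)] by auto

lemma nn_integral_step:
  assumes t: "t < N" and z: "z \<in> space (Rn t)" and [measurable]: "F \<in> borel_measurable (Rn (Suc t))"
  shows "(\<integral>\<^sup>+w. F w \<partial>step t z) = (\<integral>\<^sup>+r. F (z(Suc t := r)) \<partial>\<kappa> t z)"
proof -
  have [measurable_cong]: "sets (\<kappa> t z) = sets borel"
    using kernel_space[OF kernel[OF t] z] by simp
  have [measurable]: "(\<lambda>r. z(Suc t := r)) \<in> borel \<rightarrow>\<^sub>M Rn (Suc t)"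
    using z by measurable
  show ?thesis unfolding step_def by (rule nn_integral_distr) measurable
qed

lemma nn_integral_cond_path_Suc:
  assumes m: "t + Suc m \<le> N" and x: "x \<in> space (Rn t)"
    and F [measurable]: "F \<in> borel_measurable (Rn (Suc (t + m)))"
  shows "(\<integral>\<^sup>+w. F w \<partial>cond_path \<kappa> t (Suc m) x)
    = (\<integral>\<^sup>+z. \<integral>\<^sup>+r. F (z(Suc (t + m) := r)) \<partial>\<kappa> (t + m) z \<partial>cond_path \<kappa> t m x)"
proof -
  have sp: "sets (cond_path \<kappa> t m x) = sets (Rn (t + m))" "space (cond_path \<kappa> t m x) = space (Rn (t + m))"
    using cond_path_space[of t m x] m x by auto
  have "step (t + m) \<in> cond_path \<kappa> t m x \<rightarrow>\<^sub>M subprob_algebra (Rn (Suc (t + m)))"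
    using measurable_prob_algebraD[OF step_measurable, of "t + m"] m
    by (simp add: measurable_cong_sets[OF sp(1) refl])
  then have "(\<integral>\<^sup>+w. F w \<partial>cond_path \<kappa> t (Suc m) x) = (\<integral>\<^sup>+z. \<integral>\<^sup>+w. F w \<partial>step (t + m) z \<partial>cond_path \<kappa> t m x)"
    unfolding cond_path_step by (rule nn_integral_bind[OF F])
  also have "\<dots> = (\<integral>\<^sup>+z. \<integral>\<^sup>+r. F (z(Suc (t + m) := r)) \<partial>\<kappa> (t + m) z \<partial>cond_path \<kappa> t m x)"
    using m by (intro nn_integral_cong nn_integral_step) (auto simp: sp)
  finally show ?thesis .
qed

text \<open>The Chapman-Kolmogorov equation for path kernels, by associativity of
  \<open>bind\<close>.\<close>

lemma cond_path_add:
  assumes "t + (m + n) \<le> N" "x \<in> space (Rn t)"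
  shows "cond_path \<kappa> t (m + n) x = cond_path \<kappa> t m x \<bind> cond_path \<kappa> (t + m) n"
  using assms(1)
proof (induction n)
  case 0
  have "cond_path \<kappa> (t + m) 0 = return (Rn (t + m))" by (auto simp: fun_eq_iff)
  then show ?case using 0 assms(2) by (simp add: bind_return'' cond_path_space)
next
  case (Suc n)
  have "cond_path \<kappa> t (m + Suc n) x = (cond_path \<kappa> t m x \<bind> cond_path \<kappa> (t + m) n) \<bind> step (t + m + n)"
    using Suc by (simp only: add_Suc_right cond_path_step add.assoc)
  also have "\<dots> = cond_path \<kappa> t m x \<bind> (\<lambda>y. cond_path \<kappa> (t + m) n y \<bind> step (t + m + n))"
  proof (rule bind_assoc)
    have sp: "sets (cond_path \<kappa> t m x) = sets (Rn (t + m))"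
      using cond_path_space[of t m x] Suc assms(2) by auto
    show "cond_path \<kappa> (t + m) n \<in> cond_path \<kappa> t m x \<rightarrow>\<^sub>M subprob_algebra (Rn (t + m + n))"
      using measurable_prob_algebraD[OF cond_path_measurable, of "t + m" n] Suc.prems
      by (simp add: measurable_cong_sets[OF sp refl] ac_simps)
    show "step (t + m + n) \<in> Rn (t + m + n) \<rightarrow>\<^sub>M subprob_algebra (Rn (Suc (t + m + n)))"
      using Suc.prems by (intro measurable_prob_algebraD step_measurable) simp
  qed
  also have "\<dots> = cond_path \<kappa> t m x \<bind> cond_path \<kappa> (t + m) (Suc n)"
  proof -
    have "(\<lambda>y. cond_path \<kappa> (t + m) n y \<bind> step (t + m + n)) = cond_path \<kappa> (t + m) (Suc n)"
      by (rule ext) (rule cond_path_step[symmetric])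
    then show ?thesis by simp
  qed
  finally show ?case .
qed

text \<open>A conditional path law lives on the full path with a frozen prefix, since each step
  changes only a later coordinate. This lets functions of the prefix be treated as constants in
  conditional integrals.\<close>

lemma AE_cond_path_prefix:
  assumes "t + m \<le> N" "x \<in> space (Rn t)"
  shows "AE z in cond_path \<kappa> t m x. first_coords t z = x"
proof -
  \<comment> \<open>A finite conjunction of equalities between real coordinates is a measurable
    predicate, as \<open>AE_bind\<close> requires; equality of the paths follows at the end by
    extensionality.\<close>
  have "AE z in cond_path \<kappa> t m x. \<forall>i\<in>{1..t}. z i = x i"
    using assms(1)
  proof (induction m)
    case 0
    have "Measurable.pred (Rn t) (\<lambda>z. \<forall>i\<in>{1..t}. z i = x i)" by measurable
    then show ?case unfolding cond_path.simps using assms(2) by (subst AE_return) auto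
  next
    case (Suc m)
    have sp: "sets (cond_path \<kappa> t m x) = sets (Rn (t + m))" "space (cond_path \<kappa> t m x) = space (Rn (t + m))"
      using cond_path_space[of t m x] Suc assms(2) by auto
    have IH: "AE z in cond_path \<kappa> t m x. \<forall>i\<in>{1..t}. z i = x i"
      using Suc by simp
    have "AE z in cond_path \<kappa> t m x. AE w in step (t + m) z. \<forall>i\<in>{1..t}. w i = x i"
      using IH AE_space
    proof eventually_elim
      case (elim z)
      have z: "z \<in> space (Rn (t + m))" and i: "\<forall>i\<in>{1..t}. z i = x i"
        using elim Suc by (auto simp: sp)
      have [measurable_cong]: "sets (\<kappa> (t + m) z) = sets borel"
        using kernel_space[OF kernel, of "t + m" z] z Suc by simp
      have "(\<lambda>r. z(Suc (t + m) := r)) \<in> \<kappa> (t + m) z \<rightarrow>\<^sub>M Rn (Suc (t + m))"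
        using z by measurable
      then show ?case unfolding step_def
        by (subst AE_distr_iff) (use i in auto)
    qed
    moreover have "step (t + m) \<in> cond_path \<kappa> t m x \<rightarrow>\<^sub>M subprob_algebra (Rn (Suc (t + m)))"
      using measurable_prob_algebraD[OF step_measurable, of "t + m"] Suc.prems
      by (simp add: measurable_cong_sets[OF sp(1) refl])
    moreover have "Measurable.pred (Rn (Suc (t + m))) (\<lambda>w. \<forall>i\<in>{1..t}. w i = x i)" by measurable
    ultimately show ?case unfolding cond_path_step by (subst AE_bind)
  qed
  then show ?thesis
    by eventually_elim (use assms(2) in \<open>auto simp: space_Rn restrict_def extensional_def fun_eq_iff\<close>)
qed

definition law :: "nat \<Rightarrow> (nat \<Rightarrow> real) measure" where
  "law t = cond_path \<kappa> 0 t origin0"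

lemma law_space:
  assumes "t \<le> N"
  shows "prob_space (law t)" "sets (law t) = sets (Rn t)" "space (law t) = space (Rn t)"
  using cond_path_space[of 0 t origin0] assms by (auto simp: law_def)

lemma law_add: "t + n \<le> N \<Longrightarrow> law (t + n) = law t \<bind> cond_path \<kappa> t n"
  using cond_path_add[of 0 t n origin0] by (simp add: law_def)

lemma distr_cond_path_prefix:
  assumes "t + m \<le> N" "x \<in> space (Rn t)"
  shows "distr (cond_path \<kappa> t m x) (Rn t) (first_coords t) = return (Rn t) x"
proof -
  interpret prob_space "cond_path \<kappa> t m x" by (rule cond_path_space[OF assms])
  have m: "first_coords t \<in> cond_path \<kappa> t m x \<rightarrow>\<^sub>M Rn t"
    unfolding measurable_cong_sets[OF cond_path_space(2)[OF assms] refl]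
    by (rule first_coords_measurable[where n = "t + m"]) auto
  interpret D: prob_space "distr (cond_path \<kappa> t m x) (Rn t) (first_coords t)"
    by (rule prob_space_distr[OF m])
  have "AE z in distr (cond_path \<kappa> t m x) (Rn t) (first_coords t). z = x"
  proof -
    have "AE z in distr (cond_path \<kappa> t m x) (Rn t) (first_coords t). \<forall>i\<in>{1..t}. z i = x i"
      using AE_cond_path_prefix[OF assms]
      by (subst AE_distr_iff[OF m]) (auto elim!: eventually_mono)
    then show ?thesis using AE_space
      by eventually_elim (use assms(2) in \<open>auto simp: space_Rn extensional_def fun_eq_iff\<close>)
  qed
  then have "distr (cond_path \<kappa> t m x) (Rn t) (first_coords t)
      = return (distr (cond_path \<kappa> t m x) (Rn t) (first_coords t)) x"
    by (rule D.AE_eq_constD(1))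
  also have "\<dots> = return (Rn t) x" by (rule return_cong) simp
  finally show ?thesis .
qed

lemma distr_law_prefix:
  assumes "t + n \<le> N"
  shows "distr (law (t + n)) (Rn t) (first_coords t) = law t"
proof -
  have sp: "sets (law t) = sets (Rn t)" "space (law t) = space (Rn t)"
    using law_space[of t] assms by auto
  have K: "cond_path \<kappa> t n \<in> law t \<rightarrow>\<^sub>M subprob_algebra (Rn (t + n))"
    using measurable_prob_algebraD[OF cond_path_measurable[OF assms]]
    by (simp add: measurable_cong_sets[OF sp(1) refl])
  have "distr (law (t + n)) (Rn t) (first_coords t)
      = law t \<bind> (\<lambda>x. distr (cond_path \<kappa> t n x) (Rn t) (first_coords t))"
    unfolding law_add[OF assms]
    by (rule distr_bind[OF K]) (auto simp: sp intro!: first_coords_measurable[where n = "t + n"])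
  also have "\<dots> = law t \<bind> return (Rn t)"
    by (rule bind_cong) (auto simp: sp distr_cond_path_prefix assms)
  also have "\<dots> = law t" by (rule bind_return''[OF sp(1)])
  finally show ?thesis .
qed

lemma law_Suc: "t < N \<Longrightarrow> law (Suc t) = law t \<bind> step t"
  using cond_path_step[of 0 t origin0] by (simp only: law_def add_0)

end


section \<open>Causal couplings\<close>

abbreviation Rn2 :: "nat \<Rightarrow> ((nat \<Rightarrow> real) \<times> (nat \<Rightarrow> real)) measure" where
  "Rn2 t \<equiv> Rn t \<Otimes>\<^sub>M Rn t"

lemma fst_borel [measurable]: "fst \<in> (borel :: (real \<times> real) measure) \<rightarrow>\<^sub>M borel"
  by (simp add: borel_prod[symmetric])

lemma snd_borel [measurable]: "snd \<in> (borel :: (real \<times> real) measure) \<rightarrow>\<^sub>M borel"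
  by (simp add: borel_prod[symmetric])

lemma Pair_borel: "f \<in> borel_measurable M \<Longrightarrow> h \<in> borel_measurable M \<Longrightarrow>
    (\<lambda>x. (f x, h x)) \<in> M \<rightarrow>\<^sub>M (borel :: (real \<times> real) measure)"
  by (simp add: borel_prod[symmetric])

lemma measurable_change_sets: "f \<in> M \<rightarrow>\<^sub>M L \<Longrightarrow> sets M' = sets M \<Longrightarrow> f \<in> M' \<rightarrow>\<^sub>M L"
  by (simp cong: measurable_cong_sets)

definition upd2 :: "nat \<Rightarrow> (nat \<Rightarrow> real) \<times> (nat \<Rightarrow> real) \<Rightarrow> real \<times> real \<Rightarrow> (nat \<Rightarrow> real) \<times> (nat \<Rightarrow> real)" where
  "upd2 t z r = ((fst z)(Suc t := fst r), (snd z)(Suc t := snd r))"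

lemma upd2_measurable' [measurable]: "(\<lambda>(z, r). upd2 t z r) \<in> Rn2 t \<Otimes>\<^sub>M borel \<rightarrow>\<^sub>M Rn2 (Suc t)"
  unfolding upd2_def by measurable

lemma upd2_measurable: "z \<in> space (Rn2 t) \<Longrightarrow> upd2 t z \<in> borel \<rightarrow>\<^sub>M Rn2 (Suc t)"
  using measurable_compose[OF measurable_Pair1' upd2_measurable'] by (auto simp: split_beta')

locale joint_kernels =
  fixes N :: nat and g :: "nat \<Rightarrow> (nat \<Rightarrow> real) \<times> (nat \<Rightarrow> real) \<Rightarrow> (real \<times> real) measure"
  assumes joint_kernel: "\<And>t. t < N \<Longrightarrow> g t \<in> Rn2 t \<rightarrow>\<^sub>M prob_algebra borel"
begin

definition jstep :: "nat \<Rightarrow> (nat \<Rightarrow> real) \<times> (nat \<Rightarrow> real) \<Rightarrow> ((nat \<Rightarrow> real) \<times> (nat \<Rightarrow> real)) measure" where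
  "jstep t z = distr (g t z) (Rn2 (Suc t)) (upd2 t z)"

lemma jstep_measurable: "t < N \<Longrightarrow> jstep t \<in> Rn2 t \<rightarrow>\<^sub>M prob_algebra (Rn2 (Suc t))"
  unfolding jstep_def by (rule measurable_distr_prob_space2[OF joint_kernel upd2_measurable'])

lemma joint_path_Suc: "joint_path g (Suc t) = joint_path g t \<bind> jstep t"
proof -
  have "(\<lambda>(x, y). distr (g t (x, y)) (Rn2 (Suc t)) (\<lambda>(a, b). (x(Suc t := a), y(Suc t := b)))) = jstep t"
    by (auto simp: fun_eq_iff jstep_def upd2_def[abs_def] split_beta')
  then show ?thesis by simp
qed

lemma joint_path_in_prob_algebra: "t \<le> N \<Longrightarrow> joint_path g t \<in> space (prob_algebra (Rn2 t))"
proof (induction t)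
  case 0
  have "return (Rn2 0) (origin0, origin0) \<in> space (prob_algebra (Rn2 0))"
    by (rule measurable_space[OF measurable_return_prob_space]) (auto simp: space_pair_measure)
  then show ?case by simp
next
  case (Suc t)
  have "prob_space (joint_path g t \<bind> jstep t)" "sets (joint_path g t \<bind> jstep t) = sets (Rn2 (Suc t))"
    using prob_space_bind'[OF Suc.IH jstep_measurable] sets_bind'[OF Suc.IH jstep_measurable] Suc.prems
    by simp_all
  then show ?case unfolding joint_path_Suc by (simp add: space_prob_algebra)
qed

lemma joint_path_space:
  assumes "t \<le> N"
  shows "prob_space (joint_path g t)" "sets (joint_path g t) = sets (Rn2 t)"
    "space (joint_path g t) = space (Rn2 t)"
  using joint_path_in_prob_algebra[OF assms] by (auto simp: space_prob_algebra dest: sets_eq_imp_space_eq)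

lemma joint_path_nonempty: "t \<le> N \<Longrightarrow> space (joint_path g t) \<noteq> {}"
  using joint_path_space(1) prob_space.not_empty by blast

lemma jstep_subprob: "t < N \<Longrightarrow> jstep t \<in> joint_path g t \<rightarrow>\<^sub>M subprob_algebra (Rn2 (Suc t))"
  by (rule measurable_change_sets[OF measurable_prob_algebraD[OF jstep_measurable]])
    (auto simp: joint_path_space)

lemma nn_integral_joint_path_Suc:
  assumes t: "t < N" and F: "F \<in> borel_measurable (Rn2 (Suc t))"
  shows "(\<integral>\<^sup>+z. F z \<partial>joint_path g (Suc t)) = (\<integral>\<^sup>+z. \<integral>\<^sup>+r. F (upd2 t z r) \<partial>g t z \<partial>joint_path g t)"
proof -
  have "(\<integral>\<^sup>+z. F z \<partial>joint_path g (Suc t)) = (\<integral>\<^sup>+z. \<integral>\<^sup>+w. F w \<partial>jstep t z \<partial>joint_path g t)"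
    unfolding joint_path_Suc by (rule nn_integral_bind[OF F jstep_subprob[OF t]])
  also have "\<dots> = (\<integral>\<^sup>+z. \<integral>\<^sup>+r. F (upd2 t z r) \<partial>g t z \<partial>joint_path g t)"
  proof (rule nn_integral_cong)
    fix z assume "z \<in> space (joint_path g t)"
    then have z: "z \<in> space (Rn2 t)" using joint_path_space[of t] t by simp
    have "sets (g t z) = sets borel" using kernel_space[OF joint_kernel[OF t] z] by simp
    then show "(\<integral>\<^sup>+w. F w \<partial>jstep t z) = (\<integral>\<^sup>+r. F (upd2 t z r) \<partial>g t z)"
      unfolding jstep_def using F
      by (intro nn_integral_distr measurable_change_sets[OF upd2_measurable[OF z]]) simp_all
  qed
  finally show ?thesis .
qed

lemma integral_joint_path_Suc:
  fixes F :: "_ \<Rightarrow> real"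
  assumes t: "t < N" and int: "integrable (joint_path g (Suc t)) F"
  shows "integrable (joint_path g t) (\<lambda>z. \<integral>r. F (upd2 t z r) \<partial>g t z)"
    and "AE z in joint_path g t. integrable (g t z) (\<lambda>r. F (upd2 t z r))"
    and "(\<integral>z. F z \<partial>joint_path g (Suc t)) = (\<integral>z. \<integral>r. F (upd2 t z r) \<partial>g t z \<partial>joint_path g t)"
proof -
  have F: "F \<in> borel_measurable (Rn2 (Suc t))"
    using joint_path_space(2)[of "Suc t"] t
    by (intro measurable_change_sets[OF borel_measurable_integrable[OF int]]) simp
  have ne: "space (joint_path g t) \<noteq> {}"
    using joint_path_nonempty[of t] t by simp
  have z: "z \<in> space (joint_path g t) \<Longrightarrow> upd2 t z \<in> g t z \<rightarrow>\<^sub>M Rn2 (Suc t)" for z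
    using kernel_space(2)[OF joint_kernel[OF t], of z] joint_path_space(3)[of t] t
    by (intro measurable_change_sets[OF upd2_measurable[of z t]]) simp_all
  note * = integral_bind_integrable[OF jstep_subprob[OF t] ne int[unfolded joint_path_Suc]]
  have eq: "z \<in> space (joint_path g t) \<Longrightarrow> (\<integral>w. F w \<partial>jstep t z) = (\<integral>r. F (upd2 t z r) \<partial>g t z)" for z
    unfolding jstep_def by (rule integral_distr[OF z F])
  show "integrable (joint_path g t) (\<lambda>z. \<integral>r. F (upd2 t z r) \<partial>g t z)"
    by (rule Bochner_Integration.integrable_cong[THEN iffD1, OF refl _ *(2)]) (rule eq)
  show "AE z in joint_path g t. integrable (g t z) (\<lambda>r. F (upd2 t z r))"
    using *(1) AE_space
  proof eventually_elim
    case (elim z)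
    then show ?case unfolding jstep_def using integrable_distr_eq[OF z F] by simp
  qed
  show "(\<integral>z. F z \<partial>joint_path g (Suc t)) = (\<integral>z. \<integral>r. F (upd2 t z r) \<partial>g t z \<partial>joint_path g t)"
    unfolding joint_path_Suc *(3) by (rule Bochner_Integration.integral_cong[OF refl eq])
qed

end

locale causal_kernels = kernels N \<kappa> + joint_kernels N g for N \<kappa> g +
  assumes fst_marginal:
    "\<And>s x y. s < N \<Longrightarrow> x \<in> space (Rn s) \<Longrightarrow> y \<in> space (Rn s) \<Longrightarrow> distr (g s (x, y)) borel fst = \<kappa> s x"
begin

text \<open>Causality: given the two prefixes, the future of the first path does not depend on the prefix of
  the second.\<close>

lemma nn_integral_joint_path_prefix:
  assumes "t + m \<le> N" and "F \<in> borel_measurable (Rn (t + m) \<Otimes>\<^sub>M Rn t)"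
  shows "(\<integral>\<^sup>+z. F (fst z, first_coords t (snd z)) \<partial>joint_path g (t + m))
    = (\<integral>\<^sup>+z. \<integral>\<^sup>+w. F (w, snd z) \<partial>cond_path \<kappa> t m (fst z) \<partial>joint_path g t)"
  using assms
proof (induction m arbitrary: F)
  case 0
  have [measurable]: "F \<in> borel_measurable (Rn t \<Otimes>\<^sub>M Rn t)" using 0 by simp
  have "(\<integral>\<^sup>+z. F (fst z, first_coords t (snd z)) \<partial>joint_path g t)
      = (\<integral>\<^sup>+z. \<integral>\<^sup>+w. F (w, snd z) \<partial>return (Rn t) (fst z) \<partial>joint_path g t)"
  proof (rule nn_integral_cong)
    fix z assume "z \<in> space (joint_path g t)"
    then have z: "fst z \<in> space (Rn t)" "snd z \<in> space (Rn t)"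
      using joint_path_space[of t] 0 by (auto simp: space_pair_measure)
    have "(\<lambda>w. F (w, snd z)) \<in> borel_measurable (Rn t)" using z by measurable
    then show "F (fst z, first_coords t (snd z)) = (\<integral>\<^sup>+w. F (w, snd z) \<partial>return (Rn t) (fst z))"
      using z by (subst nn_integral_return) (auto simp: first_coords_id)
  qed
  then show ?case by (simp only: add_0_right cond_path.simps)
next
  case (Suc m)
  have [measurable]: "F \<in> borel_measurable (Rn (Suc (t + m)) \<Otimes>\<^sub>M Rn t)" using Suc.prems by simp
  \<comment> \<open>F sees no coordinate of y beyond t, so the newest pair of coordinates enters
    only through its first marginal, which is the kernel at the prefix of x.\<close>
  define F' where "F' z = (\<integral>\<^sup>+a. F ((fst z)(Suc (t + m) := a), snd z) \<partial>\<kappa> (t + m) (fst z))" for z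
  have F': "F' \<in> borel_measurable (Rn (t + m) \<Otimes>\<^sub>M Rn t)"
    unfolding F'_def
  proof (rule nn_integral_measurable_subprob_algebra2[where N = borel])
    show "(\<lambda>z. \<kappa> (t + m) (fst z)) \<in> Rn (t + m) \<Otimes>\<^sub>M Rn t \<rightarrow>\<^sub>M subprob_algebra borel"
      using Suc.prems by (intro measurable_prob_algebraD measurable_compose[OF measurable_fst kernel]) simp
  qed measurable
  have "(\<integral>\<^sup>+z. F (fst z, first_coords t (snd z)) \<partial>joint_path g (Suc (t + m)))
      = (\<integral>\<^sup>+z. \<integral>\<^sup>+r. F (fst (upd2 (t + m) z r), first_coords t (snd (upd2 (t + m) z r))) \<partial>g (t + m) z
          \<partial>joint_path g (t + m))"
    using Suc.prems by (intro nn_integral_joint_path_Suc) auto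
  also have "\<dots> = (\<integral>\<^sup>+z. F' (fst z, first_coords t (snd z)) \<partial>joint_path g (t + m))"
  proof (rule nn_integral_cong)
    fix z assume "z \<in> space (joint_path g (t + m))"
    then have z: "fst z \<in> space (Rn (t + m))" "snd z \<in> space (Rn (t + m))" and zz: "z \<in> space (Rn2 (t + m))"
      using joint_path_space[of "t + m"] Suc.prems by (auto simp: space_pair_measure)
    have s: "sets (g (t + m) z) = sets borel"
      using kernel_space[OF joint_kernel zz] Suc.prems by simp
    have c: "first_coords t ((snd z)(Suc (t + m) := b)) = first_coords t (snd z)" for b
      by (auto simp: restrict_def fun_eq_iff)
    have y: "first_coords t (snd z) \<in> space (Rn t)" by (rule first_coords_in_space)
    have "(\<integral>\<^sup>+r. F (fst (upd2 (t + m) z r), first_coords t (snd (upd2 (t + m) z r))) \<partial>g (t + m) z)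
        = (\<integral>\<^sup>+r. F ((fst z)(Suc (t + m) := fst r), first_coords t (snd z)) \<partial>g (t + m) z)"
      by (simp add: upd2_def c)
    also have "\<dots> = (\<integral>\<^sup>+a. F ((fst z)(Suc (t + m) := a), first_coords t (snd z)) \<partial>distr (g (t + m) z) borel fst)"
    proof (rule nn_integral_distr[symmetric])
      show "fst \<in> g (t + m) z \<rightarrow>\<^sub>M borel" by (rule measurable_change_sets[OF fst_borel s])
      show "(\<lambda>a. F ((fst z)(Suc (t + m) := a), first_coords t (snd z)))
          \<in> borel_measurable (distr (g (t + m) z) borel fst)"
        unfolding measurable_distr_eq1 using z y by measurable
    qed
    also have "distr (g (t + m) z) borel fst = \<kappa> (t + m) (fst z)"
      using fst_marginal[of "t + m" "fst z" "snd z"] z Suc.prems by simp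
    finally show "(\<integral>\<^sup>+r. F (fst (upd2 (t + m) z r), first_coords t (snd (upd2 (t + m) z r))) \<partial>g (t + m) z)
        = F' (fst z, first_coords t (snd z))"
      by (simp only: F'_def fst_conv snd_conv)
  qed
  also have "\<dots> = (\<integral>\<^sup>+z. \<integral>\<^sup>+w. F' (w, snd z) \<partial>cond_path \<kappa> t m (fst z) \<partial>joint_path g t)"
    using Suc.prems by (intro Suc.IH[OF _ F']) simp
  also have "\<dots> = (\<integral>\<^sup>+z. \<integral>\<^sup>+w. F (w, snd z) \<partial>cond_path \<kappa> t (Suc m) (fst z) \<partial>joint_path g t)"
  proof (rule nn_integral_cong)
    fix z assume "z \<in> space (joint_path g t)"
    then have z: "fst z \<in> space (Rn t)" "snd z \<in> space (Rn t)"
      using joint_path_space[of t] Suc.prems by (auto simp: space_pair_measure)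
    have "(\<lambda>w. F (w, snd z)) \<in> borel_measurable (Rn (Suc (t + m)))" using z by measurable
    from nn_integral_cond_path_Suc[OF Suc.prems(1) z(1) this]
    show "(\<integral>\<^sup>+w. F' (w, snd z) \<partial>cond_path \<kappa> t m (fst z))
        = (\<integral>\<^sup>+w. F (w, snd z) \<partial>cond_path \<kappa> t (Suc m) (fst z))"
      unfolding F'_def fst_conv snd_conv by simp
  qed
  finally show ?case by (simp only: add_Suc_right)
qed

text \<open>Causality with the empty prefix, tested on indicators.\<close>

lemma distr_joint_path_fst:
  assumes "t \<le> N"
  shows "distr (joint_path g t) (Rn t) fst = law t"
proof (rule measure_eqI)
  have [measurable_cong]: "sets (joint_path g t) = sets (Rn2 t)" using joint_path_space[OF assms] by simp
  show "sets (distr (joint_path g t) (Rn t) fst) = sets (law t)" using law_space[OF assms] by simp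
  fix A assume "A \<in> sets (distr (joint_path g t) (Rn t) fst)"
  then have [measurable]: "A \<in> sets (Rn t)" by simp
  have "(\<lambda>z. indicator A (fst z) :: ennreal) \<in> borel_measurable (Rn t \<Otimes>\<^sub>M Rn 0)" by measurable
  from nn_integral_joint_path_prefix[of 0 t "\<lambda>z. indicator A (fst z)", unfolded add_0, OF assms this]
  have "(\<integral>\<^sup>+z. indicator A (fst z) \<partial>joint_path g t)
      = (\<integral>\<^sup>+z. \<integral>\<^sup>+w. indicator A w \<partial>cond_path \<kappa> 0 t (fst z) \<partial>return (Rn2 0) (origin0, origin0))"
    by simp
  also have "\<dots> = (\<integral>\<^sup>+w. indicator A w \<partial>law t)"
  proof -
    have "(\<lambda>z. \<integral>\<^sup>+w. indicator A w \<partial>cond_path \<kappa> 0 t (fst z)) \<in> borel_measurable (Rn2 0)"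
      using cond_path_measurable[of 0 t] assms
      by (intro nn_integral_measurable_subprob_algebra2[where N = "Rn t"] measurable_prob_algebraD
          measurable_compose[OF measurable_fst]) auto
    then show ?thesis by (subst nn_integral_return) (auto simp: space_pair_measure law_def)
  qed
  finally have "(\<integral>\<^sup>+z. indicator A (fst z) \<partial>joint_path g t) = emeasure (law t) A"
    using law_space[OF assms] by simp
  moreover have "(\<integral>\<^sup>+z. indicator A (fst z) \<partial>joint_path g t)
      = (\<integral>\<^sup>+w. indicator A w \<partial>distr (joint_path g t) (Rn t) fst)"
    by (subst nn_integral_distr) auto
  ultimately show "emeasure (distr (joint_path g t) (Rn t) fst) A = emeasure (law t) A" by simp
qed

text \<open>Causality as an identity of measures. In this form it extends to integrable functions of
  both signs through \<open>integral_bind_integrable\<close>.\<close>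

lemma distr_joint_path_prefix:
  assumes "t + m \<le> N"
  shows "distr (joint_path g (t + m)) (Rn (t + m) \<Otimes>\<^sub>M Rn t) (\<lambda>z. (fst z, first_coords t (snd z)))
    = joint_path g t \<bind> (\<lambda>z. distr (cond_path \<kappa> t m (fst z)) (Rn (t + m) \<Otimes>\<^sub>M Rn t) (\<lambda>w. (w, snd z)))"
    (is "?L = joint_path g t \<bind> ?K")
    and "(\<lambda>z. distr (cond_path \<kappa> t m (fst z)) (Rn (t + m) \<Otimes>\<^sub>M Rn t) (\<lambda>w. (w, snd z)))
      \<in> joint_path g t \<rightarrow>\<^sub>M subprob_algebra (Rn (t + m) \<Otimes>\<^sub>M Rn t)"
proof -
  have [measurable_cong]: "sets (joint_path g (t + m)) = sets (Rn2 (t + m))"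
    and s [measurable_cong]: "sets (joint_path g t) = sets (Rn2 t)"
    and ne: "space (joint_path g t) \<noteq> {}"
    using joint_path_space[of "t + m"] joint_path_space[of t] joint_path_nonempty[of t] assms by auto
  have "?K \<in> Rn2 t \<rightarrow>\<^sub>M prob_algebra (Rn (t + m) \<Otimes>\<^sub>M Rn t)"
    using measurable_compose[OF measurable_fst cond_path_measurable[OF assms]]
    by (intro measurable_distr_prob_space2[where M = "Rn (t + m)"]) auto
  then show K: "?K \<in> joint_path g t \<rightarrow>\<^sub>M subprob_algebra (Rn (t + m) \<Otimes>\<^sub>M Rn t)"
    using measurable_prob_algebraD by (simp add: measurable_cong_sets[OF s refl])
  have fm: "(\<lambda>z. (fst z, first_coords t (snd z))) \<in> joint_path g (t + m) \<rightarrow>\<^sub>M Rn (t + m) \<Otimes>\<^sub>M Rn t"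
    by (intro measurable_Pair first_coords_measurable[where n = "t + m"]) auto
  show "?L = joint_path g t \<bind> ?K"
  proof (rule measure_eqI)
    show "sets ?L = sets (joint_path g t \<bind> ?K)" using sets_bind_measurable[OF K ne] by simp
    fix A assume "A \<in> sets ?L"
    then have A [measurable]: "A \<in> sets (Rn (t + m) \<Otimes>\<^sub>M Rn t)" by simp
    have "emeasure ?L A = (\<integral>\<^sup>+z. indicator A (fst z, first_coords t (snd z)) \<partial>joint_path g (t + m))"
    proof -
      have "emeasure ?L A = (\<integral>\<^sup>+v. indicator A v \<partial>?L)" by simp
      also have "\<dots> = (\<integral>\<^sup>+z. indicator A (fst z, first_coords t (snd z)) \<partial>joint_path g (t + m))"
        by (rule nn_integral_distr[OF fm]) measurable
      finally show ?thesis .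
    qed
    also have "\<dots> = (\<integral>\<^sup>+z. \<integral>\<^sup>+w. indicator A (w, snd z) \<partial>cond_path \<kappa> t m (fst z) \<partial>joint_path g t)"
      by (rule nn_integral_joint_path_prefix[OF assms]) measurable
    also have "\<dots> = (\<integral>\<^sup>+z. emeasure (?K z) A \<partial>joint_path g t)"
    proof (rule nn_integral_cong)
      fix z assume "z \<in> space (joint_path g t)"
      then have z: "fst z \<in> space (Rn t)" "snd z \<in> space (Rn t)"
        using joint_path_space[of t] assms by (auto simp: space_pair_measure)
      have [measurable_cong]: "sets (cond_path \<kappa> t m (fst z)) = sets (Rn (t + m))"
        using cond_path_space[OF assms z(1)] by simp
      have "(\<lambda>w. (w, snd z)) \<in> cond_path \<kappa> t m (fst z) \<rightarrow>\<^sub>M Rn (t + m) \<Otimes>\<^sub>M Rn t"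
        using z by measurable
      then have "(\<integral>\<^sup>+v. indicator A v \<partial>?K z) = (\<integral>\<^sup>+w. indicator A (w, snd z) \<partial>cond_path \<kappa> t m (fst z))"
        by (rule nn_integral_distr) measurable
      then show "(\<integral>\<^sup>+w. indicator A (w, snd z) \<partial>cond_path \<kappa> t m (fst z)) = emeasure (?K z) A"
        by simp
    qed
    also have "\<dots> = emeasure (joint_path g t \<bind> ?K) A"
      by (rule emeasure_bind[OF ne K A, symmetric])
    finally show "emeasure ?L A = emeasure (joint_path g t \<bind> ?K) A" .
  qed
qed

lemma integral_joint_path_prefix:
  fixes F :: "_ \<Rightarrow> real"
  assumes m: "t + m \<le> N" and F [measurable]: "F \<in> borel_measurable (Rn (t + m) \<Otimes>\<^sub>M Rn t)"
    and int: "integrable (joint_path g (t + m)) (\<lambda>z. F (fst z, first_coords t (snd z)))"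
  shows "integrable (joint_path g t) (\<lambda>z. \<integral>w. F (w, snd z) \<partial>cond_path \<kappa> t m (fst z))"
    and "(\<integral>z. F (fst z, first_coords t (snd z)) \<partial>joint_path g (t + m))
      = (\<integral>z. \<integral>w. F (w, snd z) \<partial>cond_path \<kappa> t m (fst z) \<partial>joint_path g t)"
proof -
  have [measurable_cong]: "sets (joint_path g (t + m)) = sets (Rn2 (t + m))"
    and s [measurable_cong]: "sets (joint_path g t) = sets (Rn2 t)"
    and ne: "space (joint_path g t) \<noteq> {}"
    using joint_path_space[of "t + m"] joint_path_space[of t] joint_path_nonempty[of t] m by auto
  have fm: "(\<lambda>z. (fst z, first_coords t (snd z))) \<in> joint_path g (t + m) \<rightarrow>\<^sub>M Rn (t + m) \<Otimes>\<^sub>M Rn t"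
    by (intro measurable_Pair first_coords_measurable[where n = "t + m"]) auto
  let ?K = "\<lambda>z. distr (cond_path \<kappa> t m (fst z)) (Rn (t + m) \<Otimes>\<^sub>M Rn t) (\<lambda>w. (w, snd z))"
  have int': "integrable (joint_path g t \<bind> ?K) F"
    using int unfolding distr_joint_path_prefix(1)[OF m, symmetric] by (simp add: integrable_distr_eq[OF fm F])
  note * = integral_bind_integrable[OF distr_joint_path_prefix(2)[OF m] ne int']
  have eq: "(\<integral>v. F v \<partial>?K z) = (\<integral>w. F (w, snd z) \<partial>cond_path \<kappa> t m (fst z))"
    if "z \<in> space (joint_path g t)" for z
  proof (rule integral_distr[OF _ F])
    have z: "fst z \<in> space (Rn t)" "snd z \<in> space (Rn t)"
      using that joint_path_space[of t] m by (auto simp: space_pair_measure)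
    have [measurable_cong]: "sets (cond_path \<kappa> t m (fst z)) = sets (Rn (t + m))"
      using cond_path_space[OF m z(1)] by simp
    show "(\<lambda>w. (w, snd z)) \<in> cond_path \<kappa> t m (fst z) \<rightarrow>\<^sub>M Rn (t + m) \<Otimes>\<^sub>M Rn t"
      using z by measurable
  qed
  show "integrable (joint_path g t) (\<lambda>z. \<integral>w. F (w, snd z) \<partial>cond_path \<kappa> t m (fst z))"
    by (rule Bochner_Integration.integrable_cong[THEN iffD1, OF refl _ *(2)]) (rule eq)
  have "(\<integral>z. F (fst z, first_coords t (snd z)) \<partial>joint_path g (t + m)) = (\<integral>v. F v \<partial>(joint_path g t \<bind> ?K))"
    unfolding distr_joint_path_prefix(1)[OF m, symmetric] by (rule integral_distr[OF fm F, symmetric])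
  also have "\<dots> = (\<integral>z. \<integral>w. F (w, snd z) \<partial>cond_path \<kappa> t m (fst z) \<partial>joint_path g t)"
    unfolding *(3) by (rule Bochner_Integration.integral_cong[OF refl eq])
  finally show "(\<integral>z. F (fst z, first_coords t (snd z)) \<partial>joint_path g (t + m))
      = (\<integral>z. \<integral>w. F (w, snd z) \<partial>cond_path \<kappa> t m (fst z) \<partial>joint_path g t)" .
qed

end


section \<open>First-order expansion of the cost\<close>

text \<open>The estimates are done in the l^1 norm because it adds up over coordinates, which suits
  telescoping. The comparisons below lead to and from the p-norm of the assumptions.\<close>

definition norm1 :: "nat \<Rightarrow> (nat \<Rightarrow> real) \<Rightarrow> real" where
  "norm1 n x = (\<Sum>i=1..n. \<bar>x i\<bar>)"

lemma norm1_nonneg [simp]: "norm1 n x \<ge> 0"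
  by (simp add: norm1_def sum_nonneg)

lemma abs_le_norm1: "i \<in> {1..n} \<Longrightarrow> \<bar>x i\<bar> \<le> norm1 n x"
  unfolding norm1_def by (rule member_le_sum) auto

lemma norm1_triangle: "norm1 n (\<lambda>i. x i + y i) \<le> norm1 n x + norm1 n y"
  unfolding norm1_def sum.distrib[symmetric] by (rule sum_mono) simp

lemma norm1_le_diff: "norm1 n y \<le> norm1 n x + norm1 n (\<lambda>i. y i - x i)"
  using norm1_triangle[of n x "\<lambda>i. y i - x i"] by simp

lemma abs_le_pnorm:
  assumes "p > 0" "finite I" "i \<in> I"
  shows "\<bar>x i\<bar> \<le> pnorm p I x"
proof -
  have "\<bar>x i\<bar> = (\<bar>x i\<bar> powr p) powr (1 / p)" using assms by (simp add: powr_powr)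
  also have "\<dots> \<le> pnorm p I x"
    unfolding pnorm_def using assms by (intro powr_mono2 member_le_sum) auto
  finally show ?thesis .
qed

lemma pnorm_nonneg [simp]: "pnorm p I x \<ge> 0"
  by (simp add: pnorm_def)

lemma pnorm_powr: "p > 0 \<Longrightarrow> pnorm p I x powr p = (\<Sum>i\<in>I. \<bar>x i\<bar> powr p)"
  by (simp add: pnorm_def powr_powr sum_nonneg)

lemma pnorm_le_norm1:
  assumes "p > 1"
  shows "pnorm p {1..n} x \<le> norm1 n x"
proof -
  have "(\<Sum>i=1..n. \<bar>x i\<bar> powr p) \<le> (\<Sum>i=1..n. \<bar>x i\<bar> * norm1 n x powr (p - 1))"
  proof (rule sum_mono)
    fix i assume i: "i \<in> {1..n}"
    have "\<bar>x i\<bar> powr p = \<bar>x i\<bar> powr 1 * \<bar>x i\<bar> powr (p - 1)"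
      unfolding powr_add[symmetric] by simp
    also have "\<dots> \<le> \<bar>x i\<bar> * norm1 n x powr (p - 1)"
      using assms abs_le_norm1[OF i] by (auto intro!: mult_left_mono powr_mono2)
    finally show "\<bar>x i\<bar> powr p \<le> \<bar>x i\<bar> * norm1 n x powr (p - 1)" .
  qed
  also have "\<dots> = norm1 n x powr 1 * norm1 n x powr (p - 1)"
    by (simp add: norm1_def sum_distrib_right sum_nonneg)
  also have "\<dots> = norm1 n x powr p" unfolding powr_add[symmetric] by simp
  finally have "pnorm p {1..n} x \<le> (norm1 n x powr p) powr (1 / p)"
    unfolding pnorm_def using assms by (intro powr_mono2) (auto intro!: sum_nonneg)
  then show ?thesis using assms by (simp add: powr_powr)
qed

lemma norm1_powr_le:
  assumes "p > 0"
  shows "norm1 n x powr p \<le> real n powr p * (\<Sum>i=1..n. \<bar>x i\<bar> powr p)"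
proof -
  have "norm1 n x \<le> (\<Sum>i=1..n. pnorm p {1..n} x)"
    unfolding norm1_def using assms by (intro sum_mono abs_le_pnorm) auto
  then have "norm1 n x powr p \<le> (real n * pnorm p {1..n} x) powr p"
    using assms by (intro powr_mono2) auto
  also have "\<dots> = real n powr p * (\<Sum>i=1..n. \<bar>x i\<bar> powr p)"
    using assms by (simp add: powr_mult pnorm_powr)
  finally show ?thesis .
qed

text \<open>Tychonoff: an extensional function space is a full product in which the coordinates
  outside the index set range over a single point.\<close>

lemma compact_PiE_const:
  fixes C :: "real set" and I :: "nat set"
  assumes "compact C"
  shows "compact (PiE I (\<lambda>_. C))"
proof -
  have "PiE I (\<lambda>_. C) = PiE UNIV (\<lambda>i. if i \<in> I then C else {undefined})"
    by (fastforce simp: PiE_def Pi_def extensional_def split: if_splits)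
  moreover have "compactin (product_topology (\<lambda>_. euclidean) UNIV)
      (PiE UNIV (\<lambda>i. if i \<in> I then C else {undefined :: real}))"
    using assms by (auto simp: compactin_PiE)
  ultimately show ?thesis by (simp add: euclidean_product_topology)
qed

text \<open>Uniform continuity refers to the metric of the function type, the estimates to the norm.
  The metric is at most twice the largest among the first coordinate distances plus a vanishing
  tail, and coordinates outside {1..n} agree.\<close>

lemma dist_le_norm1:
  assumes "x \<in> space (Rn n)" "y \<in> space (Rn n)"
  shows "dist x y \<le> 2 * norm1 n (\<lambda>i. x i - y i)"
proof -
  have c: "dist (x i) (y i) \<le> norm1 n (\<lambda>i. x i - y i)" for i
  proof (cases "i \<in> {1..n}")
    case True
    then show ?thesis using abs_le_norm1[OF True, of "\<lambda>i. x i - y i"] by (simp add: dist_real_def)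
  next
    case False
    then have "x i = y i" using assms by (auto simp: space_Rn extensional_def)
    then show ?thesis by simp
  qed
  have "dist x y \<le> 2 * norm1 n (\<lambda>i. x i - y i) + (1/2) ^ m" for m :: nat
  proof -
    have "Max {dist (x (from_nat k)) (y (from_nat k)) |k. k \<le> m} \<le> norm1 n (\<lambda>i. x i - y i)"
      using c by (subst Max_le_iff) auto
    then show ?thesis using dist_fun_le_dist_first_terms[of x y m] by linarith
  qed
  moreover have "(\<lambda>m. 2 * norm1 n (\<lambda>i. x i - y i) + (1/2) ^ m) \<longlonglongrightarrow> 2 * norm1 n (\<lambda>i. x i - y i) + 0"
    by (intro tendsto_intros LIMSEQ_power_zero) simp
  ultimately show ?thesis
    by (intro LIMSEQ_le_const[where X = "\<lambda>m. 2 * norm1 n (\<lambda>i. x i - y i) + (1/2) ^ m"]) auto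
qed

lemma space_upd: "i \<in> {1..n} \<Longrightarrow> x \<in> space (Rn n) \<Longrightarrow> x(i := r) \<in> space (Rn n)"
  by (auto simp: space_Rn extensional_def)

section \<open>Growth and continuity of the gradient, uniformly in the control\<close>

locale smooth_cost = conjugate_exponents p q for p q :: real +
  fixes N :: nat and K :: "real set" and f :: "(nat \<Rightarrow> real) \<Rightarrow> (nat \<Rightarrow> real) \<Rightarrow> real"
    and C \<epsilon>0 :: real
  assumes K: "compact K"
    and f_diff: "\<forall>x\<in>space (Rn N). \<forall>a\<in>Kn K N.
      \<exists>G. has_gradient_within N (\<lambda>x. f x a) G x (space (Rn N))"
    and grad_cont: "continuous_on (space (Rn N) \<times> Kn K N) (\<lambda>(x, a). grad_x N f x a)"
    and C: "C > 0" and eps0: "\<epsilon>0 > 0"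
    and grad_bound: "\<forall>x\<in>space (Rn N). \<forall>a\<in>Kn K N.
      pnorm p {1..N} (grad_x N f x a) \<le> C * (1 + pnorm p {1..N} x powr (p - 1 - \<epsilon>0))"
begin

text \<open>Along the line x(t := r) the Frechet condition becomes the one-variable difference
  quotient, so the \<open>deriv\<close> in \<open>partial\<close> is a genuine derivative.\<close>

lemma has_partial:
  assumes x: "x \<in> space (Rn N)" and a: "a \<in> Kn K N" and t: "t \<in> {1..N}"
  shows "((\<lambda>r. f (x(t := r)) a) has_real_derivative partial t f x a) (at (x t))"
proof -
  let ?F = "\<lambda>y. f y a"
  obtain G where G: "has_gradient_within N ?F G x (space (Rn N))" using f_diff x a by blast
  have lim: "filterlim (\<lambda>r. x(t := r)) (at x within space (Rn N)) (at (x t))"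
    unfolding filterlim_at
  proof
    have "continuous_on UNIV (\<lambda>r. x(t := r))"
    proof (rule continuous_on_coordinatewise_then_product)
      show "continuous_on UNIV (\<lambda>r. (x(t := r)) i)" for i
        by (cases "i = t") (auto intro!: continuous_intros)
    qed
    then have "((\<lambda>r. x(t := r)) \<longlongrightarrow> x(t := x t)) (at (x t))"
      by (simp add: continuous_on_def del: fun_upd_triv)
    then show "((\<lambda>r. x(t := r)) \<longlongrightarrow> x) (at (x t))" by simp
    have "\<forall>\<^sub>F r in at (x t). r \<noteq> x t" by (simp add: eventually_at_filter)
    then show "\<forall>\<^sub>F r in at (x t). x(t := r) \<in> space (Rn N) \<and> x(t := r) \<noteq> x"
      by eventually_elim (use space_upd[OF t x] in \<open>auto simp: fun_eq_iff\<close>)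
  qed
  have s: "(\<Sum>i=1..N. G i * ((x(t := r)) i - x i)) = G t * (r - x t)" for r
  proof -
    have "(\<Sum>i=1..N. G i * ((x(t := r)) i - x i)) = (\<Sum>i=1..N. if i = t then G t * (r - x t) else 0)"
      by (rule sum.cong) auto
    then show ?thesis using t by simp
  qed
  have n: "pnorm 2 {1..N} (\<lambda>i. (x(t := r)) i - x i) = \<bar>r - x t\<bar>" for r
  proof -
    have "(\<Sum>i=1..N. \<bar>(x(t := r)) i - x i\<bar> powr 2) = (\<Sum>i=1..N. if i = t then \<bar>r - x t\<bar> powr 2 else 0)"
      by (rule sum.cong) auto
    then show ?thesis using t unfolding pnorm_def by (simp add: powr_powr del: powr_numeral)
  qed
  have "((\<lambda>r. (?F (x(t := r)) - ?F x - G t * (r - x t)) / \<bar>r - x t\<bar>) \<longlongrightarrow> 0) (at (x t))"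
    using filterlim_compose[OF G[unfolded has_gradient_within_def] lim] unfolding s n .
  \<comment> \<open>The Frechet quotient has a positive denominator and the difference quotient a
    signed one; their absolute values agree.\<close>
  then have "((\<lambda>r. \<bar>(?F (x(t := r)) - ?F x - G t * (r - x t)) / (r - x t)\<bar>) \<longlongrightarrow> 0) (at (x t))"
    using tendsto_rabs_zero by (fastforce simp: abs_divide)
  then have "((\<lambda>r. (?F (x(t := r)) - ?F x - G t * (r - x t)) / (r - x t)) \<longlongrightarrow> 0) (at (x t))"
    by (rule tendsto_rabs_zero_cancel)
  moreover have "\<forall>\<^sub>F r in at (x t). (?F (x(t := r)) - ?F x - G t * (r - x t)) / (r - x t)
      = (?F (x(t := r)) - ?F x) / (r - x t) - G t"
    unfolding eventually_at_filter by (rule always_eventually) (auto simp: field_simps)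
  ultimately have "((\<lambda>r. (?F (x(t := r)) - ?F x) / (r - x t) - G t) \<longlongrightarrow> 0) (at (x t))"
    using tendsto_cong by fast
  then have "((\<lambda>r. (?F (x(t := r)) - ?F x) / (r - x t)) \<longlongrightarrow> G t) (at (x t))"
    by (rule LIM_zero_cancel)
  then have "((\<lambda>r. f (x(t := r)) a) has_real_derivative G t) (at (x t))"
    by (simp add: has_field_derivative_iff)
  then show ?thesis by (simp add: partial_def DERIV_imp_deriv)
qed

lemma has_partial_upd:
  assumes x: "x \<in> space (Rn N)" and a: "a \<in> Kn K N" and t: "t \<in> {1..N}"
  shows "((\<lambda>r. f (x(t := r)) a) has_real_derivative partial t f (x(t := r)) a) (at r)"
  using has_partial[OF space_upd[OF t x] a t, of r] by simp

lemma partial_continuous: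
  assumes t: "t \<in> {1..N}"
  shows "continuous_on (space (Rn N) \<times> Kn K N) (\<lambda>(x, a). partial t f x a)"
proof -
  have "continuous_on (space (Rn N) \<times> Kn K N) (\<lambda>z. (\<lambda>(x, a). grad_x N f x a) z t)"
    using grad_cont by (rule continuous_on_product_then_coordinatewise)
  moreover have "(\<lambda>(x, a). grad_x N f x a) z t = (\<lambda>(x, a). partial t f x a) z" for z
    using t by (auto simp: grad_x_def split: prod.split)
  ultimately show ?thesis by simp
qed

definition cube :: "real \<Rightarrow> (nat \<Rightarrow> real) set" where
  "cube R = PiE {1..N} (\<lambda>_. {- R..R})"

lemma compact_cube: "compact (cube R \<times> Kn K N)"
  unfolding cube_def by (intro compact_Times compact_PiE_const K) simp

lemma cube_subset: "cube R \<subseteq> space (Rn N)"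
  by (auto simp: cube_def space_PiM)

lemma in_cube: "x \<in> space (Rn N) \<Longrightarrow> (\<And>i. i \<in> {1..N} \<Longrightarrow> \<bar>x i\<bar> \<le> R) \<Longrightarrow> x \<in> cube R"
  by (force simp: cube_def space_PiM PiE_iff abs_le_iff)

lemma partial_bounded_on_cube:
  "\<exists>B\<ge>0. \<forall>x\<in>cube R. \<forall>a\<in>Kn K N. \<forall>t\<in>{1..N}. \<bar>partial t f x a\<bar> \<le> B"
proof -
  have "\<exists>B. \<forall>x\<in>cube R. \<forall>a\<in>Kn K N. \<bar>partial t f x a\<bar> \<le> B" if t: "t \<in> {1..N}" for t
  proof -
    have "continuous_on (cube R \<times> Kn K N) (\<lambda>(x, a). partial t f x a)"
      using cube_subset by (intro continuous_on_subset[OF partial_continuous[OF t]]) auto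
    from compact_imp_bounded[OF compact_continuous_image[OF this compact_cube]]
    obtain B where "\<forall>v\<in>(\<lambda>(x, a). partial t f x a) ` (cube R \<times> Kn K N). \<bar>v\<bar> \<le> B"
      by (auto simp: bounded_iff)
    then show ?thesis by force
  qed
  then obtain B where B: "\<And>t x a. t \<in> {1..N} \<Longrightarrow> x \<in> cube R \<Longrightarrow> a \<in> Kn K N \<Longrightarrow> \<bar>partial t f x a\<bar> \<le> B t"
    by metis
  have "\<bar>partial t f x a\<bar> \<le> (\<Sum>t=1..N. \<bar>B t\<bar>)" if "t \<in> {1..N}" "x \<in> cube R" "a \<in> Kn K N" for t x a
    using B[OF that] member_le_sum[of t "{1..N}" "\<lambda>t. \<bar>B t\<bar>"] that by fastforce
  then show ?thesis by (intro exI[of _ "\<Sum>t=1..N. \<bar>B t\<bar>"]) (auto intro: sum_nonneg)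
qed

text \<open>The surplus \<epsilon>0 in the growth exponent makes the gradient of smaller order than
  |x|^(p-1), uniformly in the control. Inside a large cube compactness supplies the additive
  constant.\<close>

lemma partial_growth:
  assumes \<eta>: "\<eta> > 0"
  shows "\<exists>B\<ge>0. \<forall>x\<in>space (Rn N). \<forall>a\<in>Kn K N. \<forall>t\<in>{1..N}. \<bar>partial t f x a\<bar> \<le> \<eta> * norm1 N x powr (p - 1) + B"
proof -
  \<comment> \<open>The growth bound at norm P divided by \<open>P powr (p - 1)\<close>.\<close>
  have "((\<lambda>P. C * (P powr (- (p - 1)) + P powr (- \<epsilon>0))) \<longlongrightarrow> C * (0 + 0)) at_top"
    using p_gt_1 eps0 by (intro tendsto_intros tendsto_neg_powr filterlim_ident) auto
  then have "\<forall>\<^sub>F P in at_top. C * (P powr (- (p - 1)) + P powr (- \<epsilon>0)) < \<eta>"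
    by (rule order_tendstoD) (use \<eta> in simp)
  then obtain R0 where R0: "\<And>P. P \<ge> R0 \<Longrightarrow> C * (P powr (- (p - 1)) + P powr (- \<epsilon>0)) < \<eta>"
    by (auto simp: eventually_at_top_linorder)
  define R where "R = max 1 R0"
  obtain B where B: "B \<ge> 0" "\<And>x a t. x \<in> cube R \<Longrightarrow> a \<in> Kn K N \<Longrightarrow> t \<in> {1..N} \<Longrightarrow> \<bar>partial t f x a\<bar> \<le> B"
    using partial_bounded_on_cube[of R] by blast
  have "\<bar>partial t f x a\<bar> \<le> \<eta> * norm1 N x powr (p - 1) + B"
    if x: "x \<in> space (Rn N)" and a: "a \<in> Kn K N" and t: "t \<in> {1..N}" for x a t
  proof (cases "pnorm p {1..N} x \<ge> R")
    case True
    define P where "P = pnorm p {1..N} x"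
    have P: "P \<ge> R0" "P \<ge> 1" using True by (auto simp: P_def R_def)
    have "\<bar>partial t f x a\<bar> = \<bar>grad_x N f x a t\<bar>" using t by (simp add: grad_x_def)
    also have "\<dots> \<le> pnorm p {1..N} (grad_x N f x a)"
      using p_gt_1 t by (intro abs_le_pnorm) auto
    also have "\<dots> \<le> C * (1 + P powr (p - 1 - \<epsilon>0))" using grad_bound x a by (auto simp: P_def)
    also have "\<dots> = P powr (p - 1) * (C * (P powr (- (p - 1)) + P powr (- \<epsilon>0)))"
    proof -
      have "P powr (p - 1) * P powr (- (p - 1)) = 1"
        unfolding powr_add[symmetric] using P by simp
      moreover have "P powr (p - 1) * P powr (- \<epsilon>0) = P powr (p - 1 - \<epsilon>0)"
        unfolding powr_add[symmetric] by simp
      ultimately show ?thesis by (simp add: algebra_simps)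
    qed
    also have "\<dots> \<le> P powr (p - 1) * \<eta>" using R0[OF P(1)] by (intro mult_left_mono) auto
    also have "\<dots> \<le> norm1 N x powr (p - 1) * \<eta>"
      using \<eta> p_gt_1 pnorm_le_norm1[OF p_gt_1, of N x] by (intro mult_right_mono powr_mono2) (auto simp: P_def)
    finally show ?thesis using B(1) by (simp add: mult.commute)
  next
    case False
    have "x \<in> cube R"
    proof (rule in_cube[OF x])
      fix i assume "i \<in> {1..N}"
      then have "\<bar>x i\<bar> \<le> pnorm p {1..N} x" using p_gt_1 by (intro abs_le_pnorm) auto
      then show "\<bar>x i\<bar> \<le> R" using False by simp
    qed
    then have "\<bar>partial t f x a\<bar> \<le> B" using B a t by blast
    then show ?thesis using \<eta> by (simp add: add_increasing)
  qed
  then show ?thesis using B(1) by blast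
qed

lemma partial_uniformly_continuous:
  assumes \<eta>: "\<eta> > 0"
  shows "\<exists>\<rho>>0. \<forall>x\<in>cube R. \<forall>y\<in>cube R. \<forall>a\<in>Kn K N. \<forall>t\<in>{1..N}.
    norm1 N (\<lambda>i. y i - x i) \<le> \<rho> \<longrightarrow> \<bar>partial t f y a - partial t f x a\<bar> \<le> \<eta>"
proof -
  define P where "P t \<rho> \<longleftrightarrow> \<rho> > 0 \<and> (\<forall>x\<in>cube R. \<forall>y\<in>cube R. \<forall>a\<in>Kn K N.
      norm1 N (\<lambda>i. y i - x i) \<le> \<rho> \<longrightarrow> \<bar>partial t f y a - partial t f x a\<bar> \<le> \<eta>)" for t and \<rho> :: real
  have "\<exists>\<rho>. P t \<rho>" if t: "t \<in> {1..N}" for t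
  proof -
    have "continuous_on (cube R \<times> Kn K N) (\<lambda>(x, a). partial t f x a)"
      using cube_subset by (intro continuous_on_subset[OF partial_continuous[OF t]]) auto
    from compact_uniformly_continuous[OF this compact_cube] \<eta>
    obtain d where d: "d > 0" "\<And>z z'. z \<in> cube R \<times> Kn K N \<Longrightarrow> z' \<in> cube R \<times> Kn K N \<Longrightarrow> dist z' z < d \<Longrightarrow>
        dist ((\<lambda>(x, a). partial t f x a) z') ((\<lambda>(x, a). partial t f x a) z) < \<eta>"
      unfolding uniformly_continuous_on_def by metis
    have "\<bar>partial t f y a - partial t f x a\<bar> \<le> \<eta>"
      if "x \<in> cube R" "y \<in> cube R" "a \<in> Kn K N" "norm1 N (\<lambda>i. y i - x i) \<le> d / 4" for x y a
    proof -
      have "dist y x \<le> 2 * norm1 N (\<lambda>i. y i - x i)"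
        using that cube_subset by (intro dist_le_norm1) auto
      then have "dist (y, a) (x, a) < d" using that d(1) by (simp add: dist_Pair_Pair)
      then show ?thesis using d(2)[of "(x, a)" "(y, a)"] that by (simp add: dist_real_def)
    qed
    \<comment> \<open>\<open>dist_le_norm1\<close> loses a factor 2; the other factor 2 keeps the
      distance strictly below d.\<close>
    then have "P t (d / 4)" using d(1) by (simp add: P_def)
    then show ?thesis ..
  qed
  then have "\<forall>t\<in>{1..N}. \<exists>\<rho>. P t \<rho>" by blast
  then obtain \<rho> where "\<forall>t\<in>{1..N}. P t (\<rho> t)" using bchoice[of "{1..N}" P] by blast
  then have \<rho>: "\<And>t. t \<in> {1..N} \<Longrightarrow> \<rho> t > 0"
      "\<And>t x y a. t \<in> {1..N} \<Longrightarrow> x \<in> cube R \<Longrightarrow> y \<in> cube R \<Longrightarrow> a \<in> Kn K N \<Longrightarrow>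
        norm1 N (\<lambda>i. y i - x i) \<le> \<rho> t \<Longrightarrow> \<bar>partial t f y a - partial t f x a\<bar> \<le> \<eta>"
    unfolding P_def by blast+
  define r where "r = Min (insert 1 (\<rho> ` {1..N}))"
  have "r > 0" unfolding r_def using \<rho>(1) by (subst Min_gr_iff) auto
  moreover have "r \<le> \<rho> t" if "t \<in> {1..N}" for t
    unfolding r_def using that by (intro Min_le) auto
  ultimately show ?thesis using \<rho>(2) by (intro exI[of _ r]) (meson order_trans)
qed

text \<open>There are three regimes. For large x the growth bound is already a small multiple of
  |x|^(p-1). For bounded x and small increments the gradient is uniformly continuous on a cube. For
  bounded x and larger increments every constant is a multiple of |y - x|^(p-1).\<close>

lemma partial_increment:
  assumes \<eta>: "\<eta> > 0"
  shows "\<exists>B\<ge>0. \<forall>x\<in>space (Rn N). \<forall>y\<in>space (Rn N). \<forall>a\<in>Kn K N. \<forall>t\<in>{1..N}.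
    \<bar>partial t f y a - partial t f x a\<bar>
      \<le> \<eta> * (1 + norm1 N x powr (p - 1)) + B * norm1 N (\<lambda>i. y i - x i) powr (p - 1)"
proof -
  \<comment> \<open>Bounding the gradient at y by powers of x and y - x costs the factor k; with the
    gradient at x this gives the coefficient \<eta>'(1 + k), which is to equal \<eta>/2. The other
    half is kept for the constants.\<close>
  define k \<eta>' where "k = 2 powr (p - 1)" and "\<eta>' = \<eta> / (2 * (1 + k))"
  have k: "k > 0" by (simp add: k_def)
  then have \<eta>': "\<eta>' > 0" and \<eta>'k1: "\<eta>' * (1 + k) = \<eta> / 2"
    using \<eta> by (simp_all add: \<eta>'_def field_simps)
  then have "\<eta>' * k \<le> \<eta> / 2" by (simp add: distrib_left)
  note \<eta>'k = \<eta>'k1 this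
  obtain B0 where B0: "B0 \<ge> 0" "\<And>x a t. x \<in> space (Rn N) \<Longrightarrow> a \<in> Kn K N \<Longrightarrow> t \<in> {1..N} \<Longrightarrow>
      \<bar>partial t f x a\<bar> \<le> \<eta>' * norm1 N x powr (p - 1) + B0"
    using partial_growth[OF \<eta>'] by blast
  \<comment> \<open>Beyond R the constant 2 B0 is at most \<eta>/2 times |x|^(p-1); the summand 1
    keeps the base positive.\<close>
  define R where "R = (4 * B0 / \<eta> + 1) powr (1 / (p - 1))"
  have "R powr (p - 1) = 4 * B0 / \<eta> + 1" "R \<ge> 0"
    using p_gt_1 B0(1) \<eta> by (auto simp: R_def powr_powr add_nonneg_pos)
  then have R: "2 * B0 \<le> \<eta> / 2 * R powr (p - 1)" "R \<ge> 0"
    using B0(1) \<eta> by (auto simp: field_simps)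
  obtain \<rho>0 where \<rho>0: "\<rho>0 > 0" "\<And>x y a t. x \<in> cube (R + 1) \<Longrightarrow> y \<in> cube (R + 1) \<Longrightarrow> a \<in> Kn K N \<Longrightarrow>
      t \<in> {1..N} \<Longrightarrow> norm1 N (\<lambda>i. y i - x i) \<le> \<rho>0 \<Longrightarrow> \<bar>partial t f y a - partial t f x a\<bar> \<le> \<eta>"
    using partial_uniformly_continuous[OF \<eta>, of "R + 1"] by blast
  define \<rho> where "\<rho> = min 1 \<rho>0"
  have \<rho>: "\<rho> > 0" "\<rho> \<le> 1" "\<rho> \<le> \<rho>0" using \<rho>0(1) by (auto simp: \<rho>_def)
  \<comment> \<open>The second summand turns the constant 2 B0 into a multiple of |y - x|^(p-1) once
    |y - x| exceeds \<rho>.\<close>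
  define B where "B = \<eta> + 2 * B0 / \<rho> powr (p - 1)"
  have B: "B \<ge> \<eta>" using B0 by (simp add: B_def)
  have "\<bar>partial t f y a - partial t f x a\<bar>
      \<le> \<eta> * (1 + norm1 N x powr (p - 1)) + B * norm1 N (\<lambda>i. y i - x i) powr (p - 1)"
    if x: "x \<in> space (Rn N)" and y: "y \<in> space (Rn N)" and a: "a \<in> Kn K N" and t: "t \<in> {1..N}" for x y a t
  proof -
    define L D where "L = norm1 N x" and "D = norm1 N (\<lambda>i. y i - x i)"
    have LD: "L \<ge> 0" "D \<ge> 0" by (simp_all add: L_def D_def)
    have "norm1 N y powr (p - 1) \<le> \<bar>L + D\<bar> powr (p - 1)"
      using norm1_le_diff[of N y x] p_gt_1 by (intro powr_mono2) (auto simp: L_def D_def)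
    also have "\<dots> \<le> k * (L powr (p - 1) + D powr (p - 1))"
      using abs_add_powr_le[of "p - 1" L D] p_gt_1 LD by (simp add: k_def)
    finally have ly: "\<eta>' * norm1 N y powr (p - 1) \<le> \<eta>' * (k * (L powr (p - 1) + D powr (p - 1)))"
      using \<eta>' by (intro mult_left_mono) auto
    have "\<bar>partial t f y a - partial t f x a\<bar> \<le> \<bar>partial t f y a\<bar> + \<bar>partial t f x a\<bar>" by linarith
    also have "\<dots> \<le> \<eta>' * (k * (L powr (p - 1) + D powr (p - 1))) + \<eta>' * L powr (p - 1) + 2 * B0"
      using B0(2)[OF x a t] B0(2)[OF y a t] ly by (simp add: L_def)
    also have "\<dots> = \<eta>' * (1 + k) * L powr (p - 1) + \<eta>' * k * D powr (p - 1) + 2 * B0"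
      by (simp add: algebra_simps)
    also have "\<dots> \<le> \<eta> / 2 * L powr (p - 1) + \<eta> / 2 * D powr (p - 1) + 2 * B0"
      unfolding \<eta>'k(1) using mult_right_mono[OF \<eta>'k(2), of "D powr (p - 1)"] by simp
    finally have crude: "\<bar>partial t f y a - partial t f x a\<bar>
        \<le> \<eta> / 2 * L powr (p - 1) + \<eta> / 2 * D powr (p - 1) + 2 * B0" .
    have hD: "\<eta> / 2 * D powr (p - 1) \<le> \<eta> * D powr (p - 1)" "\<eta> * D powr (p - 1) \<le> B * D powr (p - 1)"
      using \<eta> B by (auto intro!: mult_right_mono)
    have hL: "\<eta> * (1 + L powr (p - 1)) = \<eta> + \<eta> / 2 * L powr (p - 1) + \<eta> / 2 * L powr (p - 1)"
      by (simp add: algebra_simps)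
    have nonneg: "0 \<le> \<eta> / 2 * L powr (p - 1)" using \<eta> by simp
    consider "L > R" | "L \<le> R" "D \<le> \<rho>" | "L \<le> R" "D > \<rho>" by linarith
    then have "\<bar>partial t f y a - partial t f x a\<bar> \<le> \<eta> * (1 + L powr (p - 1)) + B * D powr (p - 1)"
    proof cases
      case 1
      have "\<eta> / 2 * R powr (p - 1) \<le> \<eta> / 2 * L powr (p - 1)"
        using 1 R(2) \<eta> p_gt_1 by (intro mult_left_mono powr_mono2) auto
      then show ?thesis using crude hD hL R(1) \<eta> by linarith
    next
      case 2
      have "x \<in> cube (R + 1)"
        using abs_le_norm1[of _ N x] 2(1) by (intro in_cube[OF x]) (fastforce simp: L_def)
      moreover have "y \<in> cube (R + 1)"
      proof (rule in_cube[OF y])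
        fix i assume "i \<in> {1..N}"
        then have "\<bar>y i\<bar> \<le> norm1 N y" by (rule abs_le_norm1)
        also have "\<dots> \<le> R + 1" using norm1_le_diff[of N y x] 2 \<rho> by (simp add: L_def D_def)
        finally show "\<bar>y i\<bar> \<le> R + 1" .
      qed
      ultimately have "\<bar>partial t f y a - partial t f x a\<bar> \<le> \<eta>"
        using 2(2) \<rho> by (intro \<rho>0(2) a t) (auto simp: D_def)
      moreover have "0 \<le> B * D powr (p - 1)" using B \<eta> by simp
      ultimately show ?thesis using hL nonneg by linarith
    next
      case 3
      have "\<rho> powr (p - 1) \<le> D powr (p - 1)" using 3 \<rho> p_gt_1 by (intro powr_mono2) auto
      then have "2 * B0 / \<rho> powr (p - 1) * \<rho> powr (p - 1) \<le> 2 * B0 / \<rho> powr (p - 1) * D powr (p - 1)"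
        using B0 by (intro mult_left_mono) auto
      then have "2 * B0 \<le> 2 * B0 / \<rho> powr (p - 1) * D powr (p - 1)" using \<rho> by simp
      moreover have "B * D powr (p - 1) = \<eta> * D powr (p - 1) + 2 * B0 / \<rho> powr (p - 1) * D powr (p - 1)"
        by (simp add: B_def algebra_simps)
      ultimately show ?thesis using crude hD(1) hL nonneg \<eta> by linarith
    qed
    then show ?thesis by (simp add: L_def D_def)
  qed
  then show ?thesis using B \<eta> by (intro exI[of _ B]) auto
qed

text \<open>Replacing the coordinates of x by those of y one at a time reduces the claim to the mean
  value theorem in one variable. All intermediate points lie within the distance |y - x| of x, where
  w bounds the variation of the gradient.\<close>

lemma first_order_telescoping:
  assumes x: "x \<in> space (Rn N)" and y: "y \<in> space (Rn N)" and a: "a \<in> Kn K N"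
    and w: "\<And>z t. z \<in> space (Rn N) \<Longrightarrow> t \<in> {1..N} \<Longrightarrow> norm1 N (\<lambda>i. z i - x i) \<le> norm1 N (\<lambda>i. y i - x i) \<Longrightarrow>
      \<bar>partial t f z a - partial t f x a\<bar> \<le> w"
  shows "\<bar>f y a - f x a - (\<Sum>t=1..N. partial t f x a * (y t - x t))\<bar> \<le> w * norm1 N (\<lambda>i. y i - x i)"
proof -
  define z where "z s = (\<lambda>i. if i \<le> s then y i else x i)" for s :: nat
  have zs: "z s \<in> space (Rn N)" for s using x y by (auto simp: z_def space_Rn extensional_def)
  have z0: "z 0 = x" using x y by (auto simp: z_def space_Rn extensional_def fun_eq_iff)
  have zN: "z N = y" using x y by (auto simp: z_def space_Rn extensional_def fun_eq_iff)
  have step: "\<bar>f (z s) a - f (z (s - 1)) a - partial s f x a * (y s - x s)\<bar> \<le> w * \<bar>y s - x s\<bar>"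
    if s: "s \<in> {1..N}" for s
  proof -
    have zu: "z s = (z (s - 1))(s := y s)" "z (s - 1) = (z (s - 1))(s := x s)"
      using s by (auto simp: z_def fun_eq_iff)
    let ?h = "\<lambda>r. f ((z (s - 1))(s := r)) a"
    have d: "(?h has_real_derivative partial s f ((z (s - 1))(s := r)) a) (at r)" for r
      by (rule has_partial_upd[OF zs a s])
    have "\<exists>r. min (x s) (y s) \<le> r \<and> r \<le> max (x s) (y s) \<and>
        ?h (y s) - ?h (x s) = (y s - x s) * partial s f ((z (s - 1))(s := r)) a"
    proof (cases "x s" "y s" rule: linorder_cases)
      case less
      from MVT2[OF less, of ?h "\<lambda>r. partial s f ((z (s - 1))(s := r)) a"] d
      obtain r where "x s < r" "r < y s"
          "?h (y s) - ?h (x s) = (y s - x s) * partial s f ((z (s - 1))(s := r)) a" by blast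
      then show ?thesis by (intro exI[of _ r]) auto
    next
      case equal then show ?thesis by auto
    next
      case greater
      from MVT2[OF greater, of ?h "\<lambda>r. partial s f ((z (s - 1))(s := r)) a"] d
      obtain r where "y s < r" "r < x s"
          "?h (x s) - ?h (y s) = (x s - y s) * partial s f ((z (s - 1))(s := r)) a" by blast
      then show ?thesis by (intro exI[of _ r]) (auto simp: algebra_simps)
    qed
    then obtain r where r: "min (x s) (y s) \<le> r" "r \<le> max (x s) (y s)"
        "?h (y s) - ?h (x s) = (y s - x s) * partial s f ((z (s - 1))(s := r)) a" by blast
    let ?\<xi> = "(z (s - 1))(s := r)"
    have "\<bar>partial s f ?\<xi> a - partial s f x a\<bar> \<le> w"
    proof (rule w[OF space_upd[OF s zs] s])
      show "norm1 N (\<lambda>i. ?\<xi> i - x i) \<le> norm1 N (\<lambda>i. y i - x i)"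
        unfolding norm1_def using r(1,2) by (intro sum_mono) (auto simp: z_def)
    qed
    then have "\<bar>(partial s f ?\<xi> a - partial s f x a) * (y s - x s)\<bar> \<le> w * \<bar>y s - x s\<bar>"
      by (simp add: abs_mult mult_right_mono)
    moreover have "f (z s) a - f (z (s - 1)) a = (y s - x s) * partial s f ?\<xi> a"
      using r(3) zu by metis
    then have "f (z s) a - f (z (s - 1)) a - partial s f x a * (y s - x s)
        = (partial s f ?\<xi> a - partial s f x a) * (y s - x s)"
      by (simp add: algebra_simps)
    ultimately show ?thesis by simp
  qed
  have "f y a - f x a = (\<Sum>s=1..N. f (z s) a - f (z (s - 1)) a)"
  proof -
    have "(\<Sum>s=1..n. f (z s) a - f (z (s - 1)) a) = f (z n) a - f (z 0) a" for n
      by (induction n) (auto simp: algebra_simps)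
    from this[of N] show ?thesis using z0 zN by simp
  qed
  then have "f y a - f x a - (\<Sum>t=1..N. partial t f x a * (y t - x t))
      = (\<Sum>s=1..N. f (z s) a - f (z (s - 1)) a - partial s f x a * (y s - x s))"
    by (simp add: sum_subtractf)
  also have "\<bar>\<dots>\<bar> \<le> (\<Sum>s=1..N. w * \<bar>y s - x s\<bar>)"
    by (rule order_trans[OF sum_abs sum_mono[OF step]])
  also have "\<dots> = w * norm1 N (\<lambda>i. y i - x i)" by (simp add: norm1_def sum_distrib_left)
  finally show ?thesis .
qed

text \<open>The weights are chosen such that every term on the right is of order \<open>o(\<delta>)\<close> in mean
  as soon as the \<open>p\<close>-th moment of the displacement is of order \<open>\<delta>\<^sup>p\<close>.\<close>

definition expansion :: "real \<Rightarrow> real \<Rightarrow> bool" where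
  "expansion \<eta> B \<longleftrightarrow> 0 \<le> B \<and> (\<forall>\<delta>>0. \<forall>x\<in>space (Rn N). \<forall>y\<in>space (Rn N). \<forall>a\<in>Kn K N.
    \<bar>f y a - f x a - (\<Sum>t=1..N. partial t f x a * (y t - x t))\<bar>
      \<le> \<eta> * \<delta> * (1 + norm1 N x powr p) + (\<eta> * \<delta> / \<delta> powr p + B) * norm1 N (\<lambda>i. y i - x i) powr p)"

text \<open>Young's inequality is applied to 1 + |x|^(p-1) and |y - x| / \<delta>. Dividing by the
  scale \<delta> makes both resulting terms of order one in mean, so the prefactor \<eta> \<delta>
  remains.\<close>

lemma first_order_expansion:
  assumes \<eta>: "\<eta> > 0"
  shows "\<exists>B. expansion \<eta> B"
proof -
  \<comment> \<open>Absorbs the factor 2^q that arises when the q-th power of 1 + |x|^(p-1) is split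
    into 1 and |x|^p.\<close>
  define \<eta>' where "\<eta>' = \<eta> / 2 powr q"
  have \<eta>': "\<eta>' > 0" "\<eta>' \<le> \<eta>" "\<eta>' * 2 powr q = \<eta>"
  proof -
    have "1 \<le> 2 powr q" using q_gt_1 by (intro ge_one_powr_ge_zero) auto
    then have "\<eta> * 1 \<le> \<eta> * 2 powr q" using \<eta> by (intro mult_left_mono) auto
    then show "\<eta>' > 0" "\<eta>' \<le> \<eta>" "\<eta>' * 2 powr q = \<eta>"
      using \<eta> by (auto simp: \<eta>'_def pos_divide_le_eq)
  qed
  obtain B where B: "B \<ge> 0" "\<And>x y a t. x \<in> space (Rn N) \<Longrightarrow> y \<in> space (Rn N) \<Longrightarrow> a \<in> Kn K N \<Longrightarrow> t \<in> {1..N} \<Longrightarrow>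
      \<bar>partial t f y a - partial t f x a\<bar>
        \<le> \<eta>' * (1 + norm1 N x powr (p - 1)) + B * norm1 N (\<lambda>i. y i - x i) powr (p - 1)"
    using partial_increment[OF \<eta>'(1)] by blast
  have "\<bar>f y a - f x a - (\<Sum>t=1..N. partial t f x a * (y t - x t))\<bar>
      \<le> \<eta> * \<delta> * (1 + norm1 N x powr p) + (\<eta> * \<delta> / \<delta> powr p + B) * norm1 N (\<lambda>i. y i - x i) powr p"
    if \<delta>: "\<delta> > 0" and x: "x \<in> space (Rn N)" and y: "y \<in> space (Rn N)" and a: "a \<in> Kn K N" for \<delta> x y a
  proof -
    define L D where "L = norm1 N x" and "D = norm1 N (\<lambda>i. y i - x i)"
    have LD: "L \<ge> 0" "D \<ge> 0" by (simp_all add: L_def D_def)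
    have "\<bar>f y a - f x a - (\<Sum>t=1..N. partial t f x a * (y t - x t))\<bar>
        \<le> (\<eta>' * (1 + L powr (p - 1)) + B * D powr (p - 1)) * D"
      unfolding D_def
    proof (rule first_order_telescoping[OF x y a])
      fix z t assume z: "z \<in> space (Rn N)" and t: "t \<in> {1..N}"
        and le: "norm1 N (\<lambda>i. z i - x i) \<le> norm1 N (\<lambda>i. y i - x i)"
      have "B * norm1 N (\<lambda>i. z i - x i) powr (p - 1) \<le> B * norm1 N (\<lambda>i. y i - x i) powr (p - 1)"
        using le B(1) p_gt_1 by (intro mult_left_mono powr_mono2) auto
      then show "\<bar>partial t f z a - partial t f x a\<bar>
          \<le> \<eta>' * (1 + L powr (p - 1)) + B * norm1 N (\<lambda>i. y i - x i) powr (p - 1)"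
        using B(2)[OF x z a t] by (simp add: L_def)
    qed
    also have "\<dots> = \<eta>' * \<delta> * ((1 + L powr (p - 1)) * (D / \<delta>)) + B * D powr p"
    proof -
      have "D powr (p - 1) * D powr 1 = D powr p" unfolding powr_add[symmetric] by simp
      then have "D powr (p - 1) * D = D powr p" using LD by simp
      then show ?thesis using \<delta> by (simp add: distrib_right mult.assoc)
    qed
    also have "\<dots> \<le> \<eta>' * \<delta> * (2 powr q * (1 + L powr p) + D powr p / \<delta> powr p) + B * D powr p"
    proof -
      have "(1 + L powr (p - 1)) * (D / \<delta>) \<le> (1 + L powr (p - 1)) powr q + (D / \<delta>) powr p"
        using LD \<delta> by (intro Young_weak) auto
      also have "(1 + L powr (p - 1)) powr q \<le> 2 powr q * (1 + (L powr (p - 1)) powr q)"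
        using powr_q_add_le[of 1 "L powr (p - 1)"] by simp
      also have "(L powr (p - 1)) powr q = L powr p" by (simp add: powr_powr p_minus_1_times_q)
      finally have "(1 + L powr (p - 1)) * (D / \<delta>) \<le> 2 powr q * (1 + L powr p) + D powr p / \<delta> powr p"
        using LD \<delta> by (simp add: powr_divide)
      then show ?thesis using \<eta>' \<delta> by (intro add_right_mono mult_left_mono) auto
    qed
    also have "\<dots> = \<eta>' * 2 powr q * \<delta> * (1 + L powr p) + (\<eta>' * \<delta> / \<delta> powr p + B) * D powr p"
      by (simp add: algebra_simps)
    also have "\<dots> \<le> \<eta> * \<delta> * (1 + L powr p) + (\<eta> * \<delta> / \<delta> powr p + B) * D powr p"
      using \<eta>' \<delta> by (intro add_mono mult_right_mono divide_right_mono) auto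
    finally show ?thesis by (simp add: L_def D_def)
  qed
  then have "expansion \<eta> B" using B(1) by (auto simp: expansion_def)
  then show ?thesis ..
qed

end


section \<open>The unperturbed control problem\<close>

lemma measurable_Rn_borel:
  assumes u: "u \<in> M \<rightarrow>\<^sub>M Rn n"
  shows "u \<in> borel_measurable M"
proof (rule measurable_coordinatewise_then_product)
  fix i
  show "(\<lambda>x. u x i) \<in> borel_measurable M"
  proof (cases "i \<in> {1..n}")
    case True
    then show ?thesis using coord_measurable[OF _ _ u] by simp
  next
    case False
    have "u x i = undefined" if "x \<in> space M" for x
      using measurable_space[OF u that] False by (auto simp: space_Rn extensional_def)
    then show ?thesis by (subst measurable_cong[of _ _ "\<lambda>_. undefined"]) auto
  qed
qed

text \<open>On S a superlevel set of F is the trace of an open set, so its preimage under a map into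
  S is the preimage of that open set.\<close>

lemma lower_semicontinuous_measurable:
  assumes lsc: "lower_semicontinuous_on S F"
    and h: "h \<in> borel_measurable M" and S: "\<And>x. x \<in> space M \<Longrightarrow> h x \<in> S"
  shows "(\<lambda>x. F (h x)) \<in> borel_measurable M"
  unfolding borel_measurable_iff_greater
proof
  fix c
  define U where "U = \<Union>{V. open V \<and> (\<forall>y\<in>V \<inter> S. c < F y)}"
  have "open U" by (auto simp: U_def)
  have "c < F z \<longleftrightarrow> z \<in> U" if z: "z \<in> S" for z
  proof
    assume c: "c < F z"
    then have "\<forall>\<^sub>F y in at z within S. c < F y"
      using lsc z by (auto simp: lower_semicontinuous_on_def)
    then obtain V where V: "open V" "z \<in> V" "\<And>y. y \<in> V \<Longrightarrow> y \<noteq> z \<Longrightarrow> y \<in> S \<Longrightarrow> c < F y"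
      by (auto simp: eventually_at_topological)
    then have "\<forall>y\<in>V \<inter> S. c < F y" using c by auto
    then show "z \<in> U" using V(1,2) by (auto simp: U_def)
  next
    assume "z \<in> U"
    then show "c < F z" using z by (auto simp: U_def)
  qed
  then have "{x \<in> space M. c < F (h x)} = h -` U \<inter> space M" using S by auto
  also have "\<dots> \<in> sets M" using h \<open>open U\<close> by (intro measurable_sets[OF h]) auto
  finally show "{x \<in> space M. c < F (h x)} \<in> sets M" .
qed

lemma continuous_imp_lower_semicontinuous_on:
  fixes F :: "'a::topological_space \<Rightarrow> real"
  shows "continuous_on S F \<Longrightarrow> lower_semicontinuous_on S F"
  unfolding lower_semicontinuous_on_def continuous_on_def by (auto intro: order_tendstoD(1))

text \<open>By second countability the complement of the support is covered by countably many basic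
  open sets of measure zero.\<close>

lemma AE_in_spt:
  fixes M :: "'a::second_countable_topology measure"
  assumes M: "\<And>U. open U \<Longrightarrow> U \<inter> space M \<in> sets M"
  shows "AE x in M. x \<in> spt M"
proof -
  obtain B :: "'a set set" where B: "countable B" "topological_basis B"
    using ex_countable_basis by blast
  define B0 where "B0 = {U \<in> B. emeasure M (U \<inter> space M) = 0}"
  have "countable B0" using B(1) by (simp add: B0_def)
  then have "AE x in M. \<forall>U\<in>B0. x \<notin> U \<inter> space M"
  proof (rule AE_ball_countable[THEN iffD2, rule_format])
    fix U assume "U \<in> B0"
    then have "U \<inter> space M \<in> null_sets M"
      using M topological_basis_open[OF B(2)] by (auto simp: B0_def null_sets_def)
    then show "AE x in M. x \<notin> U \<inter> space M" by (rule AE_not_in)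
  qed
  then show ?thesis using AE_space
  proof eventually_elim
    case (elim x)
    have "emeasure M (U \<inter> space M) > 0" if U: "open U" "x \<in> U" for U
    proof -
      obtain V where V: "V \<in> B" "x \<in> V" "V \<subseteq> U" using topological_basisE[OF B(2) U] .
      then have "V \<notin> B0" using elim by auto
      then have "emeasure M (V \<inter> space M) > 0" using V(1) by (auto simp: B0_def zero_less_iff_neq_zero)
      also have "\<dots> \<le> emeasure M (U \<inter> space M)" using V(3) U M by (intro emeasure_mono) auto
      finally show ?thesis .
    qed
    then show ?case using elim by (auto simp: spt_def)
  qed
qed

text \<open>Continuity of the cost in the control comes from here: jointly f is only lower
  semicontinuous, but the relative gradient in \<open>strongly_convex_on\<close> forces continuity
  on K^N.\<close>

lemma has_gradient_within_imp_continuous: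
  assumes G: "has_gradient_within n F G a S" and S: "S \<subseteq> extensional {1..n}" and a: "a \<in> S"
  shows "(F \<longlongrightarrow> F a) (at a within S)"
proof -
  let ?q = "\<lambda>y. (F y - F a - (\<Sum>i=1..n. G i * (y i - a i))) / pnorm 2 {1..n} (\<lambda>i. y i - a i)"
  have c: "((\<lambda>y. y i) \<longlongrightarrow> a i) (at a within S)" for i
    using continuous_on_product_coordinates[of i] by (auto simp: continuous_on_def intro: tendsto_within_subset)
  have "((\<lambda>y. (\<Sum>i=1..n. \<bar>y i - a i\<bar> powr 2) powr (1 / 2)) \<longlongrightarrow> (\<Sum>i=1..n. \<bar>a i - a i\<bar> powr 2) powr (1 / 2)) (at a within S)"
    by (intro tendsto_powr' tendsto_sum tendsto_rabs tendsto_diff c tendsto_const)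
      (auto intro!: always_eventually sum_nonneg)
  then have n: "((\<lambda>y. pnorm 2 {1..n} (\<lambda>i. y i - a i)) \<longlongrightarrow> 0) (at a within S)"
    by (simp add: pnorm_def)
  have "((\<lambda>y. \<Sum>i=1..n. G i * (y i - a i)) \<longlongrightarrow> (\<Sum>i=1..n. G i * (a i - a i))) (at a within S)"
    by (intro tendsto_intros c)
  then have s: "((\<lambda>y. \<Sum>i=1..n. G i * (y i - a i)) \<longlongrightarrow> 0) (at a within S)" by simp
  have "((\<lambda>y. ?q y * pnorm 2 {1..n} (\<lambda>i. y i - a i) + (\<Sum>i=1..n. G i * (y i - a i)) + F a) \<longlongrightarrow> 0 * 0 + 0 + F a) (at a within S)"
    by (intro tendsto_add tendsto_mult n s tendsto_const G[unfolded has_gradient_within_def])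
  moreover have "\<forall>\<^sub>F y in at a within S. ?q y * pnorm 2 {1..n} (\<lambda>i. y i - a i) + (\<Sum>i=1..n. G i * (y i - a i)) + F a = F y"
    unfolding eventually_at_filter
  proof (rule always_eventually, intro allI impI)
    fix y assume y: "y \<noteq> a" "y \<in> S"
    have "pnorm 2 {1..n} (\<lambda>i. y i - a i) \<noteq> 0"
    proof
      assume "pnorm 2 {1..n} (\<lambda>i. y i - a i) = 0"
      then have "y i = a i" if "i \<in> {1..n}" for i
        using abs_le_pnorm[of 2 "{1..n}" i "\<lambda>i. y i - a i"] that by simp
      moreover have "y i = a i" if "i \<notin> {1..n}" for i
        using S a y(2) that extensional_arb[of y "{1..n}"] extensional_arb[of a "{1..n}"] by (metis subsetD)
      ultimately show False using y(1) by blast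
    qed
    then show "?q y * pnorm 2 {1..n} (\<lambda>i. y i - a i) + (\<Sum>i=1..n. G i * (y i - a i)) + F a = F y"
      by simp
  qed
  ultimately show ?thesis using tendsto_cong by fastforce
qed

lemma sequence_tendsto_Rn:
  assumes X: "\<And>n. X n \<in> space (Rn N)" and L: "L \<in> space (Rn N)"
    and lim: "\<And>i. i \<in> {1..N} \<Longrightarrow> (\<lambda>n. X n i) \<longlonglongrightarrow> L i"
  shows "X \<longlonglongrightarrow> L"
proof -
  have "(\<lambda>n. 2 * norm1 N (\<lambda>i. X n i - L i)) \<longlonglongrightarrow> 2 * (\<Sum>i=1..N. \<bar>L i - L i\<bar>)"
    unfolding norm1_def by (intro tendsto_intros lim)
  then have "(\<lambda>n. 2 * norm1 N (\<lambda>i. X n i - L i)) \<longlonglongrightarrow> 0" by simp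
  then have "(\<lambda>n. dist (X n) L) \<longlonglongrightarrow> 0"
    by (rule Lim_null_comparison[rotated]) (auto intro!: always_eventually dist_le_norm1 X L)
  then show ?thesis by (rule tendsto_dist_iff[THEN iffD2])
qed

section \<open>Integrability of costs and the convexity gap between controls\<close>

locale control_problem = smooth_cost p q N K f C \<epsilon>0 + kernels N \<kappa>
  for p q :: real and N :: nat and K :: "real set" and f :: "(nat \<Rightarrow> real) \<Rightarrow> (nat \<Rightarrow> real) \<Rightarrow> real"
    and C \<epsilon>0 :: real and \<kappa> :: "nat \<Rightarrow> (nat \<Rightarrow> real) \<Rightarrow> real measure" +
  fixes \<epsilon> :: "(nat \<Rightarrow> real) \<Rightarrow> real"
  assumes moment: "(\<integral>\<^sup>+ x. ennreal (pnorm p {1..N} x powr p) \<partial>law N) < \<infinity>"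
    and lsc: "lower_semicontinuous_on (space (Rn N) \<times> Kn K N) (\<lambda>(x, a). f x a)"
    and convex: "\<forall>x\<in>spt (law N). strongly_convex_on p N K (\<epsilon> x) (f x)"
    and eps: "AE x in law N. \<epsilon> x > 0"
begin

abbreviation "\<mu> \<equiv> law N"

sublocale \<mu>: prob_space \<mu>
  by (rule law_space) simp

lemma sets_\<mu> [simp, measurable_cong]: "sets \<mu> = sets (Rn N)"
  and space_\<mu> [simp]: "space \<mu> = space (Rn N)"
  using law_space[of N] by auto

lemma coordinate_measurable [measurable]: "i \<in> {1..N} \<Longrightarrow> (\<lambda>x. x i) \<in> borel_measurable (Rn N)"
  using measurable_component_singleton[of i "{1..N}" "\<lambda>_. borel"] by simp

lemma norm1_measurable [measurable]: "norm1 N \<in> borel_measurable (Rn N)"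
  unfolding norm1_def[abs_def] by measurable

lemma integrable_norm1_powr: "integrable \<mu> (\<lambda>x. norm1 N x powr p)"
proof -
  have pw: "pnorm p {1..N} x powr p = (\<Sum>i=1..N. \<bar>x i\<bar> powr p)" for x
    using p_gt_1 by (intro pnorm_powr) simp
  have "integrable \<mu> (\<lambda>x. \<Sum>i=1..N. \<bar>x i\<bar> powr p)"
    using moment unfolding pw by (intro integrableI_nonneg) (auto intro!: AE_I2 sum_nonneg)
  then have "integrable \<mu> (\<lambda>x. real N powr p * (\<Sum>i=1..N. \<bar>x i\<bar> powr p))" by simp
  then show ?thesis
    by (rule Bochner_Integration.integrable_bound)
      (use norm1_powr_le[of p N] p_gt_1 in \<open>auto simp: sum_nonneg\<close>)
qed

lemma AE_spt: "AE x in \<mu>. x \<in> spt \<mu>"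
proof (rule AE_in_spt)
  fix U :: "(nat \<Rightarrow> real) set" assume "open U"
  have "(\<lambda>x. x) \<in> borel_measurable (Rn N)" by (rule measurable_Rn_borel[OF measurable_ident_sets]) simp
  from measurable_sets[OF this, of U] \<open>open U\<close>
  show "U \<inter> space \<mu> \<in> sets \<mu>" by simp
qed

lemma spt_subset: "spt \<mu> \<subseteq> space (Rn N)"
  by (auto simp: spt_def)

lemma spt_nonempty: "\<exists>x. x \<in> spt \<mu>"
proof (rule ccontr)
  assume "\<not> (\<exists>x. x \<in> spt \<mu>)"
  then have "AE x in \<mu>. False" using AE_spt by auto
  then show False by simp
qed

lemma convex_K: "convex K"
  using spt_nonempty convex by (auto simp: strongly_convex_on_def)

lemma cost_continuous:
  assumes x: "x \<in> spt \<mu>"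
  shows "continuous_on (Kn K N) (f x)"
proof -
  from x convex obtain G where G: "\<And>a. a \<in> Kn K N \<Longrightarrow> has_gradient_within N (f x) (G a) a (Kn K N)"
    unfolding strongly_convex_on_def by blast
  show ?thesis unfolding continuous_on_def
    by (intro ballI has_gradient_within_imp_continuous[OF G]) (auto simp: PiE_def)
qed

text \<open>At one point of the support the cost is continuous on the compact set K^N and hence
  bounded. The first-order expansion around that point, with \<delta> = 1, carries the bound to all
  x with growth of order p.\<close>

lemma cost_bound:
  "\<exists>B\<ge>0. \<forall>x\<in>space (Rn N). \<forall>a\<in>Kn K N. \<bar>f x a\<bar> \<le> B * (1 + norm1 N x powr p)"
proof -
  obtain x0 where x0: "x0 \<in> spt \<mu>" using spt_nonempty by blast
  then have x0S: "x0 \<in> space (Rn N)" using spt_subset by auto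
  have "bounded (f x0 ` Kn K N)"
    by (rule compact_imp_bounded[OF compact_continuous_image[OF cost_continuous[OF x0] compact_PiE_const[OF K]]])
  then obtain B0 where B0: "\<And>a. a \<in> Kn K N \<Longrightarrow> \<bar>f x0 a\<bar> \<le> B0"
    by (auto simp: bounded_iff)
  obtain B1 where B1: "B1 \<ge> 0" "\<And>x a t. x \<in> space (Rn N) \<Longrightarrow> a \<in> Kn K N \<Longrightarrow> t \<in> {1..N} \<Longrightarrow>
      \<bar>partial t f x a\<bar> \<le> 1 * norm1 N x powr (p - 1) + B1"
    using partial_growth[of 1] by auto
  obtain B2 where B2: "B2 \<ge> 0" "\<And>\<delta> x y a. \<delta> > 0 \<Longrightarrow> x \<in> space (Rn N) \<Longrightarrow> y \<in> space (Rn N) \<Longrightarrow> a \<in> Kn K N \<Longrightarrow>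
      \<bar>f y a - f x a - (\<Sum>t=1..N. partial t f x a * (y t - x t))\<bar>
      \<le> 1 * \<delta> * (1 + norm1 N x powr p) + (1 * \<delta> / \<delta> powr p + B2) * norm1 N (\<lambda>i. y i - x i) powr p"
    using first_order_expansion[of 1] unfolding expansion_def by auto
  define L0 B3 where "L0 = norm1 N x0" and "B3 = L0 powr (p - 1) + B1"
  define k where "k = 2 powr p"
  have nn: "L0 \<ge> 0" "B3 \<ge> 0" "k \<ge> 0" using B1 by (auto simp: L0_def B3_def k_def)
  define B where "B = \<bar>B0\<bar> + B3 + (1 + L0 powr p) + (B3 + 1 + B2) * k * (1 + L0 powr p)"
  have "\<bar>f x a\<bar> \<le> B * (1 + norm1 N x powr p)" if x: "x \<in> space (Rn N)" and a: "a \<in> Kn K N" for x a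
  proof -
    define D where "D = norm1 N (\<lambda>i. x i - x0 i)"
    have "\<bar>\<Sum>t=1..N. partial t f x0 a * (x t - x0 t)\<bar> \<le> (\<Sum>t=1..N. B3 * \<bar>x t - x0 t\<bar>)"
    proof (rule order_trans[OF sum_abs sum_mono])
      fix t assume "t \<in> {1..N}"
      then show "\<bar>partial t f x0 a * (x t - x0 t)\<bar> \<le> B3 * \<bar>x t - x0 t\<bar>"
        using B1(2)[OF x0S a] by (auto simp: abs_mult B3_def L0_def intro!: mult_right_mono)
    qed
    also have "\<dots> = B3 * D" by (simp add: D_def norm1_def sum_distrib_left)
    also have "\<dots> \<le> B3 * (1 + D powr p)"
    proof (rule mult_left_mono)
      show "D \<le> 1 + D powr p"
      proof (cases "D \<le> 1")
        case False
        then have "D powr 1 \<le> D powr p" using p_gt_1 by (intro powr_mono) auto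
        then show ?thesis using False by simp
      qed (simp add: add_increasing2)
    qed (use nn in simp)
    finally have s: "\<bar>\<Sum>t=1..N. partial t f x0 a * (x t - x0 t)\<bar> \<le> B3 * (1 + D powr p)" .
    have e: "\<bar>f x a - f x0 a - (\<Sum>t=1..N. partial t f x0 a * (x t - x0 t))\<bar>
        \<le> (1 + L0 powr p) + (1 + B2) * D powr p"
      using B2(2)[of 1 x0 x a] x0S x a by (simp add: D_def L0_def)
    have "D \<le> norm1 N x + L0"
      unfolding D_def L0_def norm1_def sum.distrib[symmetric] by (intro sum_mono) simp
    then have "D powr p \<le> \<bar>norm1 N x + L0\<bar> powr p"
      using p_gt_1 by (intro powr_mono2) (auto simp: D_def)
    also have "\<dots> \<le> k * (norm1 N x powr p + L0 powr p)"
      using abs_add_powr_le[of p "norm1 N x" L0] p_gt_1 nn by (simp add: k_def)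
    also have "\<dots> \<le> k * ((1 + L0 powr p) * (1 + norm1 N x powr p))"
      using nn by (intro mult_left_mono) (auto simp: distrib_left distrib_right)
    finally have d: "D powr p \<le> k * ((1 + L0 powr p) * (1 + norm1 N x powr p))" .
    define E Z where "E = \<bar>B0\<bar> + B3 + (1 + L0 powr p)" and "Z = 1 + norm1 N x powr p"
    have E: "E \<ge> 0" using nn by (auto simp: E_def intro!: add_nonneg_nonneg)
    have "\<bar>f x a\<bar> \<le> \<bar>B0\<bar> + B3 * (1 + D powr p) + ((1 + L0 powr p) + (1 + B2) * D powr p)"
      using s e B0[OF a] by linarith
    also have "\<dots> = E + (B3 + 1 + B2) * D powr p" by (simp add: E_def distrib_left distrib_right)
    also have "\<dots> \<le> E * Z + (B3 + 1 + B2) * (k * ((1 + L0 powr p) * Z))"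
    proof (rule add_mono)
      show "E \<le> E * Z" using mult_left_mono[OF _ E, of 1 Z] by (simp add: Z_def)
      show "(B3 + 1 + B2) * D powr p \<le> (B3 + 1 + B2) * (k * ((1 + L0 powr p) * Z))"
        using d nn B2(1) unfolding Z_def by (intro mult_left_mono) auto
    qed
    also have "\<dots> = B * (1 + norm1 N x powr p)"
      by (simp only: B_def E_def[symmetric] Z_def[symmetric] distrib_right mult.assoc)
    finally show ?thesis .
  qed
  moreover have "B \<ge> 0" using nn B2(1) by (auto simp: B_def intro!: add_nonneg_nonneg mult_nonneg_nonneg)
  ultimately show ?thesis by blast
qed

lemma pair_borel:
  assumes "u \<in> M \<rightarrow>\<^sub>M Rn N" "\<beta> \<in> M \<rightarrow>\<^sub>M Rn N"
  shows "(\<lambda>x. (u x, \<beta> x)) \<in> borel_measurable M"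
  using assms by (intro borel_measurable_Pair measurable_Rn_borel)

lemma cost_measurable:
  assumes u: "u \<in> M \<rightarrow>\<^sub>M Rn N" and \<beta>: "\<beta> \<in> M \<rightarrow>\<^sub>M Rn N" and K: "\<And>x. x \<in> space M \<Longrightarrow> \<beta> x \<in> Kn K N"
  shows "(\<lambda>x. f (u x) (\<beta> x)) \<in> borel_measurable M"
  using lower_semicontinuous_measurable[OF lsc pair_borel[OF u \<beta>]] measurable_space[OF u] K by simp

lemma partial_measurable:
  assumes t: "t \<in> {1..N}"
    and u: "u \<in> M \<rightarrow>\<^sub>M Rn N" and \<beta>: "\<beta> \<in> M \<rightarrow>\<^sub>M Rn N" and K: "\<And>x. x \<in> space M \<Longrightarrow> \<beta> x \<in> Kn K N"
  shows "(\<lambda>x. partial t f (u x) (\<beta> x)) \<in> borel_measurable M"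
  using lower_semicontinuous_measurable[OF continuous_imp_lower_semicontinuous_on[OF partial_continuous[OF t]]
      pair_borel[OF u \<beta>]] measurable_space[OF u] K by simp

lemma integrable_cost:
  assumes M: "prob_space M"
    and u: "u \<in> M \<rightarrow>\<^sub>M Rn N" and \<beta>: "\<beta> \<in> M \<rightarrow>\<^sub>M Rn N" and K: "\<And>x. x \<in> space M \<Longrightarrow> \<beta> x \<in> Kn K N"
    and int: "integrable M (\<lambda>x. norm1 N (u x) powr p)"
  shows "integrable M (\<lambda>x. f (u x) (\<beta> x))"
proof -
  interpret prob_space M by fact
  obtain B where B: "B \<ge> 0" "\<And>x a. x \<in> space (Rn N) \<Longrightarrow> a \<in> Kn K N \<Longrightarrow> \<bar>f x a\<bar> \<le> B * (1 + norm1 N x powr p)"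
    using cost_bound by blast
  show ?thesis
  proof (rule Bochner_Integration.integrable_bound)
    show "integrable M (\<lambda>x. B * (1 + norm1 N (u x) powr p))" using int by simp
    show "(\<lambda>x. f (u x) (\<beta> x)) \<in> borel_measurable M" by (rule cost_measurable[OF u \<beta> K])
    show "AE x in M. norm (f (u x) (\<beta> x)) \<le> norm (B * (1 + norm1 N (u x) powr p))"
    proof (rule AE_I2)
      fix x assume "x \<in> space M"
      then show "norm (f (u x) (\<beta> x)) \<le> norm (B * (1 + norm1 N (u x) powr p))"
        using B(2)[OF measurable_space[OF u] K] B(1) by fastforce
    qed
  qed
qed

definition cost :: "((nat \<Rightarrow> real) \<Rightarrow> (nat \<Rightarrow> real)) \<Rightarrow> real" where
  "cost \<beta> = (\<integral>x. f x (\<beta> x) \<partial>\<mu>)"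

lemma controlsD:
  assumes "\<beta> \<in> controls K N"
  shows "\<beta> \<in> Rn N \<rightarrow>\<^sub>M Rn N" "\<And>x. x \<in> space (Rn N) \<Longrightarrow> \<beta> x \<in> Kn K N"
    "\<And>t x x'. t \<in> {1..N} \<Longrightarrow> x \<in> space (Rn N) \<Longrightarrow> x' \<in> space (Rn N) \<Longrightarrow>
       first_coords (t - 1) x = first_coords (t - 1) x' \<Longrightarrow> \<beta> x t = \<beta> x' t"
  using assms unfolding controls_def mem_Collect_eq by (elim conjE, blast)+

lemma control_measurable_\<mu>: "\<beta> \<in> controls K N \<Longrightarrow> \<beta> \<in> \<mu> \<rightarrow>\<^sub>M Rn N"
  by (rule measurable_change_sets[OF controlsD(1)]) auto

lemma integrable_control_cost: "\<beta> \<in> controls K N \<Longrightarrow> integrable \<mu> (\<lambda>x. f x (\<beta> x))"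
  by (rule integrable_cost[OF \<mu>.prob_space_axioms measurable_ident_sets control_measurable_\<mu>])
    (auto simp: integrable_norm1_powr controlsD)

lemma cost_lower_bound: "\<exists>b. \<forall>\<beta>\<in>controls K N. b \<le> cost \<beta>"
proof -
  obtain B where B: "B \<ge> 0" "\<And>x a. x \<in> space (Rn N) \<Longrightarrow> a \<in> Kn K N \<Longrightarrow> \<bar>f x a\<bar> \<le> B * (1 + norm1 N x powr p)"
    using cost_bound by blast
  have "(\<integral>x. - (B * (1 + norm1 N x powr p)) \<partial>\<mu>) \<le> cost \<beta>" if \<beta>: "\<beta> \<in> controls K N" for \<beta>
    unfolding cost_def
  proof (rule integral_mono)
    show "integrable \<mu> (\<lambda>x. - (B * (1 + norm1 N x powr p)))" using integrable_norm1_powr by simp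
    show "- (B * (1 + norm1 N x powr p)) \<le> f x (\<beta> x)" if "x \<in> space \<mu>" for x
      using B(2)[of x "\<beta> x"] controlsD(2)[OF \<beta>, of x] that by auto
  qed (rule integrable_control_cost[OF \<beta>])
  then show ?thesis by blast
qed

definition mid :: "((nat \<Rightarrow> real) \<Rightarrow> (nat \<Rightarrow> real)) \<Rightarrow> ((nat \<Rightarrow> real) \<Rightarrow> (nat \<Rightarrow> real)) \<Rightarrow> ((nat \<Rightarrow> real) \<Rightarrow> (nat \<Rightarrow> real))" where
  "mid \<beta> \<gamma> x = (\<lambda>i\<in>{1..N}. (\<beta> x i + \<gamma> x i) / 2)"

lemma mid_controls:
  assumes \<beta>: "\<beta> \<in> controls K N" and \<gamma>: "\<gamma> \<in> controls K N"
  shows "mid \<beta> \<gamma> \<in> controls K N"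
  unfolding controls_def
proof (intro CollectI conjI ballI impI)
  note [measurable] = controlsD(1)[OF \<beta>] controlsD(1)[OF \<gamma>]
  have "(\<lambda>x. (\<beta> x i + \<gamma> x i) / 2) \<in> borel_measurable (Rn N)" if "i \<in> {1..N}" for i
    using coord_measurable[OF _ _ controlsD(1)[OF \<beta>]] coord_measurable[OF _ _ controlsD(1)[OF \<gamma>]] that
    by auto
  then show "mid \<beta> \<gamma> \<in> Rn N \<rightarrow>\<^sub>M Rn N"
    unfolding mid_def[abs_def] by (rule measurable_restrict)
  show "mid \<beta> \<gamma> x \<in> Kn K N" if "x \<in> space (Rn N)" for x
  proof (rule PiE_I)
    fix i assume i: "i \<in> {1..N}"
    then have "\<beta> x i \<in> K" "\<gamma> x i \<in> K" using controlsD(2)[OF \<beta> that] controlsD(2)[OF \<gamma> that] by auto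
    then have "(1 / 2) *\<^sub>R \<beta> x i + (1 / 2) *\<^sub>R \<gamma> x i \<in> K" by (intro convexD[OF convex_K]) auto
    then show "mid \<beta> \<gamma> x i \<in> K" using i by (simp add: mid_def field_simps)
  qed (auto simp: mid_def)
  show "mid \<beta> \<gamma> x t = mid \<beta> \<gamma> x' t"
    if "t \<in> {1..N}" "x \<in> space (Rn N)" "x' \<in> space (Rn N)" "first_coords (t - 1) x = first_coords (t - 1) x'" for t x x'
    using controlsD(3)[OF \<beta> that] controlsD(3)[OF \<gamma> that] by (simp add: mid_def)
qed

text \<open>The midpoint convexity defect. Pointwise it dominates the squared distance of two
  controls; its integral is small when both are nearly optimal, because the midpoint is again a
  control. It thus turns closeness of costs into closeness of controls.\<close>

definition gap :: "((nat \<Rightarrow> real) \<Rightarrow> (nat \<Rightarrow> real)) \<Rightarrow> ((nat \<Rightarrow> real) \<Rightarrow> (nat \<Rightarrow> real)) \<Rightarrow> (nat \<Rightarrow> real) \<Rightarrow> real" where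
  "gap \<beta> \<gamma> x = (f x (\<beta> x) + f x (\<gamma> x)) / 2 - f x (mid \<beta> \<gamma> x)"

text \<open>Strong convexity is applied at the midpoint towards both ends. The linear terms cancel,
  and each end lies at half the distance, which gives 1/8 after halving the sum. A single coordinate
  is bounded by the p-norm, so no equivalence of norms is involved.\<close>

lemma gap_lower_bound:
  assumes x: "x \<in> spt \<mu>" and e: "\<epsilon> x > 0" and \<beta>: "\<beta> x \<in> Kn K N" and \<gamma>: "\<gamma> x \<in> Kn K N"
    and m: "mid \<beta> \<gamma> x \<in> Kn K N" and i: "i \<in> {1..N}"
  shows "\<epsilon> x / 8 * (\<beta> x i - \<gamma> x i)\<^sup>2 \<le> gap \<beta> \<gamma> x"
proof -
  from x convex obtain G where G: "\<And>a b. a \<in> Kn K N \<Longrightarrow> b \<in> Kn K N \<Longrightarrow> f x b - f x a \<ge>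
      (\<Sum>i=1..N. G a i * (b i - a i)) + 1 / 2 * \<epsilon> x * (pnorm p {1..N} (\<lambda>i. b i - a i))\<^sup>2"
    unfolding strongly_convex_on_def by blast
  let ?m = "mid \<beta> \<gamma> x"
  have sq: "((\<beta> x i - \<gamma> x i) / 2)\<^sup>2 \<le> (pnorm p {1..N} (\<lambda>i. b i - ?m i))\<^sup>2"
    if "b = \<beta> x \<or> b = \<gamma> x" for b
  proof -
    have "\<bar>b i - ?m i\<bar> = \<bar>(\<beta> x i - \<gamma> x i) / 2\<bar>" using that i by (auto simp: mid_def field_simps)
    moreover have "\<bar>b i - ?m i\<bar> \<le> pnorm p {1..N} (\<lambda>i. b i - ?m i)"
      using p_gt_1 i by (intro abs_le_pnorm) auto
    ultimately have "\<bar>(\<beta> x i - \<gamma> x i) / 2\<bar> \<le> pnorm p {1..N} (\<lambda>i. b i - ?m i)" by simp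
    then show ?thesis by (rule abs_le_square_iff[THEN iffD1, OF order_trans]) simp
  qed
  have sum0: "(\<Sum>i=1..N. G ?m i * (\<beta> x i - ?m i)) + (\<Sum>i=1..N. G ?m i * (\<gamma> x i - ?m i)) = 0"
    unfolding sum.distrib[symmetric] by (rule sum.neutral) (auto simp: mid_def field_simps)
  have "1 / 2 * \<epsilon> x * ((\<beta> x i - \<gamma> x i) / 2)\<^sup>2 \<le> 1 / 2 * \<epsilon> x * (pnorm p {1..N} (\<lambda>i. \<beta> x i - ?m i))\<^sup>2"
    "1 / 2 * \<epsilon> x * ((\<beta> x i - \<gamma> x i) / 2)\<^sup>2 \<le> 1 / 2 * \<epsilon> x * (pnorm p {1..N} (\<lambda>i. \<gamma> x i - ?m i))\<^sup>2"
    using e sq by (auto intro!: mult_left_mono)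
  then have "1 / 2 * \<epsilon> x * ((\<beta> x i - \<gamma> x i) / 2)\<^sup>2 + 1 / 2 * \<epsilon> x * ((\<beta> x i - \<gamma> x i) / 2)\<^sup>2
      \<le> (f x (\<beta> x) - f x ?m) + (f x (\<gamma> x) - f x ?m)"
    using G[OF m \<beta>] G[OF m \<gamma>] sum0 by linarith
  then show ?thesis by (simp add: gap_def power2_eq_square field_simps)
qed

lemma AE_gap:
  assumes \<beta>: "\<beta> \<in> controls K N" and \<gamma>: "\<gamma> \<in> controls K N"
  shows "AE x in \<mu>. \<forall>i\<in>{1..N}. \<epsilon> x / 8 * (\<beta> x i - \<gamma> x i)\<^sup>2 \<le> gap \<beta> \<gamma> x"
  using AE_spt eps
proof eventually_elim
  case (elim x)
  then have "x \<in> space (Rn N)" using spt_subset by auto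
  then show ?case
    using gap_lower_bound[OF elim] controlsD(2)[OF \<beta>] controlsD(2)[OF \<gamma>] controlsD(2)[OF mid_controls[OF \<beta> \<gamma>]]
    by auto
qed

lemma AE_gap_nonneg:
  assumes \<beta>: "\<beta> \<in> controls K N" and \<gamma>: "\<gamma> \<in> controls K N" and N: "N \<ge> 1"
  shows "AE x in \<mu>. gap \<beta> \<gamma> x \<ge> 0"
  using AE_gap[OF \<beta> \<gamma>] eps
proof eventually_elim
  case (elim x)
  have "0 \<le> \<epsilon> x / 8 * (\<beta> x 1 - \<gamma> x 1)\<^sup>2" using elim by simp
  then show ?case using elim N by (meson atLeastAtMost_iff order_refl order_trans)
qed

lemma integral_gap:
  assumes \<beta>: "\<beta> \<in> controls K N" and \<gamma>: "\<gamma> \<in> controls K N"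
  shows "integrable \<mu> (gap \<beta> \<gamma>)" "(\<integral>x. gap \<beta> \<gamma> x \<partial>\<mu>) = (cost \<beta> + cost \<gamma>) / 2 - cost (mid \<beta> \<gamma>)"
  using integrable_control_cost[OF \<beta>] integrable_control_cost[OF \<gamma>] integrable_control_cost[OF mid_controls[OF \<beta> \<gamma>]]
  by (simp_all add: gap_def[abs_def] cost_def)

lemma cost_tendsto:
  assumes \<beta>: "\<And>n. \<beta> n \<in> controls K N" and \<alpha>: "\<alpha> \<in> controls K N"
    and lim: "AE x in \<mu>. (\<lambda>n. \<beta> n x) \<longlonglongrightarrow> \<alpha> x"
  shows "(\<lambda>n. cost (\<beta> n)) \<longlonglongrightarrow> cost \<alpha>"
proof -
  obtain B where B: "B \<ge> 0" "\<And>x a. x \<in> space (Rn N) \<Longrightarrow> a \<in> Kn K N \<Longrightarrow> \<bar>f x a\<bar> \<le> B * (1 + norm1 N x powr p)"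
    using cost_bound by blast
  show ?thesis unfolding cost_def
  proof (rule integral_dominated_convergence)
    show "integrable \<mu> (\<lambda>x. B * (1 + norm1 N x powr p))" using integrable_norm1_powr by simp
    show "AE x in \<mu>. (\<lambda>n. f x (\<beta> n x)) \<longlonglongrightarrow> f x (\<alpha> x)"
      using lim AE_spt
    proof eventually_elim
      case (elim x)
      then have x: "x \<in> space (Rn N)" using spt_subset by auto
      have "continuous_on (Kn K N) (f x)" by (rule cost_continuous[OF elim(2)])
      then show ?case
        by (rule continuous_on_tendsto_compose[OF _ elim(1)])
          (use controlsD(2)[OF \<beta> x] controlsD(2)[OF \<alpha> x] in auto)
    qed
    show "AE x in \<mu>. norm (f x (\<beta> n x)) \<le> B * (1 + norm1 N x powr p)" for n
      using B(2) controlsD(2)[OF \<beta>] by auto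
  qed (use integrable_control_cost \<alpha> \<beta> in auto)
qed

end

section \<open>Existence of an optimal control and convergence of nearly optimal ones\<close>

lemma Cauchy_geometric:
  fixes b :: "nat \<Rightarrow> real"
  assumes r: "0 \<le> r" "r < 1" and b: "\<And>n. \<bar>b n - b (Suc n)\<bar> \<le> c * r ^ n"
  shows "Cauchy b"
proof -
  have "summable (\<lambda>n. c * r ^ n)" using r by (intro summable_mult summable_geometric) simp
  then have "summable (\<lambda>n. \<bar>b n - b (Suc n)\<bar>)"
    by (rule summable_comparison_test'[where N = 0]) (use b in simp)
  then have "summable (\<lambda>n. b n - b (Suc n))" by (rule summable_rabs_cancel)
  then have "convergent (\<lambda>n. \<Sum>k<n. b k - b (Suc k))" by (simp add: summable_iff_convergent)
  then have "convergent (\<lambda>n. b 0 - b n)" by (simp add: sum_lessThan_telescope')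
  then obtain L where "(\<lambda>n. b 0 - b n) \<longlonglongrightarrow> L" by (auto simp: convergent_def)
  then have "(\<lambda>n. b 0 - (b 0 - b n)) \<longlonglongrightarrow> b 0 - L" by (intro tendsto_diff tendsto_const)
  then have "b \<longlonglongrightarrow> b 0 - L" by simp
  then show ?thesis by (rule LIMSEQ_imp_Cauchy)
qed

context control_problem
begin

lemma const_control:
  assumes k: "k \<in> K"
  shows "(\<lambda>x. \<lambda>i\<in>{1..N}. k) \<in> controls K N"
  using k by (auto simp: controls_def intro!: measurable_restrict)

text \<open>The gaps weighted by 2^n still have summable integrals, so their sum is finite almost
  everywhere; this sum serves as the constant c.\<close>

lemma AE_uniformly_bounded_gaps:
  assumes \<beta>: "\<And>n. \<beta> n \<in> controls K N" and N: "N \<ge> 1"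
    and gaps: "\<And>n. (\<integral>x. gap (\<beta> n) (\<beta> (Suc n)) x \<partial>\<mu>) \<le> (1/4) ^ n"
  shows "AE x in \<mu>. \<exists>c\<ge>0. \<forall>n. gap (\<beta> n) (\<beta> (Suc n)) x \<le> c * (1/2) ^ n"
proof -
  let ?g = "\<lambda>n x. 2 ^ n * gap (\<beta> n) (\<beta> (Suc n)) x"
  have int: "integrable \<mu> (?g n)" for n using integral_gap(1)[OF \<beta> \<beta>] by simp
  note [measurable] = borel_measurable_integrable[OF int]
  have nn: "AE x in \<mu>. \<forall>n. 0 \<le> ?g n x"
    unfolding AE_all_countable
  proof
    show "AE x in \<mu>. 0 \<le> ?g n x" for n
      using AE_gap_nonneg[OF \<beta> \<beta> N, of n "Suc n"] by eventually_elim simp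
  qed
  have one: "(\<integral>\<^sup>+x. ennreal (?g n x) \<partial>\<mu>) \<le> ennreal ((1/2) ^ n)" for n
  proof -
    have "(\<integral>\<^sup>+x. ennreal (?g n x) \<partial>\<mu>) = ennreal (\<integral>x. ?g n x \<partial>\<mu>)"
      using nn by (intro nn_integral_eq_integral int) (auto elim!: eventually_mono)
    also have "(\<integral>x. ?g n x \<partial>\<mu>) \<le> 2 ^ n * (1/4) ^ n"
      using gaps[of n] by simp
    also have "2 ^ n * (1/4 :: real) ^ n = (1/2) ^ n"
      unfolding power_mult_distrib[symmetric] by simp
    finally show ?thesis by (simp add: ennreal_leI)
  qed
  have "(\<integral>\<^sup>+x. (\<Sum>n. ennreal (?g n x)) \<partial>\<mu>) = (\<Sum>n. \<integral>\<^sup>+x. ennreal (?g n x) \<partial>\<mu>)"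
    by (rule nn_integral_suminf) measurable
  also have "\<dots> \<le> (\<Sum>n. ennreal ((1/2) ^ n))" by (intro suminf_le one) auto
  also have "\<dots> = ennreal (\<Sum>n. (1/2) ^ n)" by (intro suminf_ennreal2 summable_geometric) auto
  finally have "(\<integral>\<^sup>+x. (\<Sum>n. ennreal (?g n x)) \<partial>\<mu>) \<noteq> \<infinity>" by (auto simp: top_unique)
  then have "AE x in \<mu>. (\<Sum>n. ennreal (?g n x)) \<noteq> \<infinity>" by (intro nn_integral_PInf_AE) measurable
  then show ?thesis using nn
  proof eventually_elim
    case (elim x)
    define c where "c = enn2real (\<Sum>n. ennreal (?g n x))"
    have "gap (\<beta> n) (\<beta> (Suc n)) x \<le> c * (1/2) ^ n" for n
    proof -
      have "ennreal (?g n x) \<le> (\<Sum>n. ennreal (?g n x))"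
        using sum_le_suminf[of "\<lambda>n. ennreal (?g n x)" "{n}"] by simp
      also have "\<dots> = ennreal c" using elim(1) by (simp add: c_def ennreal_enn2real_if)
      finally have "?g n x \<le> c" using elim(2) by (simp add: c_def ennreal_le_iff)
      then show ?thesis by (simp add: field_simps)
    qed
    then show ?case by (intro exI[of _ c]) (auto simp: c_def)
  qed
qed

text \<open>Strong convexity replaces compactness of the set of controls: a minimizing sequence
  whose costs converge fast enough is itself Cauchy almost everywhere.\<close>

lemma ex_optimal:
  assumes N: "N \<ge> 1" and K0: "K \<noteq> {}"
  shows "\<exists>\<alpha>\<in>controls K N. \<forall>\<beta>\<in>controls K N. cost \<alpha> \<le> cost \<beta>"
proof -
  obtain k0 where k0: "k0 \<in> K" using K0 by blast
  have ne: "cost ` controls K N \<noteq> {}" using const_control[OF k0] by blast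
  have bdd: "bdd_below (cost ` controls K N)" using cost_lower_bound by (auto simp: bdd_below_def)
  define v where "v = Inf (cost ` controls K N)"
  have v_le: "v \<le> cost \<beta>" if "\<beta> \<in> controls K N" for \<beta>
    unfolding v_def using that by (intro cInf_lower bdd) auto
  \<comment> \<open>The rate 4^(-n) leaves room for the weight 2^n, after which the gaps still decay
    like 2^(-n) pointwise.\<close>
  have "\<exists>\<beta>\<in>controls K N. cost \<beta> < v + (1/4) ^ n" for n :: nat
    using cInf_lessD[OF ne, of "v + (1/4) ^ n"] by (auto simp: v_def)
  then obtain \<beta> where \<beta>: "\<And>n. \<beta> n \<in> controls K N" and lt: "\<And>n. cost (\<beta> n) < v + (1/4) ^ n"
    by metis
  have "(\<integral>x. gap (\<beta> n) (\<beta> (Suc n)) x \<partial>\<mu>) \<le> (1/4) ^ n" for n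
  proof -
    have "(1/4 :: real) ^ Suc n \<le> (1/4) ^ n" by simp
    then show ?thesis
      unfolding integral_gap(2)[OF \<beta> \<beta>]
      using lt[of n] lt[of "Suc n"] v_le[OF mid_controls[OF \<beta> \<beta>, of n "Suc n"]] by argo
  qed
  note bounded = AE_uniformly_bounded_gaps[OF \<beta> N this]
  \<comment> \<open>The gaps bound squared increments, so the increments decay with the square root
    of 1/2.\<close>
  define s where "s = sqrt (1/2 :: real)"
  have s: "0 \<le> s" "s < 1" "s\<^sup>2 = 1/2" by (auto simp: s_def)
  \<comment> \<open>Whether coordinate i converges depends only on the first i - 1 coordinates of x,
    so the case distinction preserves predictability; the default value k0 keeps the control in
    K.\<close>
  define \<alpha> where "\<alpha> x = (\<lambda>i\<in>{1..N}. if Cauchy (\<lambda>n. \<beta> n x i) then lim (\<lambda>n. \<beta> n x i) else k0)" for x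
  have conv: "AE x in \<mu>. \<forall>i\<in>{1..N}. Cauchy (\<lambda>n. \<beta> n x i)"
  proof -
    have "AE x in \<mu>. \<forall>n. \<forall>i\<in>{1..N}. \<epsilon> x / 8 * (\<beta> n x i - \<beta> (Suc n) x i)\<^sup>2 \<le> gap (\<beta> n) (\<beta> (Suc n)) x"
      unfolding AE_all_countable using AE_gap[OF \<beta> \<beta>] by blast
    then show ?thesis using bounded eps
    proof eventually_elim
      case (elim x)
      then obtain c where c: "c \<ge> 0" "\<And>n. gap (\<beta> n) (\<beta> (Suc n)) x \<le> c * (1/2) ^ n" by blast
      show ?case
      proof
        fix i assume i: "i \<in> {1..N}"
        have "\<bar>\<beta> n x i - \<beta> (Suc n) x i\<bar> \<le> sqrt (8 * c / \<epsilon> x) * s ^ n" for n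
        proof -
          have "\<epsilon> x / 8 * (\<beta> n x i - \<beta> (Suc n) x i)\<^sup>2 \<le> c * (1/2) ^ n"
            using elim(1) i c(2)[of n] by (meson order_trans)
          then have "(\<beta> n x i - \<beta> (Suc n) x i)\<^sup>2 \<le> 8 * c / \<epsilon> x * (1/2) ^ n"
            using elim(3) by (simp add: field_simps)
          also have "\<dots> = (sqrt (8 * c / \<epsilon> x) * s ^ n)\<^sup>2"
            using c(1) elim(3) by (simp add: power_mult_distrib s(3)[symmetric] power_even_eq[symmetric] power_mult[symmetric] mult.commute)
          finally have "\<bar>\<beta> n x i - \<beta> (Suc n) x i\<bar> \<le> \<bar>sqrt (8 * c / \<epsilon> x) * s ^ n\<bar>"
            by (simp only: abs_le_square_iff)
          also have "\<dots> = sqrt (8 * c / \<epsilon> x) * s ^ n" using c(1) elim(3) s by (intro abs_of_nonneg) auto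
          finally show ?thesis .
        qed
        then show "Cauchy (\<lambda>n. \<beta> n x i)" by (rule Cauchy_geometric[OF s(1,2)])
      qed
    qed
  qed
  have \<alpha>: "\<alpha> \<in> controls K N"
    unfolding controls_def
  proof (intro CollectI conjI ballI impI)
    have "(\<lambda>x. if Cauchy (\<lambda>n. \<beta> n x i) then lim (\<lambda>n. \<beta> n x i) else k0) \<in> borel_measurable (Rn N)"
      if i: "i \<in> {1..N}" for i
    proof -
      have [measurable]: "(\<lambda>x. \<beta> n x i) \<in> borel_measurable (Rn N)" for n
        using coord_measurable[OF _ _ controlsD(1)[OF \<beta>]] i by simp
      show ?thesis by measurable
    qed
    then show "\<alpha> \<in> Rn N \<rightarrow>\<^sub>M Rn N" unfolding \<alpha>_def[abs_def] by (rule measurable_restrict)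
    show "\<alpha> x \<in> Kn K N" if x: "x \<in> space (Rn N)" for x
    proof (rule PiE_I)
      fix i assume i: "i \<in> {1..N}"
      show "\<alpha> x i \<in> K"
      proof (cases "Cauchy (\<lambda>n. \<beta> n x i)")
        case True
        then have "(\<lambda>n. \<beta> n x i) \<longlonglongrightarrow> lim (\<lambda>n. \<beta> n x i)"
          by (simp add: Cauchy_convergent_iff convergent_LIMSEQ_iff)
        moreover have "\<beta> n x i \<in> K" for n using PiE_mem[OF controlsD(2)[OF \<beta> x] i] .
        ultimately have "lim (\<lambda>n. \<beta> n x i) \<in> K"
          using closed_sequentially[OF compact_imp_closed[OF K], of "\<lambda>n. \<beta> n x i"] by simp
        then show ?thesis using i True by (simp add: \<alpha>_def)
      qed (use i k0 in \<open>simp add: \<alpha>_def\<close>)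
    qed (auto simp: \<alpha>_def)
    show "\<alpha> x t = \<alpha> x' t"
      if "t \<in> {1..N}" "x \<in> space (Rn N)" "x' \<in> space (Rn N)" "first_coords (t - 1) x = first_coords (t - 1) x'" for t x x'
      using controlsD(3)[OF \<beta> that] by (simp add: \<alpha>_def)
  qed
  have "AE x in \<mu>. (\<lambda>n. \<beta> n x) \<longlonglongrightarrow> \<alpha> x"
    using conv AE_space
  proof eventually_elim
    case (elim x)
    then have x: "x \<in> space (Rn N)" by simp
    show ?case
    proof (rule sequence_tendsto_Rn)
      show "\<beta> n x \<in> space (Rn N)" for n by (rule measurable_space[OF controlsD(1)[OF \<beta>] x])
      show "\<alpha> x \<in> space (Rn N)" by (rule measurable_space[OF controlsD(1)[OF \<alpha>] x])
      show "(\<lambda>n. \<beta> n x i) \<longlonglongrightarrow> \<alpha> x i" if "i \<in> {1..N}" for i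
        using elim(1) that by (simp add: \<alpha>_def Cauchy_convergent_iff convergent_LIMSEQ_iff)
    qed
  qed
  from cost_tendsto[OF \<beta> \<alpha> this] have lim: "(\<lambda>n. cost (\<beta> n)) \<longlonglongrightarrow> cost \<alpha>" .
  have "(\<lambda>n. v + (1/4 :: real) ^ n) \<longlonglongrightarrow> v + 0" by (intro tendsto_intros LIMSEQ_power_zero) simp
  then have "cost \<alpha> \<le> v + 0" by (rule LIMSEQ_le[OF lim]) (use lt in \<open>auto intro: less_imp_le\<close>)
  then show ?thesis using \<alpha> v_le by (intro bexI[of _ \<alpha>]) force+
qed

text \<open>The gap to the optimal control is nonnegative with integral at most half the excess
  cost, since the midpoint costs no less than the optimum. It therefore tends to zero in L^1 and,
  along a subsequence, almost everywhere; where \<epsilon> is positive the controls follow.\<close>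

lemma near_optimal_converge:
  assumes N: "N \<ge> 1" and \<alpha>: "\<alpha> \<in> controls K N" and opt: "\<And>\<beta>. \<beta> \<in> controls K N \<Longrightarrow> cost \<alpha> \<le> cost \<beta>"
    and \<beta>: "\<And>n. \<beta> n \<in> controls K N" and lim: "(\<lambda>n. cost (\<beta> n)) \<longlonglongrightarrow> cost \<alpha>"
  obtains r :: "nat \<Rightarrow> nat" where "strict_mono r" "AE x in \<mu>. (\<lambda>n. \<beta> (r n) x) \<longlonglongrightarrow> \<alpha> x"
proof -
  let ?g = "\<lambda>n. gap (\<beta> n) \<alpha>"
  have "(\<lambda>n. (\<integral>x. norm (?g n x) \<partial>\<mu>)) \<longlonglongrightarrow> 0"
  proof (rule Lim_null_comparison)
    have "(\<lambda>n. (cost (\<beta> n) - cost \<alpha>) / 2) \<longlonglongrightarrow> (cost \<alpha> - cost \<alpha>) / 2"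
      by (intro tendsto_intros lim) simp
    then show "(\<lambda>n. (cost (\<beta> n) - cost \<alpha>) / 2) \<longlonglongrightarrow> 0" by simp
    have "norm (\<integral>x. norm (?g n x) \<partial>\<mu>) \<le> (cost (\<beta> n) - cost \<alpha>) / 2" for n
    proof -
      have nn: "AE x in \<mu>. 0 \<le> ?g n x" by (rule AE_gap_nonneg[OF \<beta> \<alpha> N])
      have "(\<integral>x. norm (?g n x) \<partial>\<mu>) = (\<integral>x. ?g n x \<partial>\<mu>)"
        using nn borel_measurable_integrable[OF integral_gap(1)[OF \<beta> \<alpha>]]
        by (intro integral_cong_AE) (auto elim!: eventually_mono)
      also have "\<dots> \<le> (cost (\<beta> n) - cost \<alpha>) / 2"
        unfolding integral_gap(2)[OF \<beta> \<alpha>] using opt[OF mid_controls[OF \<beta> \<alpha>], of n] by argo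
      finally show ?thesis by simp
    qed
    then show "\<forall>\<^sub>F n in sequentially. norm (\<integral>x. norm (?g n x) \<partial>\<mu>) \<le> (cost (\<beta> n) - cost \<alpha>) / 2" by simp
  qed
  from tendsto_L1_AE_subseq[OF integral_gap(1)[OF \<beta> \<alpha>] this]
  obtain r where r: "strict_mono r" "AE x in \<mu>. (\<lambda>n. ?g (r n) x) \<longlonglongrightarrow> 0" by blast
  have "AE x in \<mu>. \<forall>n. \<forall>i\<in>{1..N}. \<epsilon> x / 8 * (\<beta> n x i - \<alpha> x i)\<^sup>2 \<le> ?g n x"
    unfolding AE_all_countable using AE_gap[OF \<beta> \<alpha>] by blast
  then have "AE x in \<mu>. (\<lambda>n. \<beta> (r n) x) \<longlonglongrightarrow> \<alpha> x"
    using r(2) eps AE_space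
  proof eventually_elim
    case (elim x)
    then have x: "x \<in> space (Rn N)" by simp
    show ?case
    proof (rule sequence_tendsto_Rn)
      show "\<beta> (r n) x \<in> space (Rn N)" for n by (rule measurable_space[OF controlsD(1)[OF \<beta>] x])
      show "\<alpha> x \<in> space (Rn N)" by (rule measurable_space[OF controlsD(1)[OF \<alpha>] x])
      show "(\<lambda>n. \<beta> (r n) x i) \<longlonglongrightarrow> \<alpha> x i" if i: "i \<in> {1..N}" for i
      proof -
        have "(\<lambda>n. 8 / \<epsilon> x * ?g (r n) x) \<longlonglongrightarrow> 8 / \<epsilon> x * 0" by (intro tendsto_intros elim(2))
        then have lim0: "(\<lambda>n. 8 / \<epsilon> x * ?g (r n) x) \<longlonglongrightarrow> 0" by simp
        have "(\<beta> (r n) x i - \<alpha> x i)\<^sup>2 \<le> 8 / \<epsilon> x * ?g (r n) x" for n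
        proof -
          have "\<epsilon> x / 8 * (\<beta> (r n) x i - \<alpha> x i)\<^sup>2 \<le> ?g (r n) x" using elim(1) i by blast
          then show ?thesis using elim(3) by (simp add: field_simps)
        qed
        then have "(\<lambda>n. (\<beta> (r n) x i - \<alpha> x i)\<^sup>2) \<longlonglongrightarrow> 0"
          by (intro Lim_null_comparison[OF _ lim0]) auto
        then have "(\<lambda>n. sqrt ((\<beta> (r n) x i - \<alpha> x i)\<^sup>2)) \<longlonglongrightarrow> sqrt 0" by (rule tendsto_real_sqrt)
        then have "(\<lambda>n. \<bar>\<beta> (r n) x i - \<alpha> x i\<bar>) \<longlonglongrightarrow> 0" by simp
        then have "(\<lambda>n. \<beta> (r n) x i - \<alpha> x i) \<longlonglongrightarrow> 0" by (rule tendsto_rabs_zero_cancel)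
        then show ?thesis by (rule LIM_zero_cancel)
      qed
    qed
  qed
  then show ?thesis using that r(1) by blast
qed

end


section \<open>The sensitivity functional\<close>

text \<open>Pushing the kernel forward under y \<mapsto> (x, y) turns an integrand that depends on x
  into one fixed function, integrated against a measurably varying measure.\<close>

lemma integral_measurable_kernel:
  fixes f :: "'a \<Rightarrow> 'b \<Rightarrow> real"
  assumes f: "(\<lambda>(x, y). f x y) \<in> borel_measurable (M \<Otimes>\<^sub>M N)"
    and L: "L \<in> M \<rightarrow>\<^sub>M subprob_algebra N"
  shows "(\<lambda>x. \<integral>y. f x y \<partial>L x) \<in> borel_measurable M"
    and "Measurable.pred M (\<lambda>x. integrable (L x) (f x))"
proof -
  have D: "(\<lambda>x. distr (L x) (M \<Otimes>\<^sub>M N) (Pair x)) \<in> M \<rightarrow>\<^sub>M subprob_algebra (M \<Otimes>\<^sub>M N)"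
    by (rule measurable_distr2[OF _ L]) simp
  have P: "Pair x \<in> L x \<rightarrow>\<^sub>M M \<Otimes>\<^sub>M N" if "x \<in> space M" for x
    by (rule measurable_change_sets[OF measurable_Pair1' sets_kernel[OF L]]) (use that in auto)
  show "(\<lambda>x. \<integral>y. f x y \<partial>L x) \<in> borel_measurable M"
    by (rule measurable_cong[THEN iffD1, OF _ measurable_compose[OF D integral_measurable_subprob_algebra[OF f]]])
      (simp add: integral_distr[OF P f])
  show "Measurable.pred M (\<lambda>x. integrable (L x) (f x))"
    by (rule measurable_cong[THEN iffD1, OF _ measurable_compose[OF D integrable_measurable_subprob_algebra[OF f]]])
      (simp add: integrable_distr_eq[OF P f])
qed

context kernels
begin

lemma integral_step:
  fixes F :: "_ \<Rightarrow> real"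
  assumes t: "t < N" and z: "z \<in> space (Rn t)" and F: "F \<in> borel_measurable (Rn (Suc t))"
  shows "(\<integral>w. F w \<partial>step t z) = (\<integral>r. F (z(Suc t := r)) \<partial>\<kappa> t z)"
    and "integrable (step t z) F \<longleftrightarrow> integrable (\<kappa> t z) (\<lambda>r. F (z(Suc t := r)))"
proof -
  have s: "sets (\<kappa> t z) = sets borel"
    using kernel_space[OF kernel[OF t] z] by simp
  have "(\<lambda>r. z(Suc t := r)) \<in> borel \<rightarrow>\<^sub>M Rn (Suc t)" using z by measurable
  then have m: "(\<lambda>r. z(Suc t := r)) \<in> \<kappa> t z \<rightarrow>\<^sub>M Rn (Suc t)" by (rule measurable_change_sets[OF _ s])
  show "(\<integral>w. F w \<partial>step t z) = (\<integral>r. F (z(Suc t := r)) \<partial>\<kappa> t z)"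
    "integrable (step t z) F \<longleftrightarrow> integrable (\<kappa> t z) (\<lambda>r. F (z(Suc t := r)))"
    unfolding step_def by (rule integral_distr[OF m F], rule integrable_distr_eq[OF m F])
qed

lemma integral_law_Suc:
  fixes F :: "_ \<Rightarrow> real"
  assumes t: "t < N" and int: "integrable (law (Suc t)) F"
  shows "AE x in law t. integrable (\<kappa> t x) (\<lambda>r. F (x(Suc t := r)))"
    and "integrable (law t) (\<lambda>x. \<integral>r. F (x(Suc t := r)) \<partial>\<kappa> t x)"
    and "(\<integral>x. F x \<partial>law (Suc t)) = (\<integral>x. \<integral>r. F (x(Suc t := r)) \<partial>\<kappa> t x \<partial>law t)"
proof -
  have sp: "sets (law t) = sets (Rn t)" "space (law t) = space (Rn t)" using law_space[of t] t by auto
  have F: "F \<in> borel_measurable (Rn (Suc t))"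
    using law_space(2)[of "Suc t"] t
    by (intro measurable_change_sets[OF borel_measurable_integrable[OF int]]) simp
  have K: "step t \<in> law t \<rightarrow>\<^sub>M subprob_algebra (Rn (Suc t))"
    by (rule measurable_change_sets[OF measurable_prob_algebraD[OF step_measurable[OF t]] sp(1)])
  have ne: "space (law t) \<noteq> {}" by (simp add: sp)
  note * = integral_bind_integrable[OF K ne int[unfolded law_Suc[OF t]]]
  show "AE x in law t. integrable (\<kappa> t x) (\<lambda>r. F (x(Suc t := r)))"
    using *(1) AE_space by eventually_elim (simp add: integral_step(2)[OF t _ F] sp)
  show "integrable (law t) (\<lambda>x. \<integral>r. F (x(Suc t := r)) \<partial>\<kappa> t x)"
    by (rule Bochner_Integration.integrable_cong[THEN iffD1, OF refl _ *(2)])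
      (simp_all add: sp integral_step(1)[OF t _ F])
  show "(\<integral>x. F x \<partial>law (Suc t)) = (\<integral>x. \<integral>r. F (x(Suc t := r)) \<partial>\<kappa> t x \<partial>law t)"
    unfolding law_Suc[OF t] *(3)
    by (rule Bochner_Integration.integral_cong[OF refl]) (simp add: integral_step(1)[OF t _ F] sp)
qed

lemma integral_law_cond_path:
  fixes F :: "_ \<Rightarrow> real"
  assumes t: "t \<le> N" and int: "integrable (law N) F"
  shows "AE x in law t. integrable (cond_path \<kappa> t (N - t) x) F"
    and "integrable (law t) (\<lambda>x. \<integral>z. F z \<partial>cond_path \<kappa> t (N - t) x)"
    and "(\<integral>x. F x \<partial>law N) = (\<integral>x. \<integral>z. F z \<partial>cond_path \<kappa> t (N - t) x \<partial>law t)"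
proof -
  have sp: "sets (law t) = sets (Rn t)" "space (law t) = space (Rn t)" using law_space[of t] t by auto
  have K: "cond_path \<kappa> t (N - t) \<in> law t \<rightarrow>\<^sub>M subprob_algebra (Rn (t + (N - t)))"
    using t by (intro measurable_change_sets[OF measurable_prob_algebraD[OF cond_path_measurable] sp(1)]) simp
  have L: "law N = law t \<bind> cond_path \<kappa> t (N - t)" using law_add[of t "N - t"] t by simp
  note * = integral_bind_integrable[OF K _ int[unfolded L]]
  show "AE x in law t. integrable (cond_path \<kappa> t (N - t) x) F"
    "integrable (law t) (\<lambda>x. \<integral>z. F z \<partial>cond_path \<kappa> t (N - t) x)"
    using *(1,2) by (simp_all add: sp)
  show "(\<integral>x. F x \<partial>law N) = (\<integral>x. \<integral>z. F z \<partial>cond_path \<kappa> t (N - t) x \<partial>law t)"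
    unfolding L using *(3) by (simp add: sp)
qed

end

section \<open>Conditional gradients, residual norms and extremal directions of a control\<close>

context control_problem
begin

definition pgrad :: "((nat \<Rightarrow> real) \<Rightarrow> (nat \<Rightarrow> real)) \<Rightarrow> nat \<Rightarrow> (nat \<Rightarrow> real) \<Rightarrow> real" where
  "pgrad \<alpha> t x = partial t f x (\<alpha> x)"

text \<open>A version of the conditional expectation of the partial derivative given the first t
  coordinates, fixed at every prefix by the kernels.\<close>

definition cgrad :: "((nat \<Rightarrow> real) \<Rightarrow> (nat \<Rightarrow> real)) \<Rightarrow> nat \<Rightarrow> (nat \<Rightarrow> real) \<Rightarrow> real" where
  "cgrad \<alpha> t x = (\<integral>z. pgrad \<alpha> t z \<partial>cond_path \<kappa> t (N - t) x)"

definition good :: "((nat \<Rightarrow> real) \<Rightarrow> (nat \<Rightarrow> real)) \<Rightarrow> nat \<Rightarrow> (nat \<Rightarrow> real) \<Rightarrow> bool" where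
  "good \<alpha> s x \<longleftrightarrow> integrable (\<kappa> s x) (\<lambda>r. \<bar>cgrad \<alpha> (Suc s) (x(Suc s := r))\<bar> powr q)"

text \<open>The truncation to good prefixes, which have full measure, makes the one-dimensional duality
  available for every prefix.\<close>

definition ngrad :: "((nat \<Rightarrow> real) \<Rightarrow> (nat \<Rightarrow> real)) \<Rightarrow> nat \<Rightarrow> (nat \<Rightarrow> real) \<Rightarrow> real \<Rightarrow> real" where
  "ngrad \<alpha> s x r = (if good \<alpha> s x then cgrad \<alpha> (Suc s) (x(Suc s := r)) else 0)"

text \<open>The locale constants take the measure and the function as arguments and so depend on the
  prefix as a parameter; their properties at each prefix come from
  \<open>shifted_Lq_ngrad\<close>.\<close>

definition residual :: "((nat \<Rightarrow> real) \<Rightarrow> (nat \<Rightarrow> real)) \<Rightarrow> nat \<Rightarrow> (nat \<Rightarrow> real) \<Rightarrow> real" where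
  "residual \<alpha> s x = shifted_Lq.residual_moment q (\<kappa> s x) (ngrad \<alpha> s x) powr (1 / q)"

definition direction :: "((nat \<Rightarrow> real) \<Rightarrow> (nat \<Rightarrow> real)) \<Rightarrow> nat \<Rightarrow> (nat \<Rightarrow> real) \<Rightarrow> real \<Rightarrow> real" where
  "direction \<alpha> s x = shifted_Lq.dual_direction p q (\<kappa> s x) (ngrad \<alpha> s x)"

text \<open>Indexed by the length s of the prefix, so the summand belongs to coordinate s + 1. For s
  = 0 the law is a point mass, which makes the \<lambda>_1 term an instance of the others.\<close>

definition sensitivity :: "((nat \<Rightarrow> real) \<Rightarrow> (nat \<Rightarrow> real)) \<Rightarrow> real" where
  "sensitivity \<alpha> = (\<Sum>s<N. \<integral>x. residual \<alpha> s x \<partial>law s)"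

lemma pgrad_measurable:
  assumes \<alpha>: "\<alpha> \<in> controls K N" and t: "t \<in> {1..N}"
  shows "pgrad \<alpha> t \<in> borel_measurable (Rn N)"
  unfolding pgrad_def[abs_def] using controlsD(1,2)[OF \<alpha>]
  by (intro partial_measurable[OF t measurable_ident_sets]) auto

text \<open>Since (p - 1) q = p, the growth of the gradient becomes growth of order p. The constant
  is common to all controls, because in the lower bound the responses vary with \<delta>.\<close>

lemma pgrad_bound:
  obtains B where "B \<ge> 0" "\<And>\<alpha> t x. \<alpha> \<in> controls K N \<Longrightarrow> t \<in> {1..N} \<Longrightarrow> x \<in> space (Rn N) \<Longrightarrow>
    \<bar>pgrad \<alpha> t x\<bar> powr q \<le> B * (1 + norm1 N x powr p)"
proof -
  obtain B where B: "B \<ge> 0" "\<And>x a t. x \<in> space (Rn N) \<Longrightarrow> a \<in> Kn K N \<Longrightarrow> t \<in> {1..N} \<Longrightarrow>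
      \<bar>partial t f x a\<bar> \<le> 1 * norm1 N x powr (p - 1) + B"
    using partial_growth[of 1] by auto
  have "\<bar>pgrad \<alpha> t x\<bar> powr q \<le> 2 powr q * (1 + B powr q) * (1 + norm1 N x powr p)"
    if \<alpha>: "\<alpha> \<in> controls K N" and t: "t \<in> {1..N}" and x: "x \<in> space (Rn N)" for \<alpha> t x
  proof -
    have "\<bar>pgrad \<alpha> t x\<bar> \<le> \<bar>norm1 N x powr (p - 1) + B\<bar>"
      using B(2)[OF x controlsD(2)[OF \<alpha> x] t] by (simp add: pgrad_def)
    then have "\<bar>pgrad \<alpha> t x\<bar> powr q \<le> \<bar>norm1 N x powr (p - 1) + B\<bar> powr q"
      using q_gt_1 by (intro powr_mono2) auto
    also have "\<dots> \<le> 2 powr q * ((norm1 N x powr (p - 1)) powr q + B powr q)"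
      using powr_q_add_le[of "norm1 N x powr (p - 1)" B] B(1) by simp
    also have "(norm1 N x powr (p - 1)) powr q = norm1 N x powr p" by (simp add: powr_powr p_minus_1_times_q)
    also have "2 powr q * (norm1 N x powr p + B powr q) \<le> 2 powr q * ((1 + B powr q) * (1 + norm1 N x powr p))"
      by (intro mult_left_mono) (auto simp: distrib_left distrib_right)
    finally show ?thesis by (simp add: mult.assoc)
  qed
  then show ?thesis by (intro that[of "2 powr q * (1 + B powr q)"]) auto
qed

lemma integrable_pgrad_powr:
  assumes \<alpha>: "\<alpha> \<in> controls K N" and t: "t \<in> {1..N}"
  shows "integrable \<mu> (\<lambda>x. \<bar>pgrad \<alpha> t x\<bar> powr q)"
proof -
  obtain B where B: "B \<ge> 0" "\<And>\<alpha> t x. \<alpha> \<in> controls K N \<Longrightarrow> t \<in> {1..N} \<Longrightarrow> x \<in> space (Rn N) \<Longrightarrow>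
      \<bar>pgrad \<alpha> t x\<bar> powr q \<le> B * (1 + norm1 N x powr p)"
    using pgrad_bound by blast
  note [measurable] = pgrad_measurable[OF assms]
  show ?thesis
  proof (rule Bochner_Integration.integrable_bound)
    show "integrable \<mu> (\<lambda>x. B * (1 + norm1 N x powr p))" using integrable_norm1_powr by simp
    show "AE x in \<mu>. norm (\<bar>pgrad \<alpha> t x\<bar> powr q) \<le> norm (B * (1 + norm1 N x powr p))"
      using B(2)[OF assms] B(1) by (intro AE_I2) fastforce
  qed measurable
qed

lemma cond_path_N_measurable: "t \<le> N \<Longrightarrow> cond_path \<kappa> t (N - t) \<in> Rn t \<rightarrow>\<^sub>M prob_algebra (Rn N)"
  using cond_path_measurable[of t "N - t"] by simp

lemma cond_path_N_space:
  assumes "t \<le> N" "x \<in> space (Rn t)"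
  shows "prob_space (cond_path \<kappa> t (N - t) x)" "sets (cond_path \<kappa> t (N - t) x) = sets (Rn N)"
    "space (cond_path \<kappa> t (N - t) x) = space (Rn N)"
  using kernel_space[OF cond_path_N_measurable[OF assms(1)] assms(2)] by auto

lemma cgrad_measurable:
  assumes \<alpha>: "\<alpha> \<in> controls K N" and t: "t \<in> {1..N}"
  shows "cgrad \<alpha> t \<in> borel_measurable (Rn t)"
  unfolding cgrad_def[abs_def]
  by (rule measurable_compose[OF measurable_prob_algebraD[OF cond_path_N_measurable]
        integral_measurable_subprob_algebra[OF pgrad_measurable[OF \<alpha> t]]]) (use t in simp)

text \<open>Conditional Jensen inequality, obtained from Hoelder against the constant one.\<close>

lemma cgrad_powr_le:
  assumes \<alpha>: "\<alpha> \<in> controls K N" and t: "t \<in> {1..N}" and x: "x \<in> space (Rn t)"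
    and int: "integrable (cond_path \<kappa> t (N - t) x) (\<lambda>z. \<bar>pgrad \<alpha> t z\<bar> powr q)"
  shows "\<bar>cgrad \<alpha> t x\<bar> powr q \<le> (\<integral>z. \<bar>pgrad \<alpha> t z\<bar> powr q \<partial>cond_path \<kappa> t (N - t) x)"
proof -
  let ?P = "cond_path \<kappa> t (N - t) x"
  have tN: "t \<le> N" using t by simp
  interpret P: prob_space ?P by (rule cond_path_N_space[OF tN x])
  have m: "pgrad \<alpha> t \<in> borel_measurable ?P"
    by (rule measurable_change_sets[OF pgrad_measurable[OF \<alpha> t] cond_path_N_space(2)[OF tN x]])
  have "\<bar>cgrad \<alpha> t x\<bar> \<le> (\<integral>z. \<bar>pgrad \<alpha> t z * 1\<bar> \<partial>?P)"
    unfolding cgrad_def using integral_abs_bound[of ?P "pgrad \<alpha> t"] by simp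
  also have "\<dots> \<le> (\<integral>z. \<bar>pgrad \<alpha> t z\<bar> powr q \<partial>?P) powr (1 / q) * (\<integral>z. \<bar>1::real\<bar> powr p \<partial>?P) powr (1 / p)"
    by (rule Hoelder[OF m _ int]) auto
  also have "\<dots> = (\<integral>z. \<bar>pgrad \<alpha> t z\<bar> powr q \<partial>?P) powr (1 / q)" by (simp add: P.prob_space)
  finally have "\<bar>cgrad \<alpha> t x\<bar> powr q \<le> ((\<integral>z. \<bar>pgrad \<alpha> t z\<bar> powr q \<partial>?P) powr (1 / q)) powr q"
    using q_gt_1 by (intro powr_mono2) auto
  also have "\<dots> = (\<integral>z. \<bar>pgrad \<alpha> t z\<bar> powr q \<partial>?P)" using q_gt_1 by (simp add: powr_powr)
  finally show ?thesis .
qed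

lemma integrable_cgrad_powr:
  assumes \<alpha>: "\<alpha> \<in> controls K N" and t: "t \<in> {1..N}"
  shows "integrable (law t) (\<lambda>x. \<bar>cgrad \<alpha> t x\<bar> powr q)"
proof -
  have tN: "t \<le> N" using t by simp
  note L = integral_law_cond_path[OF tN integrable_pgrad_powr[OF \<alpha> t]]
  have [measurable]: "cgrad \<alpha> t \<in> borel_measurable (law t)"
    using law_space(2)[OF tN] by (intro measurable_change_sets[OF cgrad_measurable[OF \<alpha> t]])
  show ?thesis
  proof (rule Bochner_Integration.integrable_bound[OF L(2)])
    show "AE x in law t. norm (\<bar>cgrad \<alpha> t x\<bar> powr q)
        \<le> norm (\<integral>z. \<bar>pgrad \<alpha> t z\<bar> powr q \<partial>cond_path \<kappa> t (N - t) x)"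
      using L(1) AE_space
    proof eventually_elim
      case (elim x)
      then show ?case
        using cgrad_powr_le[OF \<alpha> t _ elim(1)] by (simp add: law_space(3)[OF tN])
    qed
  qed measurable
qed

lemma cgrad_upd_measurable:
  assumes \<alpha>: "\<alpha> \<in> controls K N" and s: "s < N"
  shows "(\<lambda>(x, r). cgrad \<alpha> (Suc s) (x(Suc s := r))) \<in> borel_measurable (Rn s \<Otimes>\<^sub>M borel)"
  using measurable_compose[OF upd_measurable' cgrad_measurable[OF \<alpha>, of "Suc s"]] s
  by (simp add: split_beta')

lemma good_measurable:
  assumes \<alpha>: "\<alpha> \<in> controls K N" and s: "s < N"
  shows "Measurable.pred (Rn s) (good \<alpha> s)"
  unfolding good_def[abs_def]
proof (rule integral_measurable_kernel(2)[OF _ measurable_prob_algebraD[OF kernel[OF s]]])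
  have [measurable]: "(\<lambda>z. cgrad \<alpha> (Suc s) ((fst z)(Suc s := snd z))) \<in> borel_measurable (Rn s \<Otimes>\<^sub>M borel)"
    using cgrad_upd_measurable[OF assms] by (simp add: split_beta')
  show "(\<lambda>(x, r). \<bar>cgrad \<alpha> (Suc s) (x(Suc s := r))\<bar> powr q) \<in> borel_measurable (Rn s \<Otimes>\<^sub>M borel)"
    unfolding split_beta' by measurable
qed

lemma ngrad_measurable:
  assumes \<alpha>: "\<alpha> \<in> controls K N" and s: "s < N"
  shows "(\<lambda>(x, r). ngrad \<alpha> s x r) \<in> borel_measurable (Rn s \<Otimes>\<^sub>M borel)"
proof -
  have [measurable]: "Measurable.pred (Rn s \<Otimes>\<^sub>M borel) (\<lambda>z. good \<alpha> s (fst z))"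
    by (rule measurable_compose[OF measurable_fst good_measurable[OF assms]])
  have [measurable]: "(\<lambda>z. cgrad \<alpha> (Suc s) ((fst z)(Suc s := snd z))) \<in> borel_measurable (Rn s \<Otimes>\<^sub>M borel)"
    using cgrad_upd_measurable[OF assms] by (simp add: split_beta')
  show ?thesis unfolding ngrad_def split_beta' by measurable
qed

lemma shifted_Lq_ngrad:
  assumes \<alpha>: "\<alpha> \<in> controls K N" and s: "s < N" and x: "x \<in> space (Rn s)"
  shows "shifted_Lq p q (\<kappa> s x) (ngrad \<alpha> s x)"
proof -
  note ks = kernel_space[OF kernel[OF s] x]
  interpret prob_space "\<kappa> s x" by (rule ks)
  show ?thesis
  proof
    have "(\<lambda>r. (\<lambda>(x, r). ngrad \<alpha> s x r) (x, r)) \<in> borel_measurable borel"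
      by (rule measurable_compose[OF measurable_Pair1' ngrad_measurable[OF \<alpha> s]]) (use x in simp)
    then have "ngrad \<alpha> s x \<in> borel_measurable borel" by simp
    then show "ngrad \<alpha> s x \<in> borel_measurable (\<kappa> s x)" by (rule measurable_change_sets[OF _ ks(2)])
    show "integrable (\<kappa> s x) (\<lambda>r. \<bar>ngrad \<alpha> s x r\<bar> powr q)"
      by (cases "good \<alpha> s x") (auto simp: ngrad_def good_def)
  qed
qed

lemma AE_good:
  assumes \<alpha>: "\<alpha> \<in> controls K N" and s: "s < N"
  shows "AE x in law s. good \<alpha> s x"
  unfolding good_def using integral_law_Suc(1)[OF s integrable_cgrad_powr[OF \<alpha>]] s by simp

text \<open>By \<open>best_shift_le_iff\<close> the sublevel sets of the shift are sign conditions
  on integrals that are measurable in x; no measurable selection is involved.\<close>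

lemma shift_measurable:
  assumes \<alpha>: "\<alpha> \<in> controls K N" and s: "s < N"
  shows "(\<lambda>x. shifted_Lq.best_shift q (\<kappa> s x) (ngrad \<alpha> s x)) \<in> borel_measurable (Rn s)"
  unfolding borel_measurable_iff_le
proof
  fix c
  have ng [measurable]: "(\<lambda>z. ngrad \<alpha> s (fst z) (snd z)) \<in> borel_measurable (Rn s \<Otimes>\<^sub>M borel)"
    using ngrad_measurable[OF assms] by (simp add: split_beta')
  have "(\<lambda>(x, r). spow (ngrad \<alpha> s x r + c)) \<in> borel_measurable (Rn s \<Otimes>\<^sub>M borel)"
    unfolding split_beta' by measurable
  from integral_measurable_kernel(1)[OF this measurable_prob_algebraD[OF kernel[OF s]]]
  have [measurable]: "(\<lambda>x. \<integral>r. spow (ngrad \<alpha> s x r + c) \<partial>\<kappa> s x) \<in> borel_measurable (Rn s)" .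
  have "{x \<in> space (Rn s). shifted_Lq.best_shift q (\<kappa> s x) (ngrad \<alpha> s x) \<le> c}
      = {x \<in> space (Rn s). 0 \<le> (\<integral>r. spow (ngrad \<alpha> s x r + c) \<partial>\<kappa> s x)}"
    using shifted_Lq.best_shift_le_iff[OF shifted_Lq_ngrad[OF assms]]
      shifted_Lq.shift_moment_def[OF shifted_Lq_ngrad[OF assms]] by auto
  also have "\<dots> \<in> sets (Rn s)" by measurable
  finally show "{x \<in> space (Rn s). shifted_Lq.best_shift q (\<kappa> s x) (ngrad \<alpha> s x) \<le> c} \<in> sets (Rn s)" .
qed

lemma residual_moment_measurable:
  assumes \<alpha>: "\<alpha> \<in> controls K N" and s: "s < N"
  shows "(\<lambda>x. shifted_Lq.residual_moment q (\<kappa> s x) (ngrad \<alpha> s x)) \<in> borel_measurable (Rn s)"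
proof -
  have ng [measurable]: "(\<lambda>z. ngrad \<alpha> s (fst z) (snd z)) \<in> borel_measurable (Rn s \<Otimes>\<^sub>M borel)"
    using ngrad_measurable[OF assms] by (simp add: split_beta')
  note [measurable] = shift_measurable[OF assms]
  have "(\<lambda>(x, r). \<bar>ngrad \<alpha> s x r + shifted_Lq.best_shift q (\<kappa> s x) (ngrad \<alpha> s x)\<bar> powr q)
      \<in> borel_measurable (Rn s \<Otimes>\<^sub>M borel)"
    unfolding split_beta' by measurable
  from integral_measurable_kernel(1)[OF this measurable_prob_algebraD[OF kernel[OF s]]]
  show ?thesis
    by (rule measurable_cong[THEN iffD1, rotated])
      (simp add: shifted_Lq.residual_moment_def[OF shifted_Lq_ngrad[OF assms]])
qed

lemma residual_measurable:
  assumes \<alpha>: "\<alpha> \<in> controls K N" and s: "s < N"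
  shows "residual \<alpha> s \<in> borel_measurable (Rn s)"
  unfolding residual_def[abs_def] using residual_moment_measurable[OF assms] by measurable

lemma direction_measurable:
  assumes \<alpha>: "\<alpha> \<in> controls K N" and s: "s < N"
  shows "(\<lambda>(x, r). direction \<alpha> s x r) \<in> borel_measurable (Rn s \<Otimes>\<^sub>M borel)"
proof -
  have ng [measurable]: "(\<lambda>z. ngrad \<alpha> s (fst z) (snd z)) \<in> borel_measurable (Rn s \<Otimes>\<^sub>M borel)"
    using ngrad_measurable[OF assms] by (simp add: split_beta')
  note [measurable] = shift_measurable[OF assms] residual_moment_measurable[OF assms]
  have "(\<lambda>z. spow (ngrad \<alpha> s (fst z) (snd z) + shifted_Lq.best_shift q (\<kappa> s (fst z)) (ngrad \<alpha> s (fst z)))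
      * shifted_Lq.residual_moment q (\<kappa> s (fst z)) (ngrad \<alpha> s (fst z)) powr (- (1 / p))) \<in> borel_measurable (Rn s \<Otimes>\<^sub>M borel)"
    by measurable
  then show ?thesis
    by (rule measurable_cong[THEN iffD1, rotated])
      (auto simp: direction_def shifted_Lq.dual_direction_def[OF shifted_Lq_ngrad[OF assms]] space_pair_measure)
qed

lemma residual_nonneg [simp]: "residual \<alpha> s x \<ge> 0"
  by (simp add: residual_def)

text \<open>The shift 0 is a competitor, so the residual is at most the conditional L^q norm of the
  gradient, and a^(1/q) \<le> 1 + a.\<close>

lemma integrable_residual:
  assumes \<alpha>: "\<alpha> \<in> controls K N" and s: "s < N"
  shows "integrable (law s) (residual \<alpha> s)"
proof (rule Bochner_Integration.integrable_bound)
  have t: "Suc s \<in> {1..N}" using s by auto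
  have sp: "sets (law s) = sets (Rn s)" "space (law s) = space (Rn s)" "prob_space (law s)"
    using law_space[of s] s by auto
  interpret L: prob_space "law s" by fact
  show "integrable (law s) (\<lambda>x. 1 + (\<integral>r. \<bar>cgrad \<alpha> (Suc s) (x(Suc s := r))\<bar> powr q \<partial>\<kappa> s x))"
    using integral_law_Suc(2)[OF s integrable_cgrad_powr[OF \<alpha> t]] by simp
  show "residual \<alpha> s \<in> borel_measurable (law s)"
    by (rule measurable_change_sets[OF residual_measurable[OF assms] sp(1)])
  show "AE x in law s. norm (residual \<alpha> s x) \<le> norm (1 + (\<integral>r. \<bar>cgrad \<alpha> (Suc s) (x(Suc s := r))\<bar> powr q \<partial>\<kappa> s x))"
    using AE_good[OF assms] AE_space
  proof eventually_elim
    case (elim x)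
    then have x: "x \<in> space (Rn s)" by (simp add: sp)
    let ?A = "\<integral>r. \<bar>cgrad \<alpha> (Suc s) (x(Suc s := r))\<bar> powr q \<partial>\<kappa> s x"
    have A: "?A \<ge> 0" by simp
    have "residual \<alpha> s x \<le> ?A powr (1 / q)"
      using shifted_Lq.residual_moment_le[OF shifted_Lq_ngrad[OF assms x], of 0] elim(1)
      by (simp add: residual_def ngrad_def)
    also have "\<dots> \<le> 1 + ?A"
    proof (cases "?A \<le> 1")
      case True
      then have "?A powr (1 / q) \<le> 1" using A q_gt_1 by (intro powr_le1) auto
      then show ?thesis using A by linarith
    next
      case False
      then have "?A powr (1 / q) \<le> ?A powr 1" using q_gt_1 by (intro powr_mono) auto
      then show ?thesis using False by simp
    qed
    finally show ?case using A by simp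
  qed
qed

lemma INF_Lnorm_residual:
  assumes \<alpha>: "\<alpha> \<in> controls K N" and s: "s < N" and x: "x \<in> space (Rn s)" and g: "good \<alpha> s x"
  shows "(INF c. Lnorm q (\<kappa> s x) (\<lambda>r. cgrad \<alpha> (Suc s) (x(Suc s := r)) + c)) = ennreal (residual \<alpha> s x)"
  using shifted_Lq.INF_Lnorm[OF shifted_Lq_ngrad[OF \<alpha> s x]] g by (simp add: residual_def ngrad_def)

lemma law_0: "law 0 = return (Rn 0) origin0"
  by (simp add: law_def)

text \<open>For t \<ge> 2 the infimum over the shift equals the residual at almost every prefix, by
  duality at good prefixes. The term t = 1 is phrased with a marginal of \<mu> and is first
  identified with the kernel at the empty prefix.\<close>

lemma sensitivity_eq:
  assumes \<alpha>: "\<alpha> \<in> controls K N" and N: "N \<ge> 1"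
  shows "(INF l1::real. Lnorm q (distr \<mu> borel (\<lambda>x. x 1))
         (\<lambda>x1. (\<integral>x. partial 1 f x (\<alpha> x) \<partial>(cond_path \<kappa> 1 (N - 1) (origin0(1 := x1)))) + l1))
      + (\<Sum>t=2..N. \<integral>\<^sup>+ x'. (INF lt::real. Lnorm q (\<kappa> (t - 1) x')
           (\<lambda>xt. (\<integral>x. partial t f x (\<alpha> x) \<partial>(cond_path \<kappa> t (N - t) (x'(t := xt)))) + lt))
         \<partial>(distr \<mu> (Rn (t - 1)) (first_coords (t - 1)))) = ennreal (sensitivity \<alpha>)"
proof -
  have summand: "(\<integral>\<^sup>+ x'. (INF lt::real. Lnorm q (\<kappa> s x')
      (\<lambda>xt. (\<integral>x. partial (Suc s) f x (\<alpha> x) \<partial>(cond_path \<kappa> (Suc s) (N - Suc s) (x'(Suc s := xt)))) + lt))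
      \<partial>law s) = ennreal (\<integral>x. residual \<alpha> s x \<partial>law s)" if s: "s < N" for s
  proof -
    have sp: "space (law s) = space (Rn s)" using law_space[of s] s by auto
    have "(\<integral>\<^sup>+ x'. (INF lt::real. Lnorm q (\<kappa> s x')
        (\<lambda>xt. (\<integral>x. partial (Suc s) f x (\<alpha> x) \<partial>(cond_path \<kappa> (Suc s) (N - Suc s) (x'(Suc s := xt)))) + lt))
        \<partial>law s) = (\<integral>\<^sup>+ x'. ennreal (residual \<alpha> s x') \<partial>law s)"
    proof (rule nn_integral_cong_AE)
      show "AE x' in law s. (INF lt::real. Lnorm q (\<kappa> s x')
          (\<lambda>xt. (\<integral>x. partial (Suc s) f x (\<alpha> x) \<partial>(cond_path \<kappa> (Suc s) (N - Suc s) (x'(Suc s := xt)))) + lt))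
          = ennreal (residual \<alpha> s x')"
        using AE_good[OF \<alpha> s] AE_space
      proof eventually_elim
        case (elim x)
        then show ?case using INF_Lnorm_residual[OF \<alpha> s _ elim(1)] by (simp add: cgrad_def pgrad_def sp)
      qed
    qed
    also have "\<dots> = ennreal (\<integral>x. residual \<alpha> s x \<partial>law s)"
      by (rule nn_integral_eq_integral[OF integrable_residual[OF \<alpha> s]]) simp
    finally show ?thesis .
  qed
  have first: "(INF l1::real. Lnorm q (distr \<mu> borel (\<lambda>x. x 1))
         (\<lambda>x1. (\<integral>x. partial 1 f x (\<alpha> x) \<partial>(cond_path \<kappa> 1 (N - 1) (origin0(1 := x1)))) + l1))
      = ennreal (\<integral>x. residual \<alpha> 0 x \<partial>law 0)"
  proof -
    have N0: "0 < N" using N by simp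
    have ks: "sets (\<kappa> 0 origin0) = sets borel" using kernel_space[OF kernel[OF N0] origin0_in_space] by simp
    have "law 1 = step 0 origin0"
      using law_Suc[OF N0] measurable_prob_algebraD[OF step_measurable[OF N0]]
      by (simp add: law_0 bind_return One_nat_def)
    moreover have "distr \<mu> (Rn 1) (first_coords 1) = law 1" using distr_law_prefix[of 1 "N - 1"] N by simp
    ultimately have e: "distr \<mu> (Rn 1) (first_coords 1) = distr (\<kappa> 0 origin0) (Rn 1) (\<lambda>r. origin0(1 := r))"
      by (simp add: step_def One_nat_def)
    have m1: "(\<lambda>x. x 1) \<in> borel_measurable (Rn 1)" by (rule coord_measurable) auto
    have m2: "first_coords 1 \<in> \<mu> \<rightarrow>\<^sub>M Rn 1"
      by (rule measurable_change_sets[OF first_coords_measurable]) (use N in auto)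
    have "(\<lambda>r. origin0(Suc 0 := r)) \<in> borel \<rightarrow>\<^sub>M Rn (Suc 0)"
      by (rule upd_measurable) auto
    then have m3: "(\<lambda>r. origin0(1 := r)) \<in> \<kappa> 0 origin0 \<rightarrow>\<^sub>M Rn 1"
      by (intro measurable_change_sets[OF _ ks]) (simp add: One_nat_def)
    have "distr \<mu> borel (\<lambda>x. x 1) = distr (distr \<mu> (Rn 1) (first_coords 1)) borel (\<lambda>x. x 1)"
      by (subst distr_distr[OF m1 m2]) (simp add: comp_def)
    also have "\<dots> = distr (\<kappa> 0 origin0) borel (\<lambda>r. r)"
      unfolding e by (subst distr_distr[OF m1 m3]) (simp add: comp_def)
    also have "\<dots> = \<kappa> 0 origin0" by (rule distr_id2) (simp add: ks)
    finally have d: "distr \<mu> borel (\<lambda>x. x 1) = \<kappa> 0 origin0" .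
    \<comment> \<open>Almost everywhere for a point mass means at the point itself, so duality is
      available at the empty prefix.\<close>
    have g: "good \<alpha> 0 origin0"
      using AE_good[OF \<alpha> N0] good_measurable[OF \<alpha> N0] unfolding law_0 by (simp add: AE_return)
    have "(\<integral>x. residual \<alpha> 0 x \<partial>law 0) = residual \<alpha> 0 origin0"
      unfolding law_0 by (rule integral_return[OF origin0_in_space residual_measurable[OF \<alpha> N0]])
    then show ?thesis
      using INF_Lnorm_residual[OF \<alpha> N0 origin0_in_space g] unfolding d by (simp add: cgrad_def pgrad_def One_nat_def)
  qed
  have rest: "(\<Sum>t=2..N. \<integral>\<^sup>+ x'. (INF lt::real. Lnorm q (\<kappa> (t - 1) x')
           (\<lambda>xt. (\<integral>x. partial t f x (\<alpha> x) \<partial>(cond_path \<kappa> t (N - t) (x'(t := xt)))) + lt))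
         \<partial>(distr \<mu> (Rn (t - 1)) (first_coords (t - 1))))
      = (\<Sum>s=1..<N. ennreal (\<integral>x. residual \<alpha> s x \<partial>law s))"
  proof (rule sum.reindex_bij_witness[of _ Suc "\<lambda>t. t - 1"])
    fix t assume t: "t \<in> {2..N}"
    then obtain s where s: "t = Suc s" "s < N" "s \<ge> 1" by (cases t) auto
    have "distr \<mu> (Rn s) (first_coords s) = law s" using distr_law_prefix[of s "N - s"] s by simp
    then show "ennreal (\<integral>x. residual \<alpha> (t - 1) x \<partial>law (t - 1)) = (\<integral>\<^sup>+ x'. (INF lt::real. Lnorm q (\<kappa> (t - 1) x')
           (\<lambda>xt. (\<integral>x. partial t f x (\<alpha> x) \<partial>(cond_path \<kappa> t (N - t) (x'(t := xt)))) + lt))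
         \<partial>(distr \<mu> (Rn (t - 1)) (first_coords (t - 1))))"
      using summand[OF s(2)] by (simp add: s(1))
  qed auto
  have "{..<N} = insert 0 {1..<N}" using N by auto
  then show ?thesis unfolding first rest sensitivity_def
    by (simp add: sum_nonneg)
qed

end


section \<open>Upper bound\<close>

context conjugate_exponents
begin

lemma mart_couplingD:
  assumes \<pi>: "\<pi> \<in> mart_couplings p \<delta> \<nu>" and \<delta>: "\<delta> > 0"
  shows "prob_space \<pi>" "sets \<pi> = sets borel" "distr \<pi> borel fst = \<nu>"
    and "integrable \<pi> (\<lambda>r. \<bar>snd r - fst r\<bar> powr p)"
    and "(\<integral>r. \<bar>snd r - fst r\<bar> powr p \<partial>\<pi>) \<le> \<delta> powr p"
    and "(\<integral>\<^sup>+r. ennreal (\<bar>snd r - fst r\<bar> powr p) \<partial>\<pi>) \<le> ennreal (\<delta> powr p)"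
    and "integrable \<pi> (\<lambda>r. snd r - fst r)" "(\<integral>r. snd r - fst r \<partial>\<pi>) = 0"
proof -
  show P: "prob_space \<pi>" "sets \<pi> = sets borel" "distr \<pi> borel fst = \<nu>"
    using \<pi> by (auto simp: mart_couplings_def space_prob_algebra)
  interpret prob_space \<pi> by fact
  note [measurable_cong] = P(2)
  define v where "v = (\<integral>\<^sup>+r. ennreal (\<bar>snd r - fst r\<bar> powr p) \<partial>\<pi>)"
  have v_eq: "v = (\<integral>\<^sup>+r. ennreal (\<bar>case r of (x, y) \<Rightarrow> x - y\<bar> powr p) \<partial>\<pi>)"
    unfolding v_def by (intro nn_integral_cong) (auto simp: abs_minus_commute split: prod.split)
  have "eroot p v < ennreal \<delta>"
    using \<pi> unfolding mart_couplings_def Cp_def Lnorm_def v_eq by blast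
  then have v: "v \<noteq> \<infinity>" "enn2real v powr (1 / p) < \<delta>"
    using \<delta> by (auto simp: eroot_def ennreal_less_iff split: if_splits)
  have "enn2real v = (enn2real v powr (1 / p)) powr p" using p_gt_1 by (simp add: powr_powr)
  also have "\<dots> \<le> \<delta> powr p" using v(2) p_gt_1 by (intro powr_mono2) auto
  finally have le: "enn2real v \<le> \<delta> powr p" .
  have "v = ennreal (enn2real v)" using v(1) by (simp add: ennreal_enn2real_if)
  then show vle: "(\<integral>\<^sup>+r. ennreal (\<bar>snd r - fst r\<bar> powr p) \<partial>\<pi>) \<le> ennreal (\<delta> powr p)"
    using le by (metis v_def ennreal_leI)
  show int: "integrable \<pi> (\<lambda>r. \<bar>snd r - fst r\<bar> powr p)"
    using v(1) by (intro integrableI_nonneg) (auto simp: v_def top.not_eq_extremum)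
  show "(\<integral>r. \<bar>snd r - fst r\<bar> powr p \<partial>\<pi>) \<le> \<delta> powr p"
    using vle by (simp add: nn_integral_eq_integral[OF int])
  show "integrable \<pi> (\<lambda>r. snd r - fst r)"
    using Hoelder_integrable[of "\<lambda>_. 1" \<pi> "\<lambda>r. snd r - fst r"] int by simp
  have "(\<integral>r. snd r - fst r \<partial>\<pi>) = - (\<integral>(x, y). x - y \<partial>\<pi>)"
    unfolding Bochner_Integration.integral_minus[symmetric]
    by (intro Bochner_Integration.integral_cong) (auto split: prod.split)
  then show "(\<integral>r. snd r - fst r \<partial>\<pi>) = 0"
    using \<pi> by (simp add: mart_couplings_def)
qed

text \<open>The constraint fixes only the overall mean of the displacement, so exactly the constants
  can be added to g for free; adding the best one before Hoelder gives the residual norm.\<close>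

lemma mart_coupling_pairing:
  assumes L: "shifted_Lq p q \<nu> g" and \<nu>: "sets \<nu> = sets borel"
    and \<pi>: "\<pi> \<in> mart_couplings p \<delta> \<nu>" and \<delta>: "\<delta> > 0"
  shows "(\<integral>r. g (fst r) * (snd r - fst r) \<partial>\<pi>) \<le> \<delta> * shifted_Lq.residual_moment q \<nu> g powr (1 / q)"
proof -
  interpret shifted_Lq p q \<nu> g by fact
  note C = mart_couplingD[OF \<pi> \<delta>]
  interpret P: prob_space \<pi> by (rule C)
  note [measurable_cong] = C(2)
  have g: "g \<in> borel_measurable borel" by (rule measurable_change_sets[OF g_measurable]) (simp add: \<nu>)
  have [measurable]: "(\<lambda>r. g (fst r)) \<in> borel_measurable \<pi>"
    by (rule measurable_compose[OF _ g]) measurable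
  have f: "fst \<in> \<pi> \<rightarrow>\<^sub>M borel" by measurable
  define c where "c = best_shift"
  let ?c = c
  have m: "(\<lambda>a. \<bar>g a + ?c\<bar> powr q) \<in> borel_measurable borel" using g by measurable
  have u: "integrable \<pi> (\<lambda>r. \<bar>g (fst r) + ?c\<bar> powr q)"
    using integrable_shifted[of ?c] unfolding C(3)[symmetric] by (simp add: integrable_distr_eq[OF f m])
  have A: "(\<integral>r. \<bar>g (fst r) + ?c\<bar> powr q \<partial>\<pi>) = residual_moment"
    using integral_distr[OF f m] unfolding C(3) by (simp add: residual_moment_def c_def)
  have ui: "integrable \<pi> (\<lambda>r. (g (fst r) + ?c) * (snd r - fst r))"
    by (rule Hoelder_integrable[OF _ _ u C(4)]) measurable
  have "(\<integral>r. g (fst r) * (snd r - fst r) \<partial>\<pi>)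
      = (\<integral>r. (g (fst r) + ?c) * (snd r - fst r) - ?c * (snd r - fst r) \<partial>\<pi>)"
    by (simp add: algebra_simps)
  also have "\<dots> = (\<integral>r. (g (fst r) + ?c) * (snd r - fst r) \<partial>\<pi>)"
    using C(7,8) ui by (subst Bochner_Integration.integral_diff) auto
  also have "\<dots> \<le> (\<integral>r. \<bar>(g (fst r) + ?c) * (snd r - fst r)\<bar> \<partial>\<pi>)"
    by (rule order_trans[OF abs_ge_self integral_abs_bound])
  also have "\<dots> \<le> (\<integral>r. \<bar>g (fst r) + ?c\<bar> powr q \<partial>\<pi>) powr (1 / q) * (\<integral>r. \<bar>snd r - fst r\<bar> powr p \<partial>\<pi>) powr (1 / p)"
    by (rule Hoelder[OF _ _ u C(4)]) measurable
  also have "\<dots> \<le> residual_moment powr (1 / q) * (\<delta> powr p) powr (1 / p)"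
    unfolding A using C(5) p_gt_1 by (intro mult_left_mono powr_mono2) auto
  also have "\<dots> = \<delta> * residual_moment powr (1 / q)" using p_gt_1 \<delta> by (simp add: powr_powr)
  finally show ?thesis .
qed

end

context control_problem
begin

definition moment_const :: real where
  "moment_const = (\<integral>x. norm1 N x powr p \<partial>\<mu>)"

text \<open>The factor between \<delta>^p and the p-th moment of the l^1 norm of a displacement: N^p
  from comparing norms, N from adding up the coordinates.\<close>

definition dim_const :: real where
  "dim_const = real N powr p * real N"

lemma const_nonneg: "moment_const \<ge> 0" "dim_const \<ge> 0"
  by (simp_all add: moment_const_def dim_const_def)

end

text \<open>Abstracts from how the displacement arises. The upper bound uses a coupling with its two
  projections, the lower bound uses \<mu> with the identity and a map; both share the same
  first-order estimate.\<close>

locale displacement = control_problem p q N K f C \<epsilon>0 \<kappa> \<epsilon> + M: prob_space M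
  for p q :: real and N :: nat and K :: "real set" and f :: "(nat \<Rightarrow> real) \<Rightarrow> (nat \<Rightarrow> real) \<Rightarrow> real"
    and C \<epsilon>0 :: real and \<kappa> :: "nat \<Rightarrow> (nat \<Rightarrow> real) \<Rightarrow> real measure" and \<epsilon> :: "(nat \<Rightarrow> real) \<Rightarrow> real"
    and M :: "'z measure" +
  fixes u v :: "'z \<Rightarrow> nat \<Rightarrow> real" and \<delta> :: real
  assumes u: "u \<in> M \<rightarrow>\<^sub>M Rn N" and v: "v \<in> M \<rightarrow>\<^sub>M Rn N" and law_u: "distr M (Rn N) u = law N"
    and size_pos: "\<delta> > 0"
    and size_integrable: "\<And>i. i \<in> {1..N} \<Longrightarrow> integrable M (\<lambda>z. \<bar>v z i - u z i\<bar> powr p)"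
    and size_le: "\<And>i. i \<in> {1..N} \<Longrightarrow> (\<integral>z. \<bar>v z i - u z i\<bar> powr p \<partial>M) \<le> \<delta> powr p"
begin

lemma diff_measurable: "i \<in> {1..N} \<Longrightarrow> (\<lambda>z. v z i - u z i) \<in> borel_measurable M"
  using coord_measurable[OF _ _ u] coord_measurable[OF _ _ v]
  by (intro borel_measurable_diff) auto

lemma integral_u:
  fixes F :: "_ \<Rightarrow> real"
  assumes "integrable \<mu> F"
  shows "integrable M (\<lambda>z. F (u z))" "(\<integral>z. F (u z) \<partial>M) = (\<integral>x. F x \<partial>\<mu>)"
proof -
  have F: "F \<in> borel_measurable (Rn N)"
    by (rule measurable_change_sets[OF borel_measurable_integrable[OF assms]]) simp
  show "integrable M (\<lambda>z. F (u z))"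
    using assms unfolding law_u[symmetric] by (simp add: integrable_distr_eq[OF u F])
  show "(\<integral>z. F (u z) \<partial>M) = (\<integral>x. F x \<partial>\<mu>)"
    unfolding law_u[symmetric] by (rule integral_distr[OF u F, symmetric])
qed

lemma norm1_diff_powr:
  shows "integrable M (\<lambda>z. norm1 N (\<lambda>i. v z i - u z i) powr p)"
    and "(\<integral>z. norm1 N (\<lambda>i. v z i - u z i) powr p \<partial>M) \<le> real N powr p * real N * \<delta> powr p"
proof -
  have int: "integrable M (\<lambda>z. real N powr p * (\<Sum>i=1..N. \<bar>v z i - u z i\<bar> powr p))"
    using size_integrable by (intro integrable_mult_right Bochner_Integration.integrable_sum) auto
  have le: "norm1 N (\<lambda>i. v z i - u z i) powr p \<le> real N powr p * (\<Sum>i=1..N. \<bar>v z i - u z i\<bar> powr p)" for z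
    using norm1_powr_le[of p N "\<lambda>i. v z i - u z i"] p_gt_1 by simp
  have [measurable]: "(\<lambda>z. norm1 N (\<lambda>i. v z i - u z i)) \<in> borel_measurable M"
    unfolding norm1_def by (intro borel_measurable_sum borel_measurable_abs diff_measurable)
  show int': "integrable M (\<lambda>z. norm1 N (\<lambda>i. v z i - u z i) powr p)"
    by (rule Bochner_Integration.integrable_bound[OF int])
      (use le in \<open>auto simp: sum_nonneg intro!: AE_I2 order_trans[OF le]\<close>)
  have "(\<integral>z. norm1 N (\<lambda>i. v z i - u z i) powr p \<partial>M)
      \<le> (\<integral>z. real N powr p * (\<Sum>i=1..N. \<bar>v z i - u z i\<bar> powr p) \<partial>M)"
    by (rule integral_mono[OF int' int le])
  also have "\<dots> = real N powr p * (\<Sum>i=1..N. \<integral>z. \<bar>v z i - u z i\<bar> powr p \<partial>M)"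
    using size_integrable by (simp add: Bochner_Integration.integral_sum)
  also have "\<dots> \<le> real N powr p * (\<Sum>i=1..N. \<delta> powr p)"
    using size_le by (intro mult_left_mono sum_mono) auto
  finally show "(\<integral>z. norm1 N (\<lambda>i. v z i - u z i) powr p \<partial>M) \<le> real N powr p * real N * \<delta> powr p"
    by simp
qed

lemma integrable_norm1_v: "integrable M (\<lambda>z. norm1 N (v z) powr p)"
proof (rule Bochner_Integration.integrable_bound)
  let ?D = "\<lambda>z. norm1 N (\<lambda>i. v z i - u z i)"
  show "integrable M (\<lambda>z. 2 powr p * (norm1 N (u z) powr p + ?D z powr p))"
    using integral_u(1)[OF integrable_norm1_powr] norm1_diff_powr(1) by simp
  show "(\<lambda>z. norm1 N (v z) powr p) \<in> borel_measurable M"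
    using measurable_compose[OF v norm1_measurable] by measurable
  show "AE z in M. norm (norm1 N (v z) powr p) \<le> norm (2 powr p * (norm1 N (u z) powr p + ?D z powr p))"
  proof (rule AE_I2)
    fix z
    have "norm1 N (v z) powr p \<le> \<bar>norm1 N (u z) + ?D z\<bar> powr p"
      using norm1_le_diff[of N "v z" "u z"] p_gt_1 by (intro powr_mono2) auto
    also have "\<dots> \<le> 2 powr p * (norm1 N (u z) powr p + ?D z powr p)"
      using abs_add_powr_le[of p "norm1 N (u z)" "?D z"] p_gt_1 by simp
    finally show "norm (norm1 N (v z) powr p) \<le> norm (2 powr p * (norm1 N (u z) powr p + ?D z powr p))" by simp
  qed
qed

lemma integrable_pairing:
  assumes \<alpha>: "\<alpha> \<in> controls K N" and t: "t \<in> {1..N}"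
  shows "integrable M (\<lambda>z. pgrad \<alpha> t (u z) * (v z t - u z t))"
  by (rule Hoelder_integrable[OF measurable_compose[OF u pgrad_measurable[OF \<alpha> t]] diff_measurable[OF t]
        integral_u(1)[OF integrable_pgrad_powr[OF \<alpha> t]] size_integrable[OF t]])

lemma prob_space_M: "M.prob (space M) = 1"
  by (rule M.prob_space)

text \<open>Shows that the first-order term is of order \<delta> with a constant that is the same
  for all controls. In the lower bound this is used before the responses are known to
  converge.\<close>

lemma pairing_abs_le:
  assumes \<alpha>: "\<alpha> \<in> controls K N" and t: "t \<in> {1..N}"
    and B: "\<And>x. x \<in> space (Rn N) \<Longrightarrow> \<bar>pgrad \<alpha> t x\<bar> powr q \<le> B * (1 + norm1 N x powr p)"
  shows "\<bar>\<integral>z. pgrad \<alpha> t (u z) * (v z t - u z t) \<partial>M\<bar> \<le> \<delta> * (B * (1 + moment_const) + 1)"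
proof -
  let ?d = "\<lambda>z. \<bar>v z t - u z t\<bar>"
  note i1 = integral_u[OF integrable_norm1_powr]
  have "\<bar>\<integral>z. pgrad \<alpha> t (u z) * (v z t - u z t) \<partial>M\<bar> \<le> (\<integral>z. \<bar>pgrad \<alpha> t (u z) * (v z t - u z t)\<bar> \<partial>M)"
    by (rule integral_abs_bound)
  also have "\<dots> \<le> (\<integral>z. \<delta> * (B * (1 + norm1 N (u z) powr p) + ?d z powr p / \<delta> powr p) \<partial>M)"
  proof (rule integral_mono)
    show "integrable M (\<lambda>z. \<bar>pgrad \<alpha> t (u z) * (v z t - u z t)\<bar>)" using integrable_pairing[OF \<alpha> t] by simp
    show "integrable M (\<lambda>z. \<delta> * (B * (1 + norm1 N (u z) powr p) + ?d z powr p / \<delta> powr p))"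
      using size_integrable[OF t] i1 by simp
    fix z assume "z \<in> space M"
    then have z: "u z \<in> space (Rn N)" by (rule measurable_space[OF u])
    have "\<bar>pgrad \<alpha> t (u z)\<bar> * (?d z / \<delta>) \<le> \<bar>pgrad \<alpha> t (u z)\<bar> powr q + (?d z / \<delta>) powr p"
      using size_pos by (intro Young_weak) auto
    also have "\<dots> \<le> B * (1 + norm1 N (u z) powr p) + ?d z powr p / \<delta> powr p"
      using B[OF z] size_pos by (simp add: powr_divide)
    finally show "\<bar>pgrad \<alpha> t (u z) * (v z t - u z t)\<bar> \<le> \<delta> * (B * (1 + norm1 N (u z) powr p) + ?d z powr p / \<delta> powr p)"
      using size_pos by (simp add: abs_mult pos_divide_le_eq mult.commute)
  qed
  also have "\<dots> = \<delta> * (B * (1 + moment_const) + (\<integral>z. ?d z powr p \<partial>M) / \<delta> powr p)"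
    using size_integrable[OF t] i1 prob_space_M by (simp add: moment_const_def)
  also have "\<dots> \<le> \<delta> * (B * (1 + moment_const) + 1)"
    using size_le[OF t] size_pos by (intro mult_left_mono add_left_mono) auto
  finally show ?thesis .
qed

text \<open>The expansion is integrated at the scale \<delta> of the displacement: the weight \<eta>
  \<delta> / \<delta>^p meets a moment of order \<delta>^p, and the remaining \<delta>^p equals
  \<delta> times \<delta>^(p-1), which is of smaller order.\<close>

lemma displaced_cost:
  assumes \<alpha>: "\<alpha> \<in> controls K N" and \<eta>: "\<eta> > 0" and exp: "expansion \<eta> B"
  shows "\<bar>(\<integral>z. f (v z) (\<alpha> (u z)) \<partial>M) - cost \<alpha> - (\<Sum>t=1..N. \<integral>z. pgrad \<alpha> t (u z) * (v z t - u z t) \<partial>M)\<bar>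
    \<le> \<delta> * (\<eta> * (1 + moment_const + dim_const) + B * dim_const * \<delta> powr (p - 1))"
proof -
  let ?D = "\<lambda>z. norm1 N (\<lambda>i. v z i - u z i) powr p"
  let ?c = "\<eta> * \<delta> / \<delta> powr p + B"
  have c: "?c \<ge> 0" using \<eta> size_pos exp by (simp add: expansion_def)
  let ?S = "\<lambda>z. \<Sum>t=1..N. pgrad \<alpha> t (u z) * (v z t - u z t)"
  have i1: "integrable M (\<lambda>z. f (v z) (\<alpha> (u z)))"
    using controlsD(2)[OF \<alpha> measurable_space[OF u]]
    by (intro integrable_cost[OF M.prob_space_axioms v measurable_compose[OF u controlsD(1)[OF \<alpha>]] _ integrable_norm1_v])
  note i2 = integral_u[OF integrable_control_cost[OF \<alpha>]]
  have i3: "integrable M ?S" using integrable_pairing[OF \<alpha>] by (intro Bochner_Integration.integrable_sum) auto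
  note i4 = integral_u[OF integrable_norm1_powr]
  note i5 = norm1_diff_powr
  have "(\<integral>z. f (v z) (\<alpha> (u z)) \<partial>M) - cost \<alpha> - (\<Sum>t=1..N. \<integral>z. pgrad \<alpha> t (u z) * (v z t - u z t) \<partial>M)
      = (\<integral>z. f (v z) (\<alpha> (u z)) - f (u z) (\<alpha> (u z)) - ?S z \<partial>M)"
    using i1 i2 i3 integrable_pairing[OF \<alpha>] by (simp add: cost_def Bochner_Integration.integral_sum)
  then have "\<bar>(\<integral>z. f (v z) (\<alpha> (u z)) \<partial>M) - cost \<alpha> - (\<Sum>t=1..N. \<integral>z. pgrad \<alpha> t (u z) * (v z t - u z t) \<partial>M)\<bar>
      \<le> (\<integral>z. \<bar>f (v z) (\<alpha> (u z)) - f (u z) (\<alpha> (u z)) - ?S z\<bar> \<partial>M)"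
    using integral_abs_bound by simp
  also have "\<dots> \<le> (\<integral>z. \<eta> * \<delta> * (1 + norm1 N (u z) powr p) + ?c * ?D z \<partial>M)"
  proof (rule integral_mono)
    show "integrable M (\<lambda>z. \<bar>f (v z) (\<alpha> (u z)) - f (u z) (\<alpha> (u z)) - ?S z\<bar>)"
      by (intro integrable_abs Bochner_Integration.integrable_diff i1 i2(1) i3)
    show "integrable M (\<lambda>z. \<eta> * \<delta> * (1 + norm1 N (u z) powr p) + ?c * ?D z)"
      by (intro Bochner_Integration.integrable_add integrable_mult_right M.integrable_const i4(1) i5(1))
    fix z assume z: "z \<in> space M"
    show "\<bar>f (v z) (\<alpha> (u z)) - f (u z) (\<alpha> (u z)) - ?S z\<bar> \<le> \<eta> * \<delta> * (1 + norm1 N (u z) powr p) + ?c * ?D z"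
      using exp[unfolded expansion_def, THEN conjunct2, rule_format, OF size_pos measurable_space[OF u z]
          measurable_space[OF v z] controlsD(2)[OF \<alpha> measurable_space[OF u z]]]
      unfolding pgrad_def .
  qed
  also have "\<dots> = \<eta> * \<delta> * (1 + moment_const) + ?c * (\<integral>z. ?D z \<partial>M)"
    using i4 i5 prob_space_M by (simp add: moment_const_def)
  also have "\<dots> \<le> \<eta> * \<delta> * (1 + moment_const) + ?c * (dim_const * \<delta> powr p)"
    using i5(2) c by (intro add_left_mono mult_left_mono) (auto simp: dim_const_def)
  also have "?c * (dim_const * \<delta> powr p) = \<eta> * \<delta> * dim_const + B * dim_const * \<delta> powr p"
    using size_pos by (simp add: distrib_right)
  also have "\<delta> powr p = \<delta> * \<delta> powr (p - 1)"
  proof -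
    have "\<delta> powr 1 * \<delta> powr (p - 1) = \<delta> powr p" unfolding powr_add[symmetric] by simp
    then show ?thesis using size_pos by simp
  qed
  finally show ?thesis by (simp add: algebra_simps)
qed

end

locale mart_perturbation = control_problem p q N K f C \<epsilon>0 \<kappa> \<epsilon> + joint_kernels N g
  for p q :: real and N :: nat and K :: "real set" and f :: "(nat \<Rightarrow> real) \<Rightarrow> (nat \<Rightarrow> real) \<Rightarrow> real"
    and C \<epsilon>0 :: real and \<kappa> :: "nat \<Rightarrow> (nat \<Rightarrow> real) \<Rightarrow> real measure" and \<epsilon> :: "(nat \<Rightarrow> real) \<Rightarrow> real"
    and g :: "nat \<Rightarrow> (nat \<Rightarrow> real) \<times> (nat \<Rightarrow> real) \<Rightarrow> (real \<times> real) measure" +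
  fixes \<delta> :: real
  assumes \<delta>_pos: "\<delta> > 0"
    and mart: "\<And>s x y. s < N \<Longrightarrow> x \<in> space (Rn s) \<Longrightarrow> y \<in> space (Rn s) \<Longrightarrow> g s (x, y) \<in> mart_couplings p \<delta> (\<kappa> s x)"
begin

sublocale causal_kernels N \<kappa> g
  by unfold_locales (use mart mart_couplingD(3)[OF _ \<delta>_pos] in blast)

abbreviation "\<Gamma> \<equiv> joint_path g N"

sublocale \<Gamma>: prob_space \<Gamma>
  by (rule joint_path_space) simp

lemma sets_\<Gamma> [simp, measurable_cong]: "sets \<Gamma> = sets (Rn2 N)"
  and space_\<Gamma> [simp]: "space \<Gamma> = space (Rn2 N)"
  using joint_path_space[of N] by auto

lemma fst_\<Gamma> [measurable]: "fst \<in> \<Gamma> \<rightarrow>\<^sub>M Rn N" and snd_\<Gamma> [measurable]: "snd \<in> \<Gamma> \<rightarrow>\<^sub>M Rn N"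
  by (rule measurable_change_sets[OF measurable_fst], simp)
    (rule measurable_change_sets[OF measurable_snd], simp)

lemma displacement_measurable [measurable]:
  "i \<in> {1..N} \<Longrightarrow> (\<lambda>z. snd z i - fst z i) \<in> borel_measurable \<Gamma>"
  using coord_measurable[OF _ _ fst_\<Gamma>] coord_measurable[OF _ _ snd_\<Gamma>]
  by (intro borel_measurable_diff) auto

lemma AE_cond_path_coordinate:
  assumes t: "t \<in> {1..N}" and x: "x \<in> space (Rn t)"
  shows "AE w in cond_path \<kappa> t (N - t) x. w t = x t"
proof -
  have "AE w in cond_path \<kappa> t (N - t) x. first_coords t w = x"
    using AE_cond_path_prefix[of t "N - t" x] t x by simp
  then show ?thesis by eventually_elim (use t in \<open>auto simp: restrict_def fun_eq_iff split: if_splits\<close>)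
qed

text \<open>Causality removes the coordinates after t, on which the displacement of coordinate t
  does not depend; the bound at each prefix is then integrated over the past.\<close>

lemma nn_integral_displacement:
  assumes s: "s < N"
  shows "(\<integral>\<^sup>+z. ennreal (\<bar>snd z (Suc s) - fst z (Suc s)\<bar> powr p) \<partial>\<Gamma>) \<le> ennreal (\<delta> powr p)"
proof -
  let ?t = "Suc s"
  have t: "?t + (N - ?t) = N" "?t \<in> {1..N}" using s by auto
  have m: "(\<lambda>z. ennreal (\<bar>snd z ?t - fst z ?t\<bar> powr p)) \<in> borel_measurable (Rn n \<Otimes>\<^sub>M Rn ?t)" if "?t \<le> n" for n
  proof -
    have [measurable]: "(\<lambda>z. snd z ?t) \<in> borel_measurable (Rn n \<Otimes>\<^sub>M Rn ?t)"
      by (rule coord_measurable[OF _ _ measurable_snd]) auto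
    have [measurable]: "(\<lambda>z. fst z ?t) \<in> borel_measurable (Rn n \<Otimes>\<^sub>M Rn ?t)"
      by (rule coord_measurable[OF _ _ measurable_fst]) (use that in auto)
    show ?thesis by measurable
  qed
  have "(\<integral>\<^sup>+z. ennreal (\<bar>snd z ?t - fst z ?t\<bar> powr p) \<partial>\<Gamma>)
      = (\<integral>\<^sup>+z. (\<lambda>z. ennreal (\<bar>snd z ?t - fst z ?t\<bar> powr p)) (fst z, first_coords ?t (snd z)) \<partial>joint_path g (?t + (N - ?t)))"
    using t by simp
  also have "\<dots> = (\<integral>\<^sup>+z. \<integral>\<^sup>+w. (\<lambda>z. ennreal (\<bar>snd z ?t - fst z ?t\<bar> powr p)) (w, snd z)
      \<partial>cond_path \<kappa> ?t (N - ?t) (fst z) \<partial>joint_path g ?t)"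
    by (rule nn_integral_joint_path_prefix) (use t m s in auto)
  also have "\<dots> = (\<integral>\<^sup>+z. ennreal (\<bar>snd z ?t - fst z ?t\<bar> powr p) \<partial>joint_path g ?t)"
  proof (rule nn_integral_cong)
    fix z assume "z \<in> space (joint_path g ?t)"
    then have z: "fst z \<in> space (Rn ?t)" using joint_path_space[of ?t] s by (auto simp: space_pair_measure)
    interpret Q: prob_space "cond_path \<kappa> ?t (N - ?t) (fst z)" by (rule cond_path_N_space) (use z s in auto)
    have "(\<integral>\<^sup>+w. (\<lambda>z. ennreal (\<bar>snd z ?t - fst z ?t\<bar> powr p)) (w, snd z) \<partial>cond_path \<kappa> ?t (N - ?t) (fst z))
        = (\<integral>\<^sup>+w. ennreal (\<bar>snd z ?t - fst z ?t\<bar> powr p) \<partial>cond_path \<kappa> ?t (N - ?t) (fst z))"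
      using AE_cond_path_coordinate[OF t(2) z] by (intro nn_integral_cong_AE) (auto elim!: eventually_mono)
    then show "(\<integral>\<^sup>+w. (\<lambda>z. ennreal (\<bar>snd z ?t - fst z ?t\<bar> powr p)) (w, snd z) \<partial>cond_path \<kappa> ?t (N - ?t) (fst z))
        = ennreal (\<bar>snd z ?t - fst z ?t\<bar> powr p)"
      by (simp add: Q.emeasure_space_1)
  qed
  also have "\<dots> = (\<integral>\<^sup>+z. \<integral>\<^sup>+r. ennreal (\<bar>snd r - fst r\<bar> powr p) \<partial>g s z \<partial>joint_path g s)"
    using nn_integral_joint_path_Suc[OF s m[OF order_refl]] by (simp add: upd2_def)
  also have "\<dots> \<le> (\<integral>\<^sup>+z. ennreal (\<delta> powr p) \<partial>joint_path g s)"
  proof (rule nn_integral_mono)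
    fix z assume "z \<in> space (joint_path g s)"
    then have z: "fst z \<in> space (Rn s)" "snd z \<in> space (Rn s)"
      using joint_path_space[of s] s by (auto simp: space_pair_measure)
    from mart_couplingD(6)[OF mart[OF s z] \<delta>_pos]
    show "(\<integral>\<^sup>+r. ennreal (\<bar>snd r - fst r\<bar> powr p) \<partial>g s z) \<le> ennreal (\<delta> powr p)" by simp
  qed
  also have "\<dots> = ennreal (\<delta> powr p)"
  proof -
    interpret J: prob_space "joint_path g s" by (rule joint_path_space) (use s in simp)
    show ?thesis by (simp add: J.emeasure_space_1)
  qed
  finally show ?thesis .
qed

lemma displacement_powr:
  assumes t: "t \<in> {1..N}"
  shows "integrable \<Gamma> (\<lambda>z. \<bar>snd z t - fst z t\<bar> powr p)" "(\<integral>z. \<bar>snd z t - fst z t\<bar> powr p \<partial>\<Gamma>) \<le> \<delta> powr p"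
proof -
  obtain s where s: "t = Suc s" "s < N" using t by (cases t) auto
  note [measurable] = displacement_measurable[OF t]
  note b = nn_integral_displacement[OF s(2), folded s(1)]
  show int: "integrable \<Gamma> (\<lambda>z. \<bar>snd z t - fst z t\<bar> powr p)"
    by (rule integrableI_nonneg) (use b in \<open>auto simp: less_top[symmetric] top_unique\<close>)
  show "(\<integral>z. \<bar>snd z t - fst z t\<bar> powr p \<partial>\<Gamma>) \<le> \<delta> powr p"
    using b by (simp add: nn_integral_eq_integral[OF int])
qed

sublocale displacement p q N K f C \<epsilon>0 \<kappa> \<epsilon> \<Gamma> fst snd \<delta>
  by unfold_locales (use displacement_powr \<delta>_pos distr_joint_path_fst[of N] in simp_all)

text \<open>The integral is conditioned twice. Given the prefixes of length t, the future of x
  averages the gradient to \<open>cgrad\<close>, by causality. Given the prefixes of length s = t -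
  1, the one-step duality applies to the kernel g.\<close>

lemma pairing_le:
  assumes \<alpha>: "\<alpha> \<in> controls K N" and s: "s < N"
  shows "(\<integral>z. pgrad \<alpha> (Suc s) (fst z) * (snd z (Suc s) - fst z (Suc s)) \<partial>\<Gamma>)
    \<le> \<delta> * (\<integral>x. residual \<alpha> s x \<partial>law s)"
proof -
  let ?t = "Suc s"
  have t: "?t + (N - ?t) = N" "?t \<in> {1..N}" using s by auto
  let ?F = "\<lambda>z. pgrad \<alpha> ?t (fst z) * (snd z ?t - fst z ?t)"
  have F: "?F \<in> borel_measurable (Rn (?t + (N - ?t)) \<Otimes>\<^sub>M Rn ?t)"
  proof -
    have "(\<lambda>z. snd z ?t) \<in> borel_measurable (Rn N \<Otimes>\<^sub>M Rn ?t)"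
      by (rule coord_measurable[OF _ _ measurable_snd]) auto
    moreover have "(\<lambda>z. fst z ?t) \<in> borel_measurable (Rn N \<Otimes>\<^sub>M Rn ?t)"
      by (rule coord_measurable[OF _ _ measurable_fst]) (use s in auto)
    moreover have "(\<lambda>z. pgrad \<alpha> ?t (fst z)) \<in> borel_measurable (Rn N \<Otimes>\<^sub>M Rn ?t)"
      by (rule measurable_compose[OF measurable_fst pgrad_measurable[OF \<alpha> t(2)]])
    ultimately show ?thesis unfolding t(1) by (intro borel_measurable_times borel_measurable_diff)
  qed
  have int: "integrable (joint_path g (?t + (N - ?t))) (\<lambda>z. ?F (fst z, first_coords ?t (snd z)))"
    using integrable_pairing[OF \<alpha> t(2)] t by simp
  note J1 = integral_joint_path_prefix[OF eq_imp_le[OF t(1)] F int]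
  have inner: "(\<integral>w. ?F (w, snd z) \<partial>cond_path \<kappa> ?t (N - ?t) (fst z)) = cgrad \<alpha> ?t (fst z) * (snd z ?t - fst z ?t)"
    if "z \<in> space (joint_path g ?t)" for z
  proof -
    have z: "fst z \<in> space (Rn ?t)" using joint_path_space[of ?t] s that by (auto simp: space_pair_measure)
    have tN: "?t \<le> N" using s by simp
    have m: "pgrad \<alpha> ?t \<in> borel_measurable (cond_path \<kappa> ?t (N - ?t) (fst z))"
      by (rule measurable_change_sets[OF pgrad_measurable[OF \<alpha> t(2)] cond_path_N_space(2)[OF tN z]])
    have m2: "(\<lambda>w. w ?t) \<in> borel_measurable (cond_path \<kappa> ?t (N - ?t) (fst z))"
      by (rule measurable_change_sets[OF coordinate_measurable[OF t(2)] cond_path_N_space(2)[OF tN z]])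
    have "(\<integral>w. ?F (w, snd z) \<partial>cond_path \<kappa> ?t (N - ?t) (fst z))
        = (\<integral>w. pgrad \<alpha> ?t w * (snd z ?t - fst z ?t) \<partial>cond_path \<kappa> ?t (N - ?t) (fst z))"
      using AE_cond_path_coordinate[OF t(2) z] m m2
      by (intro integral_cong_AE) (auto elim!: eventually_mono)
    then show ?thesis by (simp add: cgrad_def)
  qed
  let ?G = "\<lambda>z. cgrad \<alpha> ?t (fst z) * (snd z ?t - fst z ?t)"
  have G: "integrable (joint_path g ?t) ?G"
    by (rule Bochner_Integration.integrable_cong[THEN iffD1, OF refl _ J1(1)]) (rule inner)
  note J2 = integral_joint_path_Suc[OF s G]
  have sp: "sets (joint_path g s) = sets (Rn2 s)" "space (joint_path g s) = space (Rn2 s)"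
    using joint_path_space[of s] s by auto
  have d: "distr (joint_path g s) (Rn s) fst = law s" by (rule distr_joint_path_fst) (use s in simp)
  have fm: "fst \<in> joint_path g s \<rightarrow>\<^sub>M Rn s" by (rule measurable_change_sets[OF measurable_fst sp(1)])
  \<comment> \<open>Goodness concerns only the prefix of x, whose law under the coupling is that of
    \<mu>.\<close>
  have "AE z in joint_path g s. good \<alpha> s (fst z)"
    using AE_good[OF \<alpha> s] good_measurable[OF \<alpha> s] unfolding d[symmetric] by (simp add: AE_distr_iff[OF fm])
  then have "AE z in joint_path g s. (\<integral>r. ?G (upd2 s z r) \<partial>g s z) \<le> \<delta> * residual \<alpha> s (fst z)"
    using AE_space
  proof eventually_elim
    case (elim z)
    then have z: "fst z \<in> space (Rn s)" "snd z \<in> space (Rn s)" by (auto simp: sp space_pair_measure)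
    have \<pi>: "g s z \<in> mart_couplings p \<delta> (\<kappa> s (fst z))" using mart[OF s z] by simp
    have "(\<integral>r. ?G (upd2 s z r) \<partial>g s z) = (\<integral>r. ngrad \<alpha> s (fst z) (fst r) * (snd r - fst r) \<partial>g s z)"
      using elim(1) by (simp add: upd2_def ngrad_def)
    also have "\<dots> \<le> \<delta> * residual \<alpha> s (fst z)"
      unfolding residual_def
      by (rule mart_coupling_pairing[OF shifted_Lq_ngrad[OF \<alpha> s z(1)] kernel_space(2)[OF kernel[OF s] z(1)] \<pi> \<delta>_pos])
    finally show ?case .
  qed
  moreover have int_res: "integrable (joint_path g s) (\<lambda>z. \<delta> * residual \<alpha> s (fst z))"
    using integrable_residual[OF \<alpha> s] unfolding d[symmetric]
    by (simp add: integrable_distr_eq[OF fm residual_measurable[OF \<alpha> s]])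
  ultimately have "(\<integral>z. \<integral>r. ?G (upd2 s z r) \<partial>g s z \<partial>joint_path g s) \<le> (\<integral>z. \<delta> * residual \<alpha> s (fst z) \<partial>joint_path g s)"
    by (intro integral_mono_AE J2(1))
  also have "\<dots> = \<delta> * (\<integral>x. residual \<alpha> s x \<partial>law s)"
    unfolding d[symmetric] by (simp add: integral_distr[OF fm residual_measurable[OF \<alpha> s]])
  finally have "(\<integral>z. ?G z \<partial>joint_path g ?t) \<le> \<delta> * (\<integral>x. residual \<alpha> s x \<partial>law s)" unfolding J2(3) .
  moreover have "(\<integral>z. ?F z \<partial>\<Gamma>) = (\<integral>z. ?G z \<partial>joint_path g ?t)"
  proof -
    have "(\<integral>z. ?F z \<partial>\<Gamma>) = (\<integral>z. ?F (fst z, first_coords ?t (snd z)) \<partial>joint_path g (?t + (N - ?t)))"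
      using t by simp
    also have "\<dots> = (\<integral>z. ?G z \<partial>joint_path g ?t)"
      unfolding J1(2) by (rule Bochner_Integration.integral_cong[OF refl inner])
    finally show ?thesis .
  qed
  ultimately show ?thesis by simp
qed

lemma perturbed_cost_le:
  assumes \<alpha>: "\<alpha> \<in> controls K N" and \<eta>: "\<eta> > 0" and exp: "expansion \<eta> B"
  shows "(\<integral>z. f (snd z) (\<alpha> (fst z)) \<partial>\<Gamma>)
    \<le> cost \<alpha> + \<delta> * (sensitivity \<alpha> + \<eta> * (1 + moment_const + dim_const) + B * dim_const * \<delta> powr (p - 1))"
proof -
  have "(\<Sum>t=1..N. \<integral>z. pgrad \<alpha> t (fst z) * (snd z t - fst z t) \<partial>\<Gamma>)
      = (\<Sum>s<N. \<integral>z. pgrad \<alpha> (Suc s) (fst z) * (snd z (Suc s) - fst z (Suc s)) \<partial>\<Gamma>)"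
    by (rule sum.reindex_bij_witness[of _ Suc "\<lambda>t. t - 1"]) auto
  also have "\<dots> \<le> (\<Sum>s<N. \<delta> * (\<integral>x. residual \<alpha> s x \<partial>law s))"
    using pairing_le[OF \<alpha>] by (intro sum_mono) auto
  finally have "(\<Sum>t=1..N. \<integral>z. pgrad \<alpha> t (fst z) * (snd z t - fst z t) \<partial>\<Gamma>) \<le> \<delta> * sensitivity \<alpha>"
    by (simp add: sensitivity_def sum_distrib_left)
  then show ?thesis using displaced_cost[OF \<alpha> \<eta> exp] by (simp add: distrib_left)
qed

end

context control_problem
begin

lemma V_mart_le:
  assumes \<alpha>: "\<alpha> \<in> controls K N" and \<delta>: "\<delta> > 0" and \<eta>: "\<eta> > 0" and exp: "expansion \<eta> B"
  shows "V_mart p N K \<kappa> f \<delta> \<le> ereal (cost \<alpha>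
    + \<delta> * (sensitivity \<alpha> + \<eta> * (1 + moment_const + dim_const) + B * dim_const * \<delta> powr (p - 1)))"
    (is "_ \<le> ereal ?R")
  unfolding V_mart_def
proof (rule INF_lower2)
  let ?\<alpha> = "\<lambda>x y. \<alpha> x"
  show "?\<alpha> \<in> joint_controls K N"
    unfolding joint_controls_def
  proof (intro CollectI conjI ballI impI)
    show "(\<lambda>(x, y). ?\<alpha> x y) \<in> Rn2 N \<rightarrow>\<^sub>M Rn N"
      using measurable_compose[OF measurable_fst controlsD(1)[OF \<alpha>]] by (simp add: split_beta')
  qed (use controlsD(2)[OF \<alpha>] controlsD(3)[OF \<alpha>] in blast)+
  show "(SUP \<gamma>\<in>Pi_mart_bc p N \<kappa> \<delta>. ereal (\<integral>(x, y). f y (?\<alpha> x y) \<partial>\<gamma>)) \<le> ereal ?R"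
  proof (rule SUP_least)
    fix \<gamma> assume "\<gamma> \<in> Pi_mart_bc p N \<kappa> \<delta>"
    then obtain g where g: "joint_disintegration N \<gamma> g"
      "\<forall>s<N. \<forall>x\<in>space (Rn s). \<forall>y\<in>space (Rn s). g s (x, y) \<in> mart_couplings p \<delta> (\<kappa> s x)"
      by (auto simp: Pi_mart_bc_def Pi_mart_def)
    interpret mart_perturbation p q N K f C \<epsilon>0 \<kappa> \<epsilon> g \<delta>
      by unfold_locales (use g \<delta> in \<open>auto simp: joint_disintegration_def\<close>)
    have "\<gamma> = \<Gamma>" using g(1) by (simp add: joint_disintegration_def)
    then show "ereal (\<integral>(x, y). f y (?\<alpha> x y) \<partial>\<gamma>) \<le> ereal ?R"
      using perturbed_cost_le[OF \<alpha> \<eta> exp] by (simp add: split_beta')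
  qed
qed

lemma upper_bound:
  assumes \<alpha>: "\<alpha> \<in> controls K N" and c: "sensitivity \<alpha> < c"
  shows "\<forall>\<^sub>F \<delta> in at_right 0. V_mart p N K \<kappa> f \<delta> < ereal (cost \<alpha> + \<delta> * c)"
proof -
  define W where "W = 1 + moment_const + dim_const"
  have W: "W > 0" using const_nonneg by (simp add: W_def add_pos_nonneg)
  \<comment> \<open>Half of the margin between c and the sensitivity is spent on the terms with
    \<eta>; the other half is left for the power of \<delta>.\<close>
  define \<eta> where "\<eta> = (c - sensitivity \<alpha>) / (2 * W)"
  have \<eta>: "\<eta> > 0" "\<eta> * W = (c - sensitivity \<alpha>) / 2" using c W by (simp_all add: \<eta>_def)
  obtain B where B: "expansion \<eta> B" using first_order_expansion[OF \<eta>(1)] by blast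
  have "((\<lambda>\<delta>. B * dim_const * \<delta> powr (p - 1)) \<longlongrightarrow> B * dim_const * 0 powr (p - 1)) (at_right 0)"
    using p_gt_1 by (intro tendsto_intros tendsto_powr') (auto intro!: eventually_mono[OF eventually_at_right_less[of 0]])
  then have "((\<lambda>\<delta>. B * dim_const * \<delta> powr (p - 1)) \<longlongrightarrow> 0) (at_right 0)" by simp
  then have "\<forall>\<^sub>F \<delta> in at_right 0. B * dim_const * \<delta> powr (p - 1) < (c - sensitivity \<alpha>) / 2"
    by (rule order_tendstoD) (use c in simp)
  moreover have "\<forall>\<^sub>F \<delta> in at_right (0::real). \<delta> > 0" by (rule eventually_at_right_less)
  ultimately show ?thesis
  proof eventually_elim
    case (elim \<delta>)
    have "sensitivity \<alpha> + \<eta> * W + B * dim_const * \<delta> powr (p - 1) < c"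
      unfolding \<eta>(2) using elim(1) by argo
    then have "cost \<alpha> + \<delta> * (sensitivity \<alpha> + \<eta> * W + B * dim_const * \<delta> powr (p - 1)) < cost \<alpha> + \<delta> * c"
      using elim(2) by simp
    then show ?case
      using le_less_trans[OF V_mart_le[OF \<alpha> elim(2) \<eta>(1) B]] by (simp add: W_def)
  qed
qed

end


section \<open>Bicausal couplings from injective adapted maps\<close>

text \<open>\<tau> maps the next coordinate of x to that of y given the prefix of x, and \<sigma> is
  a left inverse for a known prefix of x. Injectivity one coordinate at a time suffices, because
  prefixes are then recovered recursively.\<close>

locale injective_transport = kernels N \<kappa> for N :: nat and \<kappa> :: "nat \<Rightarrow> (nat \<Rightarrow> real) \<Rightarrow> real measure" +
  fixes \<tau> \<sigma> :: "nat \<Rightarrow> (nat \<Rightarrow> real) \<Rightarrow> real \<Rightarrow> real"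
  assumes \<tau>_measurable': "\<And>s. s < N \<Longrightarrow> (\<lambda>(x, r). \<tau> s x r) \<in> borel_measurable (Rn s \<Otimes>\<^sub>M borel)"
    and \<sigma>_measurable': "\<And>s. s < N \<Longrightarrow> (\<lambda>(x, r). \<sigma> s x r) \<in> borel_measurable (Rn s \<Otimes>\<^sub>M borel)"
    and \<sigma>_\<tau>: "\<And>s x r. s < N \<Longrightarrow> x \<in> space (Rn s) \<Longrightarrow> \<sigma> s x (\<tau> s x r) = r"
begin

lemma \<tau>_measurable:
  assumes "s < N" "u \<in> M \<rightarrow>\<^sub>M Rn s" "v \<in> borel_measurable M"
  shows "(\<lambda>z. \<tau> s (u z) (v z)) \<in> borel_measurable M"
  using measurable_compose[OF measurable_Pair[OF assms(2,3)] \<tau>_measurable'[OF assms(1)]] by simp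

lemma \<sigma>_measurable:
  assumes "s < N" "u \<in> M \<rightarrow>\<^sub>M Rn s" "v \<in> borel_measurable M"
  shows "(\<lambda>z. \<sigma> s (u z) (v z)) \<in> borel_measurable M"
  using measurable_compose[OF measurable_Pair[OF assms(2,3)] \<sigma>_measurable'[OF assms(1)]] by simp

definition enc :: "nat \<Rightarrow> (nat \<Rightarrow> real) \<Rightarrow> (nat \<Rightarrow> real)" where
  "enc n x = (\<lambda>i\<in>{1..n}. \<tau> (i - 1) (first_coords (i - 1) x) (x i))"

text \<open>Recursive because \<sigma> has to be evaluated at the prefix of x that is already
  decoded, not at the prefix of y.\<close>

primrec dec :: "nat \<Rightarrow> (nat \<Rightarrow> real) \<Rightarrow> (nat \<Rightarrow> real)" where
  "dec 0 y = origin0"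
| "dec (Suc s) y = (dec s y)(Suc s := \<sigma> s (dec s y) (y (Suc s)))"

lemma enc_0 [simp]: "enc 0 x = origin0"
  by (simp add: enc_def restrict_def)

lemma enc_Suc: "enc (Suc s) x = (enc s x)(Suc s := \<tau> s (first_coords s x) (x (Suc s)))"
  by (auto simp: enc_def fun_eq_iff le_Suc_eq)

lemma first_coords_enc: "s \<le> n \<Longrightarrow> first_coords s (enc n x) = enc s x"
  by (auto simp: enc_def fun_eq_iff)

lemma enc_cong: "first_coords n x = first_coords n x' \<Longrightarrow> enc n x = enc n x'"
proof -
  assume e: "first_coords n x = first_coords n x'"
  have "first_coords (i - 1) x = first_coords (i - 1) x'" "x i = x' i" if "i \<in> {1..n}" for i
  proof -
    have "first_coords (i - 1) x = first_coords (i - 1) (first_coords n x)"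
      using that by (intro first_coords_first_coords[symmetric]) auto
    also have "\<dots> = first_coords (i - 1) x'"
      unfolding e using that by (intro first_coords_first_coords) auto
    finally show "first_coords (i - 1) x = first_coords (i - 1) x'" .
    show "x i = x' i" using fun_cong[OF e, of i] that by simp
  qed
  then show ?thesis unfolding enc_def by (intro restrict_ext) simp
qed

lemma enc_upd:
  assumes "x \<in> space (Rn s)"
  shows "enc (Suc s) (x(Suc s := r)) = (enc s x)(Suc s := \<tau> s x r)"
  using enc_cong[where n = s and x = "x(Suc s := r)" and x' = x] assms by (simp add: enc_Suc first_coords_id)

lemma enc_measurable: "n \<le> N \<Longrightarrow> n \<le> m \<Longrightarrow> enc n \<in> Rn m \<rightarrow>\<^sub>M Rn n"
  unfolding enc_def[abs_def]
proof (rule measurable_restrict)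
  fix i assume "n \<le> N" "n \<le> m" and i: "i \<in> {1..n}"
  then show "(\<lambda>x. \<tau> (i - 1) (first_coords (i - 1) x) (x i)) \<in> borel_measurable (Rn m)"
    by (intro \<tau>_measurable first_coords_measurable[where n = m] coord_measurable[where n = m]) auto
qed

lemma enc_in_space: "enc n x \<in> space (Rn n)"
  by (simp add: enc_def space_Rn)

lemma dec_measurable: "s \<le> N \<Longrightarrow> s \<le> n \<Longrightarrow> dec s \<in> Rn n \<rightarrow>\<^sub>M Rn s"
proof (induction s)
  case 0
  have "dec 0 = (\<lambda>_. origin0)" by (simp add: fun_eq_iff)
  then show ?case by (simp add: origin0_in_space)
next
  case (Suc s)
  have "(\<lambda>y. (dec s y)(Suc s := \<sigma> s (dec s y) (y (Suc s)))) \<in> Rn n \<rightarrow>\<^sub>M Rn (Suc s)"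
    using Suc by (intro upd_measurable \<sigma>_measurable coord_measurable[where n = n]) auto
  moreover have "dec (Suc s) = (\<lambda>y. (dec s y)(Suc s := \<sigma> s (dec s y) (y (Suc s))))"
    by (rule ext) (rule dec.simps)
  ultimately show ?case by (simp only:)
qed

lemma dec_enc: "s \<le> n \<Longrightarrow> n \<le> N \<Longrightarrow> dec s (enc n x) = first_coords s x"
proof (induction s)
  case 0 then show ?case by (simp add: restrict_def)
next
  case (Suc s)
  have "enc n x (Suc s) = \<tau> s (first_coords s x) (x (Suc s))" using Suc.prems by (simp add: enc_def)
  moreover have "dec s (enc n x) = first_coords s x" using Suc.prems by (intro Suc.IH) auto
  moreover have "\<sigma> s (first_coords s x) (\<tau> s (first_coords s x) (x (Suc s))) = x (Suc s)"
    using Suc.prems by (intro \<sigma>_\<tau> first_coords_in_space) simp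
  ultimately have "dec (Suc s) (enc n x) = (first_coords s x)(Suc s := x (Suc s))"
    by (simp only: dec.simps)
  then show ?case by (simp only: first_coords_Suc)
qed

text \<open>The kernel ignores the prefix of y. Hence the conditions of \<open>Pi_mart\<close> can
  be met at all pairs of prefixes, also at those off the graph of \<open>enc\<close>.\<close>

definition G :: "nat \<Rightarrow> (nat \<Rightarrow> real) \<times> (nat \<Rightarrow> real) \<Rightarrow> (real \<times> real) measure" where
  "G s z = distr (\<kappa> s (fst z)) borel (\<lambda>r. (r, \<tau> s (fst z) r))"

text \<open>Defined at every prefix of y through \<open>dec\<close>. On the range of
  \<open>enc\<close> it is the conditional law of the next coordinate of y.\<close>

definition L :: "nat \<Rightarrow> (nat \<Rightarrow> real) \<Rightarrow> real measure" where
  "L s y = distr (\<kappa> s (dec s y)) borel (\<tau> s (dec s y))"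

sublocale joint_kernels N G
proof
  fix t assume t: "t < N"
  have "(\<lambda>(z, r). (r, \<tau> t (fst z) r)) \<in> Rn2 t \<Otimes>\<^sub>M borel \<rightarrow>\<^sub>M borel"
    unfolding split_beta' by (intro Pair_borel \<tau>_measurable[OF t]) measurable
  then show "G t \<in> Rn2 t \<rightarrow>\<^sub>M prob_algebra borel"
    unfolding G_def[abs_def]
    by (intro measurable_distr_prob_space2[where M = borel] measurable_compose[OF measurable_fst kernel[OF t]])
qed

sublocale image: kernels N L
proof
  fix t assume t: "t < N"
  have d: "dec t \<in> Rn t \<rightarrow>\<^sub>M Rn t" by (rule dec_measurable) (use t in auto)
  have "(\<lambda>(y, r). \<tau> t (dec t y) r) \<in> Rn t \<Otimes>\<^sub>M borel \<rightarrow>\<^sub>M borel"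
    unfolding split_beta' by (intro \<tau>_measurable[OF t] measurable_compose[OF measurable_fst d]) measurable
  then show "L t \<in> Rn t \<rightarrow>\<^sub>M prob_algebra borel"
    unfolding L_def[abs_def]
    by (intro measurable_distr_prob_space2[where M = borel] measurable_compose[OF d kernel[OF t]])
qed

lemma distr_law_Suc:
  assumes s: "s < N" and h: "h \<in> Rn (Suc s) \<rightarrow>\<^sub>M R"
  shows "distr (law (Suc s)) R h = law s \<bind> (\<lambda>x. distr (\<kappa> s x) R (\<lambda>r. h (x(Suc s := r))))"
proof -
  have sp: "sets (law s) = sets (Rn s)" "space (law s) = space (Rn s)" using law_space[of s] s by auto
  have "distr (law (Suc s)) R h = law s \<bind> (\<lambda>x. distr (step s x) R h)"
    unfolding law_Suc[OF s]
    by (rule distr_bind[OF measurable_change_sets[OF measurable_prob_algebraD[OF step_measurable[OF s]] sp(1)] _ h])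
      (simp add: sp)
  also have "\<dots> = law s \<bind> (\<lambda>x. distr (\<kappa> s x) R (\<lambda>r. h (x(Suc s := r))))"
  proof (rule bind_cong[OF refl])
    fix x assume "x \<in> space (law s)"
    then have x: "x \<in> space (Rn s)" by (simp add: sp)
    have "(\<lambda>r. x(Suc s := r)) \<in> borel \<rightarrow>\<^sub>M Rn (Suc s)" using x by measurable
    then have "(\<lambda>r. x(Suc s := r)) \<in> \<kappa> s x \<rightarrow>\<^sub>M Rn (Suc s)"
      by (rule measurable_change_sets) (rule kernel_space[OF kernel[OF s] x])
    then show "distr (step s x) R h = distr (\<kappa> s x) R (\<lambda>r. h (x(Suc s := r)))"
      unfolding step_def by (simp add: distr_distr[OF h] comp_def)
  qed
  finally show ?thesis .
qed

lemma Pair_enc_measurable: "s \<le> N \<Longrightarrow> (\<lambda>x. (x, enc s x)) \<in> Rn s \<rightarrow>\<^sub>M Rn2 s"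
  using enc_measurable[of s s] by measurable

lemma joint_path_enc: "s \<le> N \<Longrightarrow> joint_path G s = distr (law s) (Rn2 s) (\<lambda>x. (x, enc s x))"
proof (induction s)
  case 0
  have "distr (law 0) (Rn2 0) (\<lambda>x. (x, enc 0 x)) = return (Rn2 0) (origin0, origin0)"
    unfolding law_def cond_path.simps
    by (subst distr_return[OF Pair_enc_measurable]) auto
  then show ?case by simp
next
  case (Suc s)
  then have s: "s < N" by simp
  have sp: "sets (law s) = sets (Rn s)" "space (law s) = space (Rn s)" using law_space[of s] s by auto
  have P: "(\<lambda>x. (x, enc s x)) \<in> law s \<rightarrow>\<^sub>M Rn2 s"
    by (rule measurable_change_sets[OF Pair_enc_measurable sp(1)]) (use s in simp)
  have "joint_path G (Suc s) = distr (law s) (Rn2 s) (\<lambda>x. (x, enc s x)) \<bind> jstep s"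
    unfolding joint_path_Suc using Suc by simp
  also have "\<dots> = law s \<bind> (\<lambda>x. jstep s (x, enc s x))"
    by (rule bind_distr[OF P measurable_prob_algebraD[OF jstep_measurable[OF s]]]) (simp add: sp)
  also have "\<dots> = law s \<bind> (\<lambda>x. distr (\<kappa> s x) (Rn2 (Suc s)) (\<lambda>r. (x(Suc s := r), enc (Suc s) (x(Suc s := r)))))"
  proof (rule bind_cong[OF refl])
    fix x assume "x \<in> space (law s)"
    then have x: "x \<in> space (Rn s)" and z: "(x, enc s x) \<in> space (Rn2 s)"
      by (auto simp: sp space_pair_measure enc_in_space)
    have "(\<lambda>r. (r, \<tau> s x r)) \<in> borel \<rightarrow>\<^sub>M borel"
      by (intro Pair_borel \<tau>_measurable[OF s]) (use x in auto)
    then have m: "(\<lambda>r. (r, \<tau> s x r)) \<in> \<kappa> s x \<rightarrow>\<^sub>M borel"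
      by (rule measurable_change_sets) (rule kernel_space[OF kernel[OF s] x])
    show "jstep s (x, enc s x)
        = distr (\<kappa> s x) (Rn2 (Suc s)) (\<lambda>r. (x(Suc s := r), enc (Suc s) (x(Suc s := r))))"
      unfolding jstep_def G_def
      by (simp add: distr_distr[OF upd2_measurable[OF z]] m comp_def upd2_def enc_upd[OF x])
  qed
  also have "\<dots> = distr (law (Suc s)) (Rn2 (Suc s)) (\<lambda>x. (x, enc (Suc s) x))"
    using distr_law_Suc[OF s Pair_enc_measurable] s by simp
  finally show ?case .
qed

lemma image_law: "s \<le> N \<Longrightarrow> image.law s = distr (law s) (Rn s) (enc s)"
proof (induction s)
  case 0
  have "distr (law 0) (Rn 0) (enc 0) = return (Rn 0) origin0"
    unfolding law_def cond_path.simps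
    by (subst distr_return[OF enc_measurable]) auto
  then show ?case by (simp only: image.law_def cond_path.simps)
next
  case (Suc s)
  then have s: "s < N" by simp
  have sp: "sets (law s) = sets (Rn s)" "space (law s) = space (Rn s)" using law_space[of s] s by auto
  have P: "enc s \<in> law s \<rightarrow>\<^sub>M Rn s"
    by (rule measurable_change_sets[OF enc_measurable sp(1)]) (use s in auto)
  have "image.law (Suc s) = distr (law s) (Rn s) (enc s) \<bind> image.step s"
    unfolding image.law_Suc[OF s] using Suc by simp
  also have "\<dots> = law s \<bind> (\<lambda>x. image.step s (enc s x))"
    by (rule bind_distr[OF P measurable_prob_algebraD[OF image.step_measurable[OF s]]]) (simp add: sp)
  also have "\<dots> = law s \<bind> (\<lambda>x. distr (\<kappa> s x) (Rn (Suc s)) (\<lambda>r. enc (Suc s) (x(Suc s := r))))"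
  proof (rule bind_cong[OF refl])
    fix x assume "x \<in> space (law s)"
    then have x: "x \<in> space (Rn s)" by (auto simp: sp)
    have "\<tau> s x \<in> borel \<rightarrow>\<^sub>M borel"
      using \<tau>_measurable[OF s, of "\<lambda>_. x" borel "\<lambda>r. r"] x by simp
    then have m: "\<tau> s x \<in> \<kappa> s x \<rightarrow>\<^sub>M borel"
      by (rule measurable_change_sets) (rule kernel_space[OF kernel[OF s] x])
    have u: "(\<lambda>r. (enc s x)(Suc s := r)) \<in> borel \<rightarrow>\<^sub>M Rn (Suc s)"
      using enc_in_space[of s x] by measurable
    \<comment> \<open>Here injectivity enters: the prefix of y identifies the prefix of x, so the
      law of the next y given the past of y is the image of the kernel at that single x.\<close>
    have "dec s (enc s x) = x" using dec_enc[of s s x] s x by (simp add: first_coords_id)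
    then show "image.step s (enc s x) = distr (\<kappa> s x) (Rn (Suc s)) (\<lambda>r. enc (Suc s) (x(Suc s := r)))"
      unfolding image.step_def L_def by (simp add: distr_distr[OF u m] comp_def enc_upd[OF x])
  qed
  also have "\<dots> = distr (law (Suc s)) (Rn (Suc s)) (enc (Suc s))"
    using distr_law_Suc[OF s enc_measurable[of "Suc s"]] s by simp
  finally show ?case .
qed

text \<open>The coupling is carried by the graph of \<open>enc\<close>. There, decoding the prefix
  of y returns the prefix of x, so both marginals of G are the required kernels, each evaluated at
  the prefix of its own path.\<close>

lemma bicausal_joint_path: "bicausal N \<kappa> (joint_path G N)"
  unfolding bicausal_def
proof (intro exI conjI allI impI)
  have sp: "sets (law N) = sets (Rn N)" "space (law N) = space (Rn N)" using law_space[of N] by auto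
  have P: "(\<lambda>x. (x, enc N x)) \<in> law N \<rightarrow>\<^sub>M Rn2 N"
    by (rule measurable_change_sets[OF Pair_enc_measurable sp(1)]) simp
  show "joint_disintegration N (joint_path G N) G"
    using joint_kernel by (simp add: joint_disintegration_def)
  have "distr (joint_path G N) (Rn N) snd = distr (law N) (Rn N) (enc N)"
    by (simp add: joint_path_enc distr_distr[OF measurable_snd P] comp_def)
  also have "\<dots> = cond_path L 0 N origin0" using image_law[of N] by (simp add: image.law_def)
  finally show "disintegration N (distr (joint_path G N) (Rn N) snd) L"
    using image.kernel by (simp add: disintegration_def)
  fix t assume t: "t < N"
  \<comment> \<open>Stated by coordinates, which makes the graph a measurable set.\<close>
  have "AE z in joint_path G N. \<forall>i\<in>{1..N}. snd z i = enc N (fst z) i"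
  proof -
    have [measurable]: "(\<lambda>z. snd z i) \<in> borel_measurable (Rn2 N)" "(\<lambda>z. enc N (fst z) i) \<in> borel_measurable (Rn2 N)"
      if "i \<in> {1..N}" for i
    proof -
      show "(\<lambda>z. snd z i) \<in> borel_measurable (Rn2 N)"
        by (rule coord_measurable[OF _ _ measurable_snd]) (use that in auto)
      show "(\<lambda>z. enc N (fst z) i) \<in> borel_measurable (Rn2 N)"
        by (rule coord_measurable[OF _ _ measurable_compose[OF measurable_fst enc_measurable]]) (use that in auto)
    qed
    have "{z \<in> space (Rn2 N). \<forall>i\<in>{1..N}. snd z i = enc N (fst z) i} \<in> sets (Rn2 N)" by measurable
    then show ?thesis unfolding joint_path_enc[OF order_refl] by (subst AE_distr_iff[OF P]) auto
  qed
  then show "AE (x, y) in joint_path G N. G t (first_coords t x, first_coords t y)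
      \<in> couplings (\<kappa> t (first_coords t x)) (L t (first_coords t y))"
    using AE_space
  proof eventually_elim
    case (elim z)
    define x where "x = first_coords t (fst z)"
    have x: "x \<in> space (Rn t)" by (simp add: x_def first_coords_in_space)
    have "first_coords t (snd z) = first_coords t (enc N (fst z))"
      using elim(1) t by (auto simp: fun_eq_iff)
    also have "\<dots> = enc t x"
      using t enc_cong[where n = t and x = "fst z" and x' = x] by (simp add: first_coords_enc x_def)
    finally have y: "first_coords t (snd z) = enc t x" .
    have d: "dec t (enc t x) = x" using dec_enc[of t t x] t x by (simp add: first_coords_id)
    have z: "(x, enc t x) \<in> space (Rn2 t)" using x by (simp add: space_pair_measure enc_in_space)
    have "(\<lambda>r. (r, \<tau> t x r)) \<in> borel \<rightarrow>\<^sub>M borel"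
      by (intro Pair_borel \<tau>_measurable[OF t]) (use x in auto)
    then have m: "(\<lambda>r. (r, \<tau> t x r)) \<in> \<kappa> t x \<rightarrow>\<^sub>M borel"
      by (rule measurable_change_sets) (rule kernel_space[OF kernel[OF t] x])
    have "G t (x, enc t x) \<in> couplings (\<kappa> t x) (L t (enc t x))"
      unfolding couplings_def
    proof (intro CollectI conjI)
      show "G t (x, enc t x) \<in> space (prob_algebra borel)" by (rule measurable_space[OF joint_kernel[OF t] z])
      have "distr (G t (x, enc t x)) borel fst = distr (\<kappa> t x) borel (\<lambda>r. r)"
        unfolding G_def by (simp add: distr_distr[OF fst_borel m] comp_def)
      also have "\<dots> = \<kappa> t x" by (rule distr_id2) (simp add: kernel_space[OF kernel[OF t] x])
      finally show "distr (G t (x, enc t x)) borel fst = \<kappa> t x" .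
      show "distr (G t (x, enc t x)) borel snd = L t (enc t x)"
        unfolding G_def L_def d by (simp add: distr_distr[OF snd_borel m] comp_def)
    qed
    then show ?case by (simp add: split_beta' y x_def[symmetric])
  qed
qed

end


section \<open>Worst-case perturbations\<close>

text \<open>Convexity of the power including the endpoint 0, where the extremal direction may lie;
  there the inequality reduces to u^p \<le> u for weights u in [0, 1].\<close>

lemma powr_convex_combination:
  fixes a b u p :: real
  assumes "p \<ge> 1" "a \<ge> 0" "b \<ge> 0" "0 \<le> u" "u \<le> 1"
  shows "((1 - u) * a + u * b) powr p \<le> (1 - u) * a powr p + u * b powr p"
proof -
  have scale: "(v * c) powr p \<le> v * c powr p" if "0 \<le> v" "v \<le> 1" "c \<ge> 0" for v c
  proof -
    have "v powr p \<le> v powr 1" using that assms by (intro powr_mono') auto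
    then show ?thesis using that by (simp add: powr_mult mult_right_mono)
  qed
  consider "a = 0" | "b = 0" | "a > 0" "b > 0" using assms by linarith
  then show ?thesis
  proof cases
    case 3
    then show ?thesis using convex_onD[OF powr_convex[OF assms(1)], of u a b] assms by simp
  qed (use scale[of u b] scale[of "1 - u" a] assms in auto)
qed

definition squash :: "real \<Rightarrow> real" where
  "squash r = arctan r / pi + 1 / 2"

definition unsquash :: "real \<Rightarrow> real" where
  "unsquash v = tan (pi * (v - 1 / 2))"

lemma squash_bounds: "0 < squash r" "squash r < 1"
  using arctan_bounded[of r] pi_gt_zero by (auto simp: squash_def field_simps)

lemma unsquash_squash: "unsquash (squash r) = r"
  by (simp add: squash_def unsquash_def tan_arctan)

text \<open>Rounding \<^term>\<open>w\<close> to a grid of mesh \<^term>\<open>e\<close> frees the fractional part, which then stores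
  \<^term>\<open>r\<close>; this makes every displacement injective at the price of an error of size \<^term>\<open>e\<close>.\<close>

definition grid_store :: "real \<Rightarrow> real \<Rightarrow> real \<Rightarrow> real" where
  "grid_store e w r = e * (of_int \<lfloor>w / e\<rfloor> + squash r)"

lemma grid_store_error:
  assumes "e > 0"
  shows "\<bar>grid_store e w r - w\<bar> \<le> e"
proof -
  have "\<bar>of_int \<lfloor>w / e\<rfloor> + squash r - w / e\<bar> \<le> 1"
    using squash_bounds[of r] floor_correct[of "w / e"] by linarith
  then have "e * \<bar>of_int \<lfloor>w / e\<rfloor> + squash r - w / e\<bar> \<le> e * 1" using assms by (intro mult_left_mono) auto
  moreover have "grid_store e w r - w = e * (of_int \<lfloor>w / e\<rfloor> + squash r - w / e)"
    using assms by (simp add: grid_store_def algebra_simps)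
  ultimately show ?thesis using assms by (simp add: abs_mult)
qed

lemma grid_retrieve:
  assumes "e > 0"
  shows "unsquash (frac (grid_store e w r / e)) = r"
proof -
  have "frac (grid_store e w r / e) = squash r"
    using assms squash_bounds[of r] by (simp add: frac_unique_iff grid_store_def)
  then show ?thesis by (simp add: unsquash_squash)
qed

lemma grid_store_measurable [measurable]:
  assumes [measurable]: "w \<in> borel_measurable M" "v \<in> borel_measurable M"
  shows "(\<lambda>x. grid_store e (w x) (v x)) \<in> borel_measurable M"
  unfolding grid_store_def squash_def by measurable

lemma tan_measurable: "(tan :: real \<Rightarrow> real) \<in> borel_measurable borel"
  unfolding tan_def[abs_def] by measurable

lemma unsquash_measurable [measurable]: "unsquash \<in> borel_measurable borel"
  unfolding unsquash_def[abs_def] by (rule measurable_compose[OF _ tan_measurable]) measurable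

lemma frac_measurable: "(frac :: real \<Rightarrow> real) \<in> borel_measurable borel"
  unfolding frac_def[abs_def] by measurable

section \<open>The extremal displacement, made injective and exactly centred\<close>

context control_problem
begin

declare coordinate_measurable [measurable del]

text \<open>Shortening the step from \<open>\<delta>\<close> to \<open>\<delta> - 4 \<delta>\<^sup>2\<close> pays for the rounding error and its
  correction by the drift, each at most \<open>\<delta>\<^sup>2\<close>, so that the cost stays strictly below \<open>\<delta>\<close>.\<close>

definition raw_shift :: "((nat \<Rightarrow> real) \<Rightarrow> (nat \<Rightarrow> real)) \<Rightarrow> real \<Rightarrow> nat \<Rightarrow> (nat \<Rightarrow> real) \<Rightarrow> real \<Rightarrow> real" where
  "raw_shift \<alpha> \<delta> s x r = grid_store (\<delta>\<^sup>2) (r + (\<delta> - 4 * \<delta>\<^sup>2) * direction \<alpha> s x r) r"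

text \<open>The mean added by the rounding at this prefix. The direction itself has mean zero, so
  subtracting the drift restores the martingale constraint exactly.\<close>

definition drift :: "((nat \<Rightarrow> real) \<Rightarrow> (nat \<Rightarrow> real)) \<Rightarrow> real \<Rightarrow> nat \<Rightarrow> (nat \<Rightarrow> real) \<Rightarrow> real" where
  "drift \<alpha> \<delta> s x = (\<integral>r. raw_shift \<alpha> \<delta> s x r - r - (\<delta> - 4 * \<delta>\<^sup>2) * direction \<alpha> s x r \<partial>\<kappa> s x)"

definition shift_map :: "((nat \<Rightarrow> real) \<Rightarrow> (nat \<Rightarrow> real)) \<Rightarrow> real \<Rightarrow> nat \<Rightarrow> (nat \<Rightarrow> real) \<Rightarrow> real \<Rightarrow> real" where
  "shift_map \<alpha> \<delta> s x r = raw_shift \<alpha> \<delta> s x r - drift \<alpha> \<delta> s x"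

text \<open>The drift depends only on the prefix of x, which is known when decoding, so it can be
  added back before the fractional part is read off.\<close>

definition unshift_map :: "((nat \<Rightarrow> real) \<Rightarrow> (nat \<Rightarrow> real)) \<Rightarrow> real \<Rightarrow> nat \<Rightarrow> (nat \<Rightarrow> real) \<Rightarrow> real \<Rightarrow> real" where
  "unshift_map \<alpha> \<delta> s x y = unsquash (frac ((y + drift \<alpha> \<delta> s x) / \<delta>\<^sup>2))"

lemma raw_shift_measurable:
  assumes \<alpha>: "\<alpha> \<in> controls K N" and s: "s < N"
  shows "(\<lambda>(x, r). raw_shift \<alpha> \<delta> s x r) \<in> borel_measurable (Rn s \<Otimes>\<^sub>M borel)"
proof -
  have [measurable]: "(\<lambda>z. direction \<alpha> s (fst z) (snd z)) \<in> borel_measurable (Rn s \<Otimes>\<^sub>M borel)"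
    using direction_measurable[OF assms] by (simp add: split_beta')
  show ?thesis unfolding raw_shift_def split_beta' by measurable
qed

lemma drift_measurable:
  assumes \<alpha>: "\<alpha> \<in> controls K N" and s: "s < N"
  shows "drift \<alpha> \<delta> s \<in> borel_measurable (Rn s)"
  unfolding drift_def[abs_def]
proof (rule integral_measurable_kernel(1)[OF _ measurable_prob_algebraD[OF kernel[OF s]]])
  have [measurable]: "(\<lambda>z. direction \<alpha> s (fst z) (snd z)) \<in> borel_measurable (Rn s \<Otimes>\<^sub>M borel)"
    using direction_measurable[OF assms] by (simp add: split_beta')
  have [measurable]: "(\<lambda>z. raw_shift \<alpha> \<delta> s (fst z) (snd z)) \<in> borel_measurable (Rn s \<Otimes>\<^sub>M borel)"
    using raw_shift_measurable[OF assms] by (simp add: split_beta')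
  show "(\<lambda>(x, r). raw_shift \<alpha> \<delta> s x r - r - (\<delta> - 4 * \<delta>\<^sup>2) * direction \<alpha> s x r) \<in> borel_measurable (Rn s \<Otimes>\<^sub>M borel)"
    unfolding split_beta' by measurable
qed

lemma shift_map_measurable:
  assumes \<alpha>: "\<alpha> \<in> controls K N" and s: "s < N"
  shows "(\<lambda>(x, r). shift_map \<alpha> \<delta> s x r) \<in> borel_measurable (Rn s \<Otimes>\<^sub>M borel)"
    and "(\<lambda>(x, r). unshift_map \<alpha> \<delta> s x r) \<in> borel_measurable (Rn s \<Otimes>\<^sub>M borel)"
proof -
  have [measurable]: "(\<lambda>z. raw_shift \<alpha> \<delta> s (fst z) (snd z)) \<in> borel_measurable (Rn s \<Otimes>\<^sub>M borel)"
    using raw_shift_measurable[OF assms] by (simp add: split_beta')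
  note [measurable] = drift_measurable[OF assms] frac_measurable
  show "(\<lambda>(x, r). shift_map \<alpha> \<delta> s x r) \<in> borel_measurable (Rn s \<Otimes>\<^sub>M borel)"
    unfolding shift_map_def split_beta' by measurable
  show "(\<lambda>(x, r). unshift_map \<alpha> \<delta> s x r) \<in> borel_measurable (Rn s \<Otimes>\<^sub>M borel)"
    unfolding unshift_map_def split_beta' by measurable
qed

lemma unshift_shift: "\<delta> > 0 \<Longrightarrow> unshift_map \<alpha> \<delta> s x (shift_map \<alpha> \<delta> s x r) = r"
  using grid_retrieve[of "\<delta>\<^sup>2"] by (simp add: unshift_map_def shift_map_def raw_shift_def)

lemma raw_shift_error:
  "\<delta> > 0 \<Longrightarrow> \<bar>raw_shift \<alpha> \<delta> s x r - r - (\<delta> - 4 * \<delta>\<^sup>2) * direction \<alpha> s x r\<bar> \<le> \<delta>\<^sup>2"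
  using grid_store_error[of "\<delta>\<^sup>2" "r + (\<delta> - 4 * \<delta>\<^sup>2) * direction \<alpha> s x r" r] by (simp add: raw_shift_def algebra_simps)

lemma fixed_prefix_measurable:
  assumes h: "(\<lambda>(x, r). h x r) \<in> borel_measurable (Rn s \<Otimes>\<^sub>M borel)" and s: "s < N" and x: "x \<in> space (Rn s)"
  shows "(h x :: real \<Rightarrow> real) \<in> borel_measurable borel" "h x \<in> borel_measurable (\<kappa> s x)"
proof -
  have "(\<lambda>r. (\<lambda>(x, r). h x r) (x, r)) \<in> borel_measurable borel"
    by (rule measurable_compose[OF measurable_Pair1' h]) (use x in simp)
  then show "h x \<in> borel_measurable borel" by simp
  then show "h x \<in> borel_measurable (\<kappa> s x)"
    by (rule measurable_change_sets) (rule kernel_space[OF kernel[OF s] x])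
qed

lemma drift_bound:
  assumes \<alpha>: "\<alpha> \<in> controls K N" and s: "s < N" and x: "x \<in> space (Rn s)" and \<delta>: "\<delta> > 0"
  shows "\<bar>drift \<alpha> \<delta> s x\<bar> \<le> \<delta>\<^sup>2"
    and "integrable (\<kappa> s x) (\<lambda>r. raw_shift \<alpha> \<delta> s x r - r - (\<delta> - 4 * \<delta>\<^sup>2) * direction \<alpha> s x r)"
proof -
  interpret prob_space "\<kappa> s x" by (rule kernel_space[OF kernel[OF s] x])
  have sk [measurable_cong]: "sets (\<kappa> s x) = sets borel" by (rule kernel_space[OF kernel[OF s] x])
  note [measurable] = fixed_prefix_measurable(1)[OF direction_measurable[OF \<alpha> s] s x]
    fixed_prefix_measurable(1)[OF raw_shift_measurable[OF \<alpha> s] s x]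
  let ?e = "\<lambda>r. raw_shift \<alpha> \<delta> s x r - r - (\<delta> - 4 * \<delta>\<^sup>2) * direction \<alpha> s x r"
  show int: "integrable (\<kappa> s x) ?e"
    by (rule integrable_const_bound[of _ "\<delta>\<^sup>2"]) (use raw_shift_error[OF \<delta>] in auto)
  have "\<bar>drift \<alpha> \<delta> s x\<bar> \<le> (\<integral>r. \<bar>?e r\<bar> \<partial>\<kappa> s x)" unfolding drift_def by (rule integral_abs_bound)
  also have "\<dots> \<le> (\<integral>r. \<delta>\<^sup>2 \<partial>\<kappa> s x)"
    using int raw_shift_error[OF \<delta>] by (intro integral_mono) auto
  finally show "\<bar>drift \<alpha> \<delta> s x\<bar> \<le> \<delta>\<^sup>2" by (simp add: prob_space)
qed

lemma shift_map_error:
  assumes \<alpha>: "\<alpha> \<in> controls K N" and s: "s < N" and x: "x \<in> space (Rn s)" and \<delta>: "\<delta> > 0"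
  shows "\<bar>shift_map \<alpha> \<delta> s x r - r - (\<delta> - 4 * \<delta>\<^sup>2) * direction \<alpha> s x r\<bar> \<le> 2 * \<delta>\<^sup>2"
  using drift_bound(1)[OF assms] raw_shift_error[OF \<delta>, of \<alpha> s x r] by (simp add: shift_map_def)

lemma shift_map_mean:
  assumes \<alpha>: "\<alpha> \<in> controls K N" and s: "s < N" and x: "x \<in> space (Rn s)" and \<delta>: "\<delta> > 0"
  shows "(\<integral>r. shift_map \<alpha> \<delta> s x r - r \<partial>\<kappa> s x) = 0"
proof -
  interpret shifted_Lq p q "\<kappa> s x" "ngrad \<alpha> s x" by (rule shifted_Lq_ngrad[OF \<alpha> s x])
  define e where "e r = raw_shift \<alpha> \<delta> s x r - r - (\<delta> - 4 * \<delta>\<^sup>2) * direction \<alpha> s x r" for r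
  have e: "integrable (\<kappa> s x) e" "drift \<alpha> \<delta> s x = (\<integral>r. e r \<partial>\<kappa> s x)"
    using drift_bound(2)[OF assms] by (simp_all add: e_def[abs_def] drift_def)
  have h: "integrable (\<kappa> s x) (direction \<alpha> s x)" "(\<integral>r. direction \<alpha> s x r \<partial>\<kappa> s x) = 0"
    unfolding direction_def by (rule integrable_dual_direction, rule integral_dual_direction)
  have "(\<integral>r. shift_map \<alpha> \<delta> s x r - r \<partial>\<kappa> s x)
      = (\<integral>r. e r + (\<delta> - 4 * \<delta>\<^sup>2) * direction \<alpha> s x r - drift \<alpha> \<delta> s x \<partial>\<kappa> s x)"
    by (intro Bochner_Integration.integral_cong refl) (simp add: shift_map_def e_def)
  also have "\<dots> = (\<integral>r. e r \<partial>\<kappa> s x) + (\<delta> - 4 * \<delta>\<^sup>2) * (\<integral>r. direction \<alpha> s x r \<partial>\<kappa> s x) - drift \<alpha> \<delta> s x"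
    using h(1) e(1) by (simp add: prob_space)
  finally show ?thesis by (simp add: h(2) e(2))
qed

text \<open>The error 2 \<delta>^2 is \<delta> times the weight 4 \<delta> times the value 1/2. The
  displacement is thus at most \<delta> times a convex combination of |h| and 1/2 with weights 1 - 4
  \<delta> and 4 \<delta>. As (1/2)^p < 1, convexity gives a moment strictly below \<delta>^p even
  when h has p-th moment one.\<close>

lemma shift_map_moment:
  assumes \<alpha>: "\<alpha> \<in> controls K N" and s: "s < N" and x: "x \<in> space (Rn s)" and \<delta>: "0 < \<delta>" "\<delta> < 1 / 4"
  shows "(\<integral>\<^sup>+r. ennreal (\<bar>r - shift_map \<alpha> \<delta> s x r\<bar> powr p) \<partial>\<kappa> s x) < ennreal (\<delta> powr p)"
proof -
  interpret shifted_Lq p q "\<kappa> s x" "ngrad \<alpha> s x" by (rule shifted_Lq_ngrad[OF \<alpha> s x])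
  have sk [measurable_cong]: "sets (\<kappa> s x) = sets borel" by (rule kernel_space[OF kernel[OF s] x])
  note [measurable] = fixed_prefix_measurable(1)[OF direction_measurable[OF \<alpha> s] s x]
    fixed_prefix_measurable(1)[OF shift_map_measurable(1)[OF \<alpha> s] s x]
  let ?h = "direction \<alpha> s x"
  have h: "integrable (\<kappa> s x) (\<lambda>r. \<bar>?h r\<bar> powr p)" "(\<integral>r. \<bar>?h r\<bar> powr p \<partial>\<kappa> s x) \<le> 1"
    unfolding direction_def by (rule integrable_dual_direction_powr, rule integral_dual_direction_powr)
  define b where "b = (1 / 2 :: real) powr p"
  have b: "b < 1"
  proof -
    have "b < (1 :: real) powr p" unfolding b_def using p_gt_1 by (intro powr_less_mono2) auto
    then show ?thesis by simp
  qed
  have pt: "\<bar>r - shift_map \<alpha> \<delta> s x r\<bar> powr p \<le> \<delta> powr p * ((1 - 4 * \<delta>) * \<bar>?h r\<bar> powr p + 4 * \<delta> * b)" for r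
  proof -
    have "\<bar>r - shift_map \<alpha> \<delta> s x r\<bar> \<le> \<bar>(\<delta> - 4 * \<delta>\<^sup>2) * ?h r\<bar> + 2 * \<delta>\<^sup>2"
      using shift_map_error[OF \<alpha> s x \<delta>(1), of r] by linarith
    also have "\<bar>(\<delta> - 4 * \<delta>\<^sup>2) * ?h r\<bar> = \<delta> * (1 - 4 * \<delta>) * \<bar>?h r\<bar>"
    proof -
      have "\<delta> - 4 * \<delta>\<^sup>2 = \<delta> * (1 - 4 * \<delta>)" by (simp add: power2_eq_square algebra_simps)
      then show ?thesis using \<delta> by (simp add: abs_mult)
    qed
    also have "\<delta> * (1 - 4 * \<delta>) * \<bar>?h r\<bar> + 2 * \<delta>\<^sup>2 = \<delta> * ((1 - 4 * \<delta>) * \<bar>?h r\<bar> + 4 * \<delta> * (1 / 2))"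
      by (simp add: power2_eq_square algebra_simps)
    finally have "\<bar>r - shift_map \<alpha> \<delta> s x r\<bar> powr p \<le> (\<delta> * ((1 - 4 * \<delta>) * \<bar>?h r\<bar> + 4 * \<delta> * (1 / 2))) powr p"
      using p_gt_1 by (intro powr_mono2) auto
    also have "\<dots> = \<delta> powr p * ((1 - 4 * \<delta>) * \<bar>?h r\<bar> + 4 * \<delta> * (1 / 2)) powr p"
      using \<delta> by (intro powr_mult)
    also have "\<dots> \<le> \<delta> powr p * ((1 - 4 * \<delta>) * \<bar>?h r\<bar> powr p + 4 * \<delta> * (1 / 2) powr p)"
      using \<delta> p_gt_1 by (intro mult_left_mono powr_convex_combination) auto
    finally show ?thesis by (simp add: b_def)
  qed
  have int: "integrable (\<kappa> s x) (\<lambda>r. \<delta> powr p * ((1 - 4 * \<delta>) * \<bar>?h r\<bar> powr p + 4 * \<delta> * b))"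
    using h(1) by simp
  have "(\<integral>\<^sup>+r. ennreal (\<bar>r - shift_map \<alpha> \<delta> s x r\<bar> powr p) \<partial>\<kappa> s x)
      \<le> (\<integral>\<^sup>+r. ennreal (\<delta> powr p * ((1 - 4 * \<delta>) * \<bar>?h r\<bar> powr p + 4 * \<delta> * b)) \<partial>\<kappa> s x)"
    using pt by (intro nn_integral_mono ennreal_leI)
  also have "\<dots> = ennreal (\<integral>r. \<delta> powr p * ((1 - 4 * \<delta>) * \<bar>?h r\<bar> powr p + 4 * \<delta> * b) \<partial>\<kappa> s x)"
    using \<delta> by (intro nn_integral_eq_integral int) (auto simp: b_def)
  also have "(\<integral>r. \<delta> powr p * ((1 - 4 * \<delta>) * \<bar>?h r\<bar> powr p + 4 * \<delta> * b) \<partial>\<kappa> s x)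
      = \<delta> powr p * ((1 - 4 * \<delta>) * (\<integral>r. \<bar>?h r\<bar> powr p \<partial>\<kappa> s x) + 4 * \<delta> * b)"
    using h(1) by (simp add: prob_space)
  also have "ennreal \<dots> < ennreal (\<delta> powr p)"
  proof -
    have "(1 - 4 * \<delta>) * (\<integral>r. \<bar>?h r\<bar> powr p \<partial>\<kappa> s x) \<le> (1 - 4 * \<delta>) * 1"
      using \<delta> h(2) by (intro mult_left_mono) auto
    moreover have "4 * \<delta> * b < 4 * \<delta> * 1" using \<delta> b by (intro mult_strict_left_mono) auto
    ultimately have "(1 - 4 * \<delta>) * (\<integral>r. \<bar>?h r\<bar> powr p \<partial>\<kappa> s x) + 4 * \<delta> * b < (1 - 4 * \<delta>) * 1 + 4 * \<delta> * 1"
      by (rule add_le_less_mono)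
    then have "(1 - 4 * \<delta>) * (\<integral>r. \<bar>?h r\<bar> powr p \<partial>\<kappa> s x) + 4 * \<delta> * b < 1" by simp
    then have "\<delta> powr p * ((1 - 4 * \<delta>) * (\<integral>r. \<bar>?h r\<bar> powr p \<partial>\<kappa> s x) + 4 * \<delta> * b) < \<delta> powr p * 1"
      using \<delta> by (intro mult_strict_left_mono) auto
    then show ?thesis using \<delta> by (simp add: ennreal_less_iff b_def)
  qed
  finally show ?thesis .
qed

lemma shift_map_mart_coupling:
  assumes \<alpha>: "\<alpha> \<in> controls K N" and s: "s < N" and x: "x \<in> space (Rn s)" and \<delta>: "0 < \<delta>" "\<delta> < 1 / 4"
  shows "distr (\<kappa> s x) borel (\<lambda>r. (r, shift_map \<alpha> \<delta> s x r)) \<in> mart_couplings p \<delta> (\<kappa> s x)"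
proof -
  note ks = kernel_space[OF kernel[OF s] x]
  interpret prob_space "\<kappa> s x" by (rule ks)
  note [measurable_cong] = ks(2)
  note [measurable] = fixed_prefix_measurable(1)[OF shift_map_measurable(1)[OF \<alpha> s] s x]
  have m: "(\<lambda>r. (r, shift_map \<alpha> \<delta> s x r)) \<in> \<kappa> s x \<rightarrow>\<^sub>M borel"
    by (rule Pair_borel) measurable
  let ?\<pi> = "distr (\<kappa> s x) borel (\<lambda>r. (r, shift_map \<alpha> \<delta> s x r))"
  have [measurable]: "(\<lambda>z. fst z - snd z) \<in> borel_measurable (borel :: (real \<times> real) measure)"
    by (intro borel_measurable_diff fst_borel snd_borel)
  have "distr ?\<pi> borel fst = distr (\<kappa> s x) borel (\<lambda>r. r)"
    by (simp add: distr_distr[OF fst_borel m] comp_def)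
  also have "\<dots> = \<kappa> s x" by (rule distr_id2) (simp add: ks)
  finally have f: "distr ?\<pi> borel fst = \<kappa> s x" .
  have "(\<integral>\<^sup>+z. ennreal (\<bar>case z of (x, y) \<Rightarrow> x - y\<bar> powr p) \<partial>?\<pi>)
      = (\<integral>\<^sup>+r. ennreal (\<bar>r - shift_map \<alpha> \<delta> s x r\<bar> powr p) \<partial>\<kappa> s x)"
    unfolding split_beta' by (subst nn_integral_distr[OF m]) (auto simp: measurable_distr_eq1)
  also note shift_map_moment[OF assms]
  finally have "(\<integral>\<^sup>+z. ennreal (\<bar>case z of (x, y) \<Rightarrow> x - y\<bar> powr p) \<partial>?\<pi>) < ennreal (\<delta> powr p)" .
  then have "Cp p ?\<pi> < ennreal \<delta>"
    unfolding Cp_def Lnorm_def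
  proof (cases "\<integral>\<^sup>+z. ennreal (\<bar>case z of (x, y) \<Rightarrow> x - y\<bar> powr p) \<partial>?\<pi>")
    case (real v)
    assume less: "(\<integral>\<^sup>+z. ennreal (\<bar>case z of (x, y) \<Rightarrow> x - y\<bar> powr p) \<partial>?\<pi>) < ennreal (\<delta> powr p)"
    then have "v < \<delta> powr p" using real by (simp add: ennreal_less_iff)
    then have "v powr (1 / p) < (\<delta> powr p) powr (1 / p)"
      using p_gt_1 real by (intro powr_less_mono2) auto
    also have "\<dots> = \<delta>" using p_gt_1 \<delta> by (simp add: powr_powr)
    finally show "eroot p (\<integral>\<^sup>+z. ennreal (\<bar>case z of (x, y) \<Rightarrow> x - y\<bar> powr p) \<partial>?\<pi>) < ennreal \<delta>"
      unfolding real(2) using real(1) by (simp add: eroot_def ennreal_less_iff)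
  qed auto
  moreover have "(\<integral>z. (case z of (x, y) \<Rightarrow> x - y) \<partial>?\<pi>) = 0"
  proof -
    have "(\<integral>z. (case z of (x, y) \<Rightarrow> x - y) \<partial>?\<pi>) = (\<integral>r. r - shift_map \<alpha> \<delta> s x r \<partial>\<kappa> s x)"
      unfolding split_beta' by (subst integral_distr[OF m]) auto
    also have "\<dots> = - (\<integral>r. shift_map \<alpha> \<delta> s x r - r \<partial>\<kappa> s x)"
      unfolding Bochner_Integration.integral_minus[symmetric] by simp
    finally show ?thesis using shift_map_mean[OF \<alpha> s x \<delta>(1)] by simp
  qed
  ultimately show ?thesis
    using f prob_space_distr[OF m] by (simp add: mart_couplings_def space_prob_algebra)
qed

text \<open>Reduces the game to a single map T: the last property lets the lower bound ignore joint
  controls and couplings and compare with controls of x at the displaced path only.\<close>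

lemma ex_perturbation:
  assumes \<alpha>: "\<alpha> \<in> controls K N" and \<delta>: "0 < \<delta>" "\<delta> < 1 / 4"
  obtains T where "displacement p q N K f C \<epsilon>0 \<kappa> \<epsilon> \<mu> (\<lambda>x. x) T \<delta>"
    and "\<And>x i. x \<in> space (Rn N) \<Longrightarrow> i \<in> {1..N} \<Longrightarrow>
      \<bar>T x i - x i - (\<delta> - 4 * \<delta>\<^sup>2) * direction \<alpha> (i - 1) (first_coords (i - 1) x) (x i)\<bar> \<le> 2 * \<delta>\<^sup>2"
    and "\<And>c. (\<And>\<beta>. \<beta> \<in> controls K N \<Longrightarrow> c \<le> (\<integral>x. f (T x) (\<beta> x) \<partial>\<mu>)) \<Longrightarrow> ereal c \<le> V_mart p N K \<kappa> f \<delta>"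
proof -
  interpret T: injective_transport N \<kappa> "shift_map \<alpha> \<delta>" "unshift_map \<alpha> \<delta>"
    by unfold_locales (use shift_map_measurable[OF \<alpha>] unshift_shift[OF \<delta>(1)] in auto)
  have G: "T.G s (x, y) \<in> mart_couplings p \<delta> (\<kappa> s x)" if "s < N" "x \<in> space (Rn s)" for s x y
    using shift_map_mart_coupling[OF \<alpha> that \<delta>] by (simp add: T.G_def)
  interpret M: mart_perturbation p q N K f C \<epsilon>0 \<kappa> \<epsilon> T.G \<delta>
    by unfold_locales (use \<delta> G in auto)
  define T where "T = T.enc N"
  have T: "T \<in> Rn N \<rightarrow>\<^sub>M Rn N" unfolding T_def by (rule T.enc_measurable) auto
  have \<Gamma>: "joint_path T.G N = distr \<mu> (Rn2 N) (\<lambda>x. (x, T x))"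
    unfolding T_def by (rule T.joint_path_enc) simp
  have P: "(\<lambda>x. (x, T x)) \<in> \<mu> \<rightarrow>\<^sub>M Rn2 N"
    by (rule measurable_change_sets[of _ "Rn N"]) (use T in measurable)
  have dm: "(\<lambda>z. \<bar>snd z i - fst z i\<bar> powr p) \<in> borel_measurable (Rn2 N)" if "i \<in> {1..N}" for i
    using measurable_change_sets[OF M.displacement_measurable[OF that], of "Rn2 N"] by measurable
  show ?thesis
  proof (rule that)
    show "displacement p q N K f C \<epsilon>0 \<kappa> \<epsilon> \<mu> (\<lambda>x. x) T \<delta>"
    proof
      show "(\<lambda>x. x) \<in> \<mu> \<rightarrow>\<^sub>M Rn N" by (rule measurable_ident_sets) simp
      show "T \<in> \<mu> \<rightarrow>\<^sub>M Rn N" by (rule measurable_change_sets[OF T]) simp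
      show "distr \<mu> (Rn N) (\<lambda>x. x) = \<mu>" by (rule distr_id2) simp
      show "integrable \<mu> (\<lambda>x. \<bar>T x i - x i\<bar> powr p)" if "i \<in> {1..N}" for i
        using M.displacement_powr(1)[OF that] unfolding \<Gamma> by (simp add: integrable_distr_eq[OF P dm[OF that]])
      show "(\<integral>x. \<bar>T x i - x i\<bar> powr p \<partial>\<mu>) \<le> \<delta> powr p" if "i \<in> {1..N}" for i
        using M.displacement_powr(2)[OF that] unfolding \<Gamma> by (simp add: integral_distr[OF P dm[OF that]])
    qed (rule \<delta>)
    show "\<bar>T x i - x i - (\<delta> - 4 * \<delta>\<^sup>2) * direction \<alpha> (i - 1) (first_coords (i - 1) x) (x i)\<bar> \<le> 2 * \<delta>\<^sup>2"
      if "x \<in> space (Rn N)" "i \<in> {1..N}" for x i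
    proof -
      have "i - 1 < N" using that(2) by auto
      from shift_map_error[OF \<alpha> this first_coords_in_space \<delta>(1), of x "x i"] that(2)
      show ?thesis by (simp add: T_def T.enc_def)
    qed
    fix c assume c: "\<And>\<beta>. \<beta> \<in> controls K N \<Longrightarrow> c \<le> (\<integral>x. f (T x) (\<beta> x) \<partial>\<mu>)"
    have mem: "joint_path T.G N \<in> Pi_mart_bc p N \<kappa> \<delta>"
    proof -
      have "joint_disintegration N (joint_path T.G N) T.G"
        using T.joint_kernel by (simp add: joint_disintegration_def)
      moreover have "\<forall>s<N. \<forall>x\<in>space (Rn s). \<forall>y\<in>space (Rn s). T.G s (x, y) \<in> mart_couplings p \<delta> (\<kappa> s x)"
        using G by blast
      ultimately show ?thesis
        unfolding Pi_mart_bc_def Pi_mart_def using T.bicausal_joint_path by blast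
    qed
    show "ereal c \<le> V_mart p N K \<kappa> f \<delta>"
      unfolding V_mart_def
    proof (rule INF_greatest)
      fix A assume A: "A \<in> joint_controls K N"
      then have Am: "(\<lambda>z. A (fst z) (snd z)) \<in> Rn2 N \<rightarrow>\<^sub>M Rn N"
        and AK: "\<And>x y. x \<in> space (Rn N) \<Longrightarrow> y \<in> space (Rn N) \<Longrightarrow> A x y \<in> Kn K N"
        and Ap: "\<And>t x y x' y'. t \<in> {1..N} \<Longrightarrow> x \<in> space (Rn N) \<Longrightarrow> y \<in> space (Rn N) \<Longrightarrow> x' \<in> space (Rn N) \<Longrightarrow>
          y' \<in> space (Rn N) \<Longrightarrow> first_coords (t - 1) x = first_coords (t - 1) x' \<Longrightarrow>
          first_coords (t - 1) y = first_coords (t - 1) y' \<Longrightarrow> A x y t = A x' y' t"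
        unfolding joint_controls_def mem_Collect_eq split_beta' by (elim conjE, blast)+
      have TS: "T x \<in> space (Rn N)" for x unfolding T_def by (rule T.enc_in_space)
      have \<beta>: "(\<lambda>x. A x (T x)) \<in> controls K N"
        unfolding controls_def
      proof (intro CollectI conjI ballI impI)
        have "(\<lambda>x. (x, T x)) \<in> Rn N \<rightarrow>\<^sub>M Rn2 N" using T by measurable
        from measurable_compose[OF this Am] show "(\<lambda>x. A x (T x)) \<in> Rn N \<rightarrow>\<^sub>M Rn N" by simp
        show "A x (T x) \<in> Kn K N" if "x \<in> space (Rn N)" for x using AK that TS by blast
        fix t x x' assume t: "t \<in> {1..N}" and x: "x \<in> space (Rn N)" "x' \<in> space (Rn N)"
          and e: "first_coords (t - 1) x = first_coords (t - 1) x'"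
        \<comment> \<open>T is adapted, so a control that looks at the pasts of x and of T x looks
          at the past of x only.\<close>
        have "first_coords (t - 1) (T x) = first_coords (t - 1) (T x')"
        proof -
          have "t - 1 \<le> N" using t by auto
          then show ?thesis unfolding T_def using T.enc_cong[OF e] by (simp only: T.first_coords_enc)
        qed
        then show "A x (T x) t = A x' (T x') t" by (rule Ap[OF t x(1) TS x(2) TS e])
      qed
      have Fm: "(\<lambda>z. f (snd z) (A (fst z) (snd z))) \<in> borel_measurable (Rn2 N)"
        by (rule cost_measurable[OF measurable_snd Am]) (use AK in \<open>simp add: space_pair_measure mem_Times_iff\<close>)
      have "(\<integral>(x, y). f y (A x y) \<partial>joint_path T.G N) = (\<integral>x. f (T x) (A x (T x)) \<partial>\<mu>)"
        unfolding \<Gamma> split_beta' by (simp add: integral_distr[OF P Fm])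
      then have "ereal c \<le> ereal (\<integral>(x, y). f y (A x y) \<partial>joint_path T.G N)"
        using c[OF \<beta>] by simp
      also have "\<dots> \<le> (SUP \<gamma>\<in>Pi_mart_bc p N \<kappa> \<delta>. ereal (\<integral>(x, y). f y (A x y) \<partial>\<gamma>))"
        by (rule SUP_upper[OF mem])
      finally show "ereal c \<le> (SUP \<gamma>\<in>Pi_mart_bc p N \<kappa> \<delta>. ereal (\<integral>(x, y). f y (A x y) \<partial>\<gamma>))" .
    qed
  qed
qed

end


section \<open>Lower bound\<close>

context control_problem
begin

definition path_direction :: "((nat \<Rightarrow> real) \<Rightarrow> (nat \<Rightarrow> real)) \<Rightarrow> nat \<Rightarrow> (nat \<Rightarrow> real) \<Rightarrow> real" where
  "path_direction \<alpha> i x = direction \<alpha> (i - 1) (first_coords (i - 1) x) (x i)"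

lemma path_direction_measurable:
  assumes \<alpha>: "\<alpha> \<in> controls K N" and s: "s < N" and n: "Suc s \<le> n"
  shows "path_direction \<alpha> (Suc s) \<in> borel_measurable (Rn n)"
proof -
  have "(\<lambda>x. (first_coords s x, x (Suc s))) \<in> Rn n \<rightarrow>\<^sub>M Rn s \<Otimes>\<^sub>M borel"
    using n by (intro measurable_Pair first_coords_measurable[where n = n] coord_measurable[where n = n]) auto
  from measurable_compose[OF this direction_measurable[OF \<alpha> s]]
  show ?thesis by (simp add: path_direction_def[abs_def])
qed

lemma path_direction_upd:
  "x \<in> space (Rn s) \<Longrightarrow> path_direction \<alpha> (Suc s) (x(Suc s := r)) = direction \<alpha> s x r"
  by (simp add: path_direction_def first_coords_id)

lemma path_direction_prefix:
  "path_direction \<alpha> (Suc s) (first_coords (Suc s) x) = path_direction \<alpha> (Suc s) x"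
  by (simp add: path_direction_def first_coords_first_coords)

text \<open>The conditional p-th moment is at most one at every prefix, hence so is the
  unconditional one.\<close>

lemma integrable_path_direction:
  assumes \<alpha>: "\<alpha> \<in> controls K N" and s: "s < N"
  shows "integrable \<mu> (\<lambda>x. \<bar>path_direction \<alpha> (Suc s) x\<bar> powr p)"
proof -
  have t: "Suc s + (N - Suc s) = N" using s by simp
  have sp: "sets (law s) = sets (Rn s)" "space (law s) = space (Rn s)" "prob_space (law s)"
    using law_space[of s] s by auto
  interpret L: prob_space "law s" by fact
  have m: "(\<lambda>x. \<bar>path_direction \<alpha> (Suc s) x\<bar> powr p) \<in> borel_measurable (Rn (Suc s))"
    using path_direction_measurable[OF \<alpha> s order_refl] by measurable
  have "(\<integral>\<^sup>+x. ennreal (\<bar>path_direction \<alpha> (Suc s) x\<bar> powr p) \<partial>law (Suc s))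
      = (\<integral>\<^sup>+x. \<integral>\<^sup>+w. ennreal (\<bar>path_direction \<alpha> (Suc s) w\<bar> powr p) \<partial>step s x \<partial>law s)"
    unfolding law_Suc[OF s]
    by (rule nn_integral_bind[OF _ measurable_change_sets[OF measurable_prob_algebraD[OF step_measurable[OF s]] sp(1)]])
      (use m in measurable)
  also have "\<dots> \<le> (\<integral>\<^sup>+x. 1 \<partial>law s)"
  proof (rule nn_integral_mono)
    fix x assume "x \<in> space (law s)"
    then have x: "x \<in> space (Rn s)" by (simp add: sp)
    interpret shifted_Lq p q "\<kappa> s x" "ngrad \<alpha> s x" by (rule shifted_Lq_ngrad[OF \<alpha> s x])
    have "(\<integral>\<^sup>+w. ennreal (\<bar>path_direction \<alpha> (Suc s) w\<bar> powr p) \<partial>step s x)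
        = (\<integral>\<^sup>+r. ennreal (\<bar>direction \<alpha> s x r\<bar> powr p) \<partial>\<kappa> s x)"
      using m by (subst nn_integral_step[OF s x]) (auto simp: path_direction_upd[OF x])
    also have "\<dots> = ennreal (\<integral>r. \<bar>direction \<alpha> s x r\<bar> powr p \<partial>\<kappa> s x)"
      unfolding direction_def by (intro nn_integral_eq_integral integrable_dual_direction_powr) simp
    also have "\<dots> \<le> ennreal 1"
      unfolding direction_def by (intro ennreal_leI integral_dual_direction_powr)
    finally show "(\<integral>\<^sup>+w. ennreal (\<bar>path_direction \<alpha> (Suc s) w\<bar> powr p) \<partial>step s x) \<le> 1" by simp
  qed
  also have "\<dots> = 1" by (simp add: L.emeasure_space_1)
  finally have le: "(\<integral>\<^sup>+x. ennreal (\<bar>path_direction \<alpha> (Suc s) x\<bar> powr p) \<partial>law (Suc s)) \<le> 1" .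
  have fm: "first_coords (Suc s) \<in> \<mu> \<rightarrow>\<^sub>M Rn (Suc s)"
    by (rule measurable_change_sets[OF first_coords_measurable[OF _ measurable_ident_sets]]) (use s in auto)
  have d: "law (Suc s) = distr \<mu> (Rn (Suc s)) (first_coords (Suc s))"
    using distr_law_prefix[of "Suc s" "N - Suc s"] t by simp
  have "integrable (law (Suc s)) (\<lambda>x. \<bar>path_direction \<alpha> (Suc s) x\<bar> powr p)"
  proof (rule integrableI_nonneg)
    show "(\<lambda>x. \<bar>path_direction \<alpha> (Suc s) x\<bar> powr p) \<in> borel_measurable (law (Suc s))"
      by (rule measurable_change_sets[OF m]) (use law_space(2)[of "Suc s"] s in simp)
    show "(\<integral>\<^sup>+x. ennreal (\<bar>path_direction \<alpha> (Suc s) x\<bar> powr p) \<partial>law (Suc s)) < \<infinity>"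
      using le by (rule le_less_trans) simp
  qed simp
  then show ?thesis
    unfolding d integrable_distr_eq[OF fm m] by (simp only: path_direction_prefix)
qed

text \<open>Given the first s + 1 coordinates the direction is a constant and the gradient averages
  to \<open>cgrad\<close>; given the first s coordinates the extremal direction attains the residual
  norm. This is equality where a general coupling only has the bound of
  \<open>pairing_le\<close>.\<close>

lemma integral_pgrad_path_direction:
  assumes \<alpha>: "\<alpha> \<in> controls K N" and s: "s < N"
  shows "(\<integral>x. pgrad \<alpha> (Suc s) x * path_direction \<alpha> (Suc s) x \<partial>\<mu>) = (\<integral>x. residual \<alpha> s x \<partial>law s)"
proof -
  have t: "Suc s \<in> {1..N}" "Suc s \<le> N" "Suc s + (N - Suc s) = N" using s by auto
  have sp: "space (law (Suc s)) = space (Rn (Suc s))" "space (law s) = space (Rn s)"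
    "sets (law s) = sets (Rn s)"
    using law_space[of "Suc s"] law_space[of s] s by auto
  have pm: "path_direction \<alpha> (Suc s) \<in> borel_measurable \<mu>"
    by (rule measurable_change_sets[OF path_direction_measurable[OF \<alpha> s t(2)]]) simp
  have gm: "pgrad \<alpha> (Suc s) \<in> borel_measurable \<mu>"
    by (rule measurable_change_sets[OF pgrad_measurable[OF \<alpha> t(1)]]) simp
  have int: "integrable \<mu> (\<lambda>x. pgrad \<alpha> (Suc s) x * path_direction \<alpha> (Suc s) x)"
    by (rule Hoelder_integrable[OF gm pm integrable_pgrad_powr[OF \<alpha> t(1)] integrable_path_direction[OF \<alpha> s]])
  note I = integral_law_cond_path[OF t(2) int]
  have inner: "(\<integral>z. pgrad \<alpha> (Suc s) z * path_direction \<alpha> (Suc s) z \<partial>cond_path \<kappa> (Suc s) (N - Suc s) x)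
      = cgrad \<alpha> (Suc s) x * path_direction \<alpha> (Suc s) x" if "x \<in> space (law (Suc s))" for x
  proof -
    have x: "x \<in> space (Rn (Suc s))" using that by (simp add: sp)
    have m1: "pgrad \<alpha> (Suc s) \<in> borel_measurable (cond_path \<kappa> (Suc s) (N - Suc s) x)"
      by (rule measurable_change_sets[OF pgrad_measurable[OF \<alpha> t(1)] cond_path_N_space(2)[OF t(2) x]])
    have m2: "path_direction \<alpha> (Suc s) \<in> borel_measurable (cond_path \<kappa> (Suc s) (N - Suc s) x)"
      by (rule measurable_change_sets[OF path_direction_measurable[OF \<alpha> s t(2)] cond_path_N_space(2)[OF t(2) x]])
    have "AE z in cond_path \<kappa> (Suc s) (N - Suc s) x. first_coords (Suc s) z = x"
      using AE_cond_path_prefix[of "Suc s" "N - Suc s" x] t(3) x by simp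
    then have "AE z in cond_path \<kappa> (Suc s) (N - Suc s) x.
        pgrad \<alpha> (Suc s) z * path_direction \<alpha> (Suc s) z = pgrad \<alpha> (Suc s) z * path_direction \<alpha> (Suc s) x"
    proof eventually_elim
      case (elim z)
      then show ?case using path_direction_prefix[of \<alpha> s z] by simp
    qed
    then have "(\<integral>z. pgrad \<alpha> (Suc s) z * path_direction \<alpha> (Suc s) z \<partial>cond_path \<kappa> (Suc s) (N - Suc s) x)
        = (\<integral>z. pgrad \<alpha> (Suc s) z * path_direction \<alpha> (Suc s) x \<partial>cond_path \<kappa> (Suc s) (N - Suc s) x)"
      using m1 m2 by (intro integral_cong_AE) auto
    then show ?thesis by (simp add: cgrad_def)
  qed
  let ?F = "\<lambda>x. cgrad \<alpha> (Suc s) x * path_direction \<alpha> (Suc s) x"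
  have F: "integrable (law (Suc s)) ?F"
    by (rule Bochner_Integration.integrable_cong[THEN iffD1, OF refl _ I(2)]) (rule inner)
  note J = integral_law_Suc[OF s F]
  have "(\<integral>x. pgrad \<alpha> (Suc s) x * path_direction \<alpha> (Suc s) x \<partial>\<mu>) = (\<integral>x. ?F x \<partial>law (Suc s))"
    unfolding I(3) by (rule Bochner_Integration.integral_cong[OF refl inner])
  also have "\<dots> = (\<integral>x. residual \<alpha> s x \<partial>law s)"
    unfolding J(3)
  proof (rule integral_cong_AE)
    show "(\<lambda>x. \<integral>r. ?F (x(Suc s := r)) \<partial>\<kappa> s x) \<in> borel_measurable (law s)"
      by (rule borel_measurable_integrable[OF J(2)])
    show "residual \<alpha> s \<in> borel_measurable (law s)"
      by (rule borel_measurable_integrable[OF integrable_residual[OF \<alpha> s]])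
    show "AE x in law s. (\<integral>r. ?F (x(Suc s := r)) \<partial>\<kappa> s x) = residual \<alpha> s x"
      using AE_good[OF \<alpha> s] AE_space
    proof eventually_elim
      case (elim x)
      then have x: "x \<in> space (Rn s)" by (simp add: sp)
      interpret shifted_Lq p q "\<kappa> s x" "ngrad \<alpha> s x" by (rule shifted_Lq_ngrad[OF \<alpha> s x])
      \<comment> \<open>The shift 0 brings the integrand into the form of the pairing identity,
        whose value is the same for every shift.\<close>
      have "(\<integral>r. ?F (x(Suc s := r)) \<partial>\<kappa> s x) = (\<integral>r. (ngrad \<alpha> s x r + 0) * dual_direction r \<partial>\<kappa> s x)"
        using elim(1) by (simp add: path_direction_upd[OF x] ngrad_def direction_def)
      also have "\<dots> = residual \<alpha> s x" unfolding integral_mult_dual_direction by (simp add: residual_def)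
      finally show ?case .
    qed
  qed
  finally show ?thesis .
qed

text \<open>The displacement direction is adapted to the optimal control, while the controls are the
  nearly optimal responses to it.\<close>

lemma pairing_tendsto:
  assumes \<alpha>: "\<alpha> \<in> controls K N" and t: "t \<in> {1..N}"
    and \<beta>: "\<And>n. \<beta> n \<in> controls K N" and lim: "AE x in \<mu>. (\<lambda>n. \<beta> n x) \<longlonglongrightarrow> \<alpha> x"
    and D: "\<And>n. displacement p q N K f C \<epsilon>0 \<kappa> \<epsilon> \<mu> (\<lambda>x. x) (T n) (d n)"
    and d: "\<And>n. 0 < d n" "\<And>n. d n < 1 / 4" "d \<longlonglongrightarrow> 0"
    and err: "\<And>n x. x \<in> space (Rn N) \<Longrightarrow>
      \<bar>T n x t - x t - (d n - 4 * (d n)\<^sup>2) * path_direction \<alpha> t x\<bar> \<le> 2 * (d n)\<^sup>2"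
  shows "(\<lambda>n. (\<integral>x. pgrad (\<beta> n) t x * (T n x t - x t) \<partial>\<mu>) / d n)
    \<longlonglongrightarrow> (\<integral>x. pgrad \<alpha> t x * path_direction \<alpha> t x \<partial>\<mu>)"
proof -
  obtain s where s: "t = Suc s" "s < N" using t by (cases t) auto
  obtain B where B: "B \<ge> 0" "\<And>\<alpha> t x. \<alpha> \<in> controls K N \<Longrightarrow> t \<in> {1..N} \<Longrightarrow> x \<in> space (Rn N) \<Longrightarrow>
      \<bar>pgrad \<alpha> t x\<bar> powr q \<le> B * (1 + norm1 N x powr p)"
    using pgrad_bound by blast
  have pm: "path_direction \<alpha> t \<in> borel_measurable \<mu>"
    unfolding s(1) by (rule measurable_change_sets[OF path_direction_measurable[OF \<alpha> s(2), of N]]) (use s in auto)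
  have gm: "pgrad \<gamma> t \<in> borel_measurable \<mu>" if "\<gamma> \<in> controls K N" for \<gamma>
    by (rule measurable_change_sets[OF pgrad_measurable[OF that t]]) simp
  have dm: "(\<lambda>x. T n x t - x t) \<in> borel_measurable \<mu>" for n
    by (rule displacement.diff_measurable[OF D t])
  let ?h = "path_direction \<alpha> t"
  \<comment> \<open>After division by the size, the quadratic error and the shortening of the step
    are both of order \<open>d n\<close>.\<close>
  have q_err: "\<bar>(T n x t - x t) / d n - (1 - 4 * d n) * ?h x\<bar> \<le> 2 * d n" if x: "x \<in> space (Rn N)" for n x
  proof -
    have "(T n x t - x t) / d n - (1 - 4 * d n) * ?h x = (T n x t - x t - (d n - 4 * (d n)\<^sup>2) * ?h x) / d n"
      using d(1)[of n] by (simp add: field_simps power2_eq_square)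
    moreover have "\<bar>(T n x t - x t - (d n - 4 * (d n)\<^sup>2) * ?h x) / d n\<bar> \<le> 2 * (d n)\<^sup>2 / d n"
      using err[OF x, of n] d(1)[of n] by (simp add: abs_divide divide_right_mono)
    ultimately show ?thesis using d(1)[of n] by (simp add: power2_eq_square)
  qed
  have "(\<lambda>n. \<integral>x. pgrad (\<beta> n) t x * ((T n x t - x t) / d n) \<partial>\<mu>) \<longlonglongrightarrow> (\<integral>x. pgrad \<alpha> t x * ?h x \<partial>\<mu>)"
  proof (rule integral_dominated_convergence)
    show "(\<lambda>x. pgrad \<alpha> t x * ?h x) \<in> borel_measurable \<mu>" using gm[OF \<alpha>] pm by measurable
    show "(\<lambda>x. pgrad (\<beta> n) t x * ((T n x t - x t) / d n)) \<in> borel_measurable \<mu>" for n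
      using gm[OF \<beta>] dm by measurable
    have "integrable \<mu> (\<lambda>x. \<bar>\<bar>?h x\<bar> + 1\<bar> powr p)"
    proof (rule Bochner_Integration.integrable_bound)
      show "integrable \<mu> (\<lambda>x. 2 powr p * (\<bar>\<bar>?h x\<bar>\<bar> powr p + \<bar>1\<bar> powr p))"
        using integrable_path_direction[OF \<alpha> s(2)] unfolding s(1) by simp
      show "(\<lambda>x. \<bar>\<bar>?h x\<bar> + 1\<bar> powr p) \<in> borel_measurable \<mu>" using pm by measurable
      show "AE x in \<mu>. norm (\<bar>\<bar>?h x\<bar> + 1\<bar> powr p) \<le> norm (2 powr p * (\<bar>\<bar>?h x\<bar>\<bar> powr p + \<bar>1\<bar> powr p))"
        using abs_add_powr_le[of p "\<bar>?h x\<bar>" 1 for x] p_gt_1 by (intro AE_I2) simp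
    qed
    \<comment> \<open>Young's inequality separates gradient and displacement. Both bounds are
      independent of n: B serves all controls, and \<open>d n\<close> < 1/4 keeps the rescaled
      displacement below |h| + 1.\<close>
    then show "integrable \<mu> (\<lambda>x. B * (1 + norm1 N x powr p) + \<bar>\<bar>?h x\<bar> + 1\<bar> powr p)"
      using integrable_norm1_powr by simp
    show "AE x in \<mu>. norm (pgrad (\<beta> n) t x * ((T n x t - x t) / d n)) \<le> B * (1 + norm1 N x powr p) + \<bar>\<bar>?h x\<bar> + 1\<bar> powr p" for n
    proof (rule AE_I2)
      fix x assume "x \<in> space \<mu>"
      then have x: "x \<in> space (Rn N)" by simp
      have "\<bar>(1 - 4 * d n) * ?h x\<bar> \<le> 1 * \<bar>?h x\<bar>"
        unfolding abs_mult using d(1,2)[of n] by (intro mult_right_mono) auto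
      then have le: "\<bar>(T n x t - x t) / d n\<bar> \<le> \<bar>\<bar>?h x\<bar> + 1\<bar>"
        using q_err[OF x, of n] d(2)[of n] by linarith
      have "\<bar>pgrad (\<beta> n) t x\<bar> * \<bar>(T n x t - x t) / d n\<bar>
          \<le> \<bar>pgrad (\<beta> n) t x\<bar> powr q + \<bar>(T n x t - x t) / d n\<bar> powr p"
        by (rule Young_weak) auto
      also have "\<dots> \<le> B * (1 + norm1 N x powr p) + \<bar>\<bar>?h x\<bar> + 1\<bar> powr p"
        using B(2)[OF \<beta> t x] le p_gt_1 by (intro add_mono powr_mono2) auto
      finally show "norm (pgrad (\<beta> n) t x * ((T n x t - x t) / d n)) \<le> B * (1 + norm1 N x powr p) + \<bar>\<bar>?h x\<bar> + 1\<bar> powr p"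
        by (simp only: real_norm_def abs_mult)
    qed
    show "AE x in \<mu>. (\<lambda>n. pgrad (\<beta> n) t x * ((T n x t - x t) / d n)) \<longlonglongrightarrow> pgrad \<alpha> t x * ?h x"
      using lim AE_space
    proof eventually_elim
      case (elim x)
      then have x: "x \<in> space (Rn N)" by simp
      have "(\<lambda>n. (x, \<beta> n x)) \<longlonglongrightarrow> (x, \<alpha> x)" by (intro tendsto_Pair tendsto_const elim(1))
      then have "(\<lambda>n. (\<lambda>(x, a). partial t f x a) (x, \<beta> n x)) \<longlonglongrightarrow> (\<lambda>(x, a). partial t f x a) (x, \<alpha> x)"
        by (rule continuous_on_tendsto_compose[OF partial_continuous[OF t]])
          (use x controlsD(2)[OF \<alpha> x] controlsD(2)[OF \<beta> x] in auto)
      then have g: "(\<lambda>n. pgrad (\<beta> n) t x) \<longlonglongrightarrow> pgrad \<alpha> t x" by (simp add: pgrad_def)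
      have "(\<lambda>n. (T n x t - x t) / d n - (1 - 4 * d n) * ?h x) \<longlonglongrightarrow> 0"
      proof (rule Lim_null_comparison)
        have "(\<lambda>n. 2 * d n) \<longlonglongrightarrow> 2 * 0" by (intro tendsto_intros d(3))
        then show "(\<lambda>n. 2 * d n) \<longlonglongrightarrow> 0" by simp
      qed (use q_err[OF x] in simp)
      moreover have "(\<lambda>n. (1 - 4 * d n) * ?h x) \<longlonglongrightarrow> (1 - 4 * 0) * ?h x"
        by (intro tendsto_intros d(3))
      ultimately have "(\<lambda>n. ((T n x t - x t) / d n - (1 - 4 * d n) * ?h x) + (1 - 4 * d n) * ?h x)
          \<longlonglongrightarrow> 0 + (1 - 4 * 0) * ?h x" by (rule tendsto_add)
      then have "(\<lambda>n. (T n x t - x t) / d n) \<longlonglongrightarrow> ?h x" by simp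
      then show ?case by (rule tendsto_mult[OF g])
    qed
  qed
  moreover have "(\<integral>x. pgrad (\<beta> n) t x * ((T n x t - x t) / d n) \<partial>\<mu>)
      = (\<integral>x. pgrad (\<beta> n) t x * (T n x t - x t) \<partial>\<mu>) / d n" for n
    by (simp only: times_divide_eq_right Bochner_Integration.integral_divide_zero)
  ultimately show ?thesis by simp
qed

lemma sensitivity_eq_pairing:
  assumes \<alpha>: "\<alpha> \<in> controls K N"
  shows "sensitivity \<alpha> = (\<Sum>t=1..N. \<integral>x. pgrad \<alpha> t x * path_direction \<alpha> t x \<partial>\<mu>)"
proof -
  have "(\<Sum>t=1..N. \<integral>x. pgrad \<alpha> t x * path_direction \<alpha> t x \<partial>\<mu>)
      = (\<Sum>s<N. \<integral>x. pgrad \<alpha> (Suc s) x * path_direction \<alpha> (Suc s) x \<partial>\<mu>)"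
    by (rule sum.reindex_bij_witness[of _ Suc "\<lambda>t. t - 1"]) auto
  then show ?thesis
    by (simp add: sensitivity_def integral_pgrad_path_direction[OF \<alpha>])
qed

lemma lower_bound:
  assumes N: "N \<ge> 1" and \<alpha>: "\<alpha> \<in> controls K N" and opt': "\<forall>\<beta>\<in>controls K N. cost \<alpha> \<le> cost \<beta>"
    and c: "c < sensitivity \<alpha>"
  shows "\<forall>\<^sub>F \<delta> in at_right 0. ereal (cost \<alpha> + \<delta> * c) < V_mart p N K \<kappa> f \<delta>"
proof (rule ccontr)
  have opt: "cost \<alpha> \<le> cost \<beta>" if "\<beta> \<in> controls K N" for \<beta> using opt' that by blast
  assume "\<not> ?thesis"
  then have freq: "\<exists>\<delta>>0. \<delta> < b \<and> V_mart p N K \<kappa> f \<delta> \<le> ereal (cost \<alpha> + \<delta> * c)" if "b > 0" for b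
    using that unfolding eventually_at_right_field by (metis not_less)
  \<comment> \<open>A best response need not be attained; the slack \<delta>^2, of smaller order
    than \<delta>, selects a nearly optimal one. The bound 1/(n+5) sends the sizes to zero and keeps
    them below 1/4, as the construction of T requires.\<close>
  define P where "P n \<delta> T \<beta> \<longleftrightarrow> 0 < \<delta> \<and> \<delta> < 1 / (real n + 5)
    \<and> displacement p q N K f C \<epsilon>0 \<kappa> \<epsilon> \<mu> (\<lambda>x. x) T \<delta> \<and> \<beta> \<in> controls K N
    \<and> (\<forall>x\<in>space (Rn N). \<forall>i\<in>{1..N}. \<bar>T x i - x i - (\<delta> - 4 * \<delta>\<^sup>2) * path_direction \<alpha> i x\<bar> \<le> 2 * \<delta>\<^sup>2)
    \<and> (\<integral>x. f (T x) (\<beta> x) \<partial>\<mu>) < cost \<alpha> + \<delta> * c + \<delta>\<^sup>2"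
    for n :: nat and \<delta> :: real and T \<beta> :: "(nat \<Rightarrow> real) \<Rightarrow> (nat \<Rightarrow> real)"
  have "\<exists>\<delta> T \<beta>. P n \<delta> T \<beta>" for n
  proof -
    obtain \<delta> where \<delta>: "\<delta> > 0" "\<delta> < 1 / (real n + 5)" "V_mart p N K \<kappa> f \<delta> \<le> ereal (cost \<alpha> + \<delta> * c)"
      using freq[of "1 / (real n + 5)"] by auto
    have "1 / (real n + 5) \<le> 1 / 4" by (simp add: field_simps)
    then have \<delta>4: "\<delta> < 1 / 4" using \<delta>(2) by linarith
    obtain T where T: "displacement p q N K f C \<epsilon>0 \<kappa> \<epsilon> \<mu> (\<lambda>x. x) T \<delta>"
        "\<And>x i. x \<in> space (Rn N) \<Longrightarrow> i \<in> {1..N} \<Longrightarrow>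
          \<bar>T x i - x i - (\<delta> - 4 * \<delta>\<^sup>2) * direction \<alpha> (i - 1) (first_coords (i - 1) x) (x i)\<bar> \<le> 2 * \<delta>\<^sup>2"
        "\<And>c. (\<And>\<beta>. \<beta> \<in> controls K N \<Longrightarrow> c \<le> (\<integral>x. f (T x) (\<beta> x) \<partial>\<mu>)) \<Longrightarrow> ereal c \<le> V_mart p N K \<kappa> f \<delta>"
      using ex_perturbation[OF \<alpha> \<delta>(1) \<delta>4] by blast
    have "\<exists>\<beta>\<in>controls K N. (\<integral>x. f (T x) (\<beta> x) \<partial>\<mu>) < cost \<alpha> + \<delta> * c + \<delta>\<^sup>2"
    proof (rule ccontr)
      assume "\<not> ?thesis"
      then have "ereal (cost \<alpha> + \<delta> * c + \<delta>\<^sup>2) \<le> V_mart p N K \<kappa> f \<delta>"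
        by (intro T(3)) (auto simp: not_less)
      then have "ereal (cost \<alpha> + \<delta> * c + \<delta>\<^sup>2) \<le> ereal (cost \<alpha> + \<delta> * c)" using \<delta>(3) by (rule order_trans)
      then show False using \<delta>(1) by simp
    qed
    then obtain \<beta> where "\<beta> \<in> controls K N" "(\<integral>x. f (T x) (\<beta> x) \<partial>\<mu>) < cost \<alpha> + \<delta> * c + \<delta>\<^sup>2" by blast
    then have "P n \<delta> T \<beta>" using \<delta>(1,2) T(1,2) by (simp add: P_def path_direction_def)
    then show ?thesis by blast
  qed
  then obtain d T \<beta> where P: "\<And>n. P n (d n) (T n) (\<beta> n)" by metis
  have d: "\<And>n. 0 < d n" and d5: "\<And>n. d n < 1 / (real n + 5)"
    and D: "\<And>n. displacement p q N K f C \<epsilon>0 \<kappa> \<epsilon> \<mu> (\<lambda>x. x) (T n) (d n)"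
    and \<beta>: "\<And>n. \<beta> n \<in> controls K N"
    and err: "\<And>n x i. x \<in> space (Rn N) \<Longrightarrow> i \<in> {1..N} \<Longrightarrow>
      \<bar>T n x i - x i - (d n - 4 * (d n)\<^sup>2) * path_direction \<alpha> i x\<bar> \<le> 2 * (d n)\<^sup>2"
    and lt: "\<And>n. (\<integral>x. f (T n x) (\<beta> n x) \<partial>\<mu>) < cost \<alpha> + d n * c + (d n)\<^sup>2"
    using P unfolding P_def by blast+
  have d4: "d n < 1 / 4" for n
  proof -
    have "1 / (real n + 5) \<le> 1 / 4" by (simp add: field_simps)
    then show ?thesis using d5[of n] by linarith
  qed
  have d0: "d \<longlonglongrightarrow> 0"
  proof (rule Lim_null_comparison)
    show "(\<lambda>n. inverse (real (Suc n))) \<longlonglongrightarrow> 0" by (rule LIMSEQ_inverse_real_of_nat)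
    have "norm (d n) \<le> inverse (real (Suc n))" for n
    proof -
      have "1 / (real n + 5) \<le> inverse (real (Suc n))" by (simp add: field_simps)
      then show ?thesis using d[of n] d5[of n] by simp
    qed
    then show "\<forall>\<^sub>F n in sequentially. norm (d n) \<le> inverse (real (Suc n))" by simp
  qed
  define W where "W = 1 + moment_const + dim_const"
  have W: "W > 0" using const_nonneg by (simp add: W_def add_pos_nonneg)
  define S where "S n = (\<Sum>t=1..N. \<integral>x. pgrad (\<beta> n) t x * (T n x t - x t) \<partial>\<mu>)" for n
  define bound where "bound \<eta> B n = c + d n + (\<eta> * W + B * dim_const * d n powr (p - 1))" for \<eta> B n
  \<comment> \<open>Near-optimality of the response combined with the expansion. It is used twice:
    with \<eta> = 1 to show that the costs converge, and with a small \<eta> to compare the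
    first-order terms.\<close>
  have main: "\<exists>B. \<forall>n. cost (\<beta> n) + S n \<le> cost \<alpha> + d n * bound \<eta> B n" if \<eta>: "\<eta> > 0" for \<eta>
  proof -
    obtain B where B: "expansion \<eta> B" using first_order_expansion[OF \<eta>] by blast
    have "cost (\<beta> n) + S n \<le> cost \<alpha> + d n * bound \<eta> B n" for n
    proof -
      have "cost (\<beta> n) + S n \<le> (\<integral>x. f (T n x) (\<beta> n x) \<partial>\<mu>) + d n * (\<eta> * W + B * dim_const * d n powr (p - 1))"
        using displacement.displaced_cost[OF D \<beta> \<eta> B, of n n] unfolding S_def W_def by linarith
      also have "\<dots> \<le> cost \<alpha> + d n * c + (d n)\<^sup>2 + d n * (\<eta> * W + B * dim_const * d n powr (p - 1))"
        using lt[of n] by simp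
      also have "\<dots> = cost \<alpha> + d n * bound \<eta> B n"
        by (simp add: bound_def algebra_simps power2_eq_square)
      finally show ?thesis .
    qed
    then show ?thesis by blast
  qed
  have rate: "bound \<eta> B \<longlonglongrightarrow> c + \<eta> * W" for \<eta> B
  proof -
    have ev: "\<forall>\<^sub>F n in sequentially. 0 \<le> d n" using d by (intro always_eventually allI less_imp_le)
    have pw: "(\<lambda>n. d n powr (p - 1)) \<longlonglongrightarrow> 0 powr (p - 1)"
      by (rule tendsto_powr'[OF d0 tendsto_const]) (use ev p_gt_1 in simp)
    have "bound \<eta> B \<longlonglongrightarrow> c + 0 + (\<eta> * W + B * dim_const * 0 powr (p - 1))"
      unfolding bound_def[abs_def] by (intro tendsto_add tendsto_mult tendsto_const d0 pw)
    then show ?thesis by simp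
  qed
  \<comment> \<open>The first-order term S is of order \<open>d n\<close> uniformly over controls,
    so the unperturbed costs of the responses are squeezed to the minimum.\<close>
  have cost_lim: "(\<lambda>n. cost (\<beta> n)) \<longlonglongrightarrow> cost \<alpha>"
  proof -
    obtain B where "B \<ge> 0" and B: "\<And>\<alpha> t x. \<alpha> \<in> controls K N \<Longrightarrow> t \<in> {1..N} \<Longrightarrow> x \<in> space (Rn N) \<Longrightarrow>
        \<bar>pgrad \<alpha> t x\<bar> powr q \<le> B * (1 + norm1 N x powr p)"
      using pgrad_bound by blast
    obtain B' where B': "\<And>n. cost (\<beta> n) + S n \<le> cost \<alpha> + d n * bound 1 B' n"
      using main[OF zero_less_one] by blast
    define A where "A = real N * (B * (1 + moment_const) + 1)"
    have S: "\<bar>S n\<bar> \<le> d n * A" for n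
    proof -
      have "\<bar>S n\<bar> \<le> (\<Sum>t=1..N. d n * (B * (1 + moment_const) + 1))"
        unfolding S_def
        by (rule order_trans[OF sum_abs sum_mono[OF displacement.pairing_abs_le[OF D \<beta>]]]) (use B \<beta> in auto)
      then show ?thesis by (simp add: A_def algebra_simps)
    qed
    have "(\<lambda>n. cost \<alpha> + d n * bound 1 B' n + d n * A) \<longlonglongrightarrow> cost \<alpha> + 0 * (c + 1 * W) + 0 * A"
      by (intro tendsto_add tendsto_mult tendsto_const d0 rate)
    then have up: "(\<lambda>n. cost \<alpha> + d n * bound 1 B' n + d n * A) \<longlonglongrightarrow> cost \<alpha>" by simp
    show ?thesis
    proof (rule tendsto_sandwich[OF _ _ tendsto_const up])
      show "\<forall>\<^sub>F n in sequentially. cost \<alpha> \<le> cost (\<beta> n)" using opt[OF \<beta>] by simp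
      have "cost (\<beta> n) \<le> cost \<alpha> + d n * bound 1 B' n + d n * A" for n
        using B'[of n] S[of n] by linarith
      then show "\<forall>\<^sub>F n in sequentially. cost (\<beta> n) \<le> cost \<alpha> + d n * bound 1 B' n + d n * A"
        by (intro always_eventually allI)
    qed
  qed
  obtain r :: "nat \<Rightarrow> nat" where r: "strict_mono r" "AE x in \<mu>. (\<lambda>n. \<beta> (r n) x) \<longlonglongrightarrow> \<alpha> x"
    using near_optimal_converge[OF N \<alpha> opt \<beta> cost_lim] by blast
  have dr: "(\<lambda>n. d (r n)) \<longlonglongrightarrow> 0" using LIMSEQ_subseq_LIMSEQ[OF d0 r(1)] by (simp add: comp_def)
  have S_lim: "(\<lambda>n. S (r n) / d (r n)) \<longlonglongrightarrow> sensitivity \<alpha>"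
    unfolding S_def sum_divide_distrib sensitivity_eq_pairing[OF \<alpha>]
    by (intro tendsto_sum pairing_tendsto[OF \<alpha> _ \<beta> r(2) D d d4 dr err]) auto
  \<comment> \<open>Makes \<eta> W half of the margin between the sensitivity and c, so that the
    limit inequality below becomes contradictory.\<close>
  define \<eta> where "\<eta> = (sensitivity \<alpha> - c) / (2 * W)"
  have \<eta>: "\<eta> > 0" using c W by (simp add: \<eta>_def)
  obtain B where B: "\<And>n. cost (\<beta> n) + S n \<le> cost \<alpha> + d n * bound \<eta> B n"
    using main[OF \<eta>] by blast
  \<comment> \<open>The response costs at least the minimum on the unperturbed law, so the terms of
    order zero cancel.\<close>
  have "S n / d n \<le> bound \<eta> B n" for n
    using B[of n] opt[OF \<beta>, of n] d[of n] by (simp add: pos_divide_le_eq mult.commute)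
  then have "sensitivity \<alpha> \<le> c + \<eta> * W"
    using LIMSEQ_le[OF S_lim LIMSEQ_subseq_LIMSEQ[OF rate r(1), of \<eta> B]] by (auto simp: comp_def)
  also have "\<dots> = c + (sensitivity \<alpha> - c) / 2" using W by (simp add: \<eta>_def)
  finally show False using c by argo
qed

lemma sensitivity_nonneg: "sensitivity \<alpha> \<ge> 0"
  by (simp add: sensitivity_def sum_nonneg)

lemma quotient_tendsto:
  assumes N: "N \<ge> 1" and \<alpha>: "\<alpha> \<in> controls K N" and opt': "\<forall>\<beta>\<in>controls K N. cost \<alpha> \<le> cost \<beta>"
  shows "((\<lambda>\<delta>. (V_mart p N K \<kappa> f \<delta> - ereal (cost \<alpha>)) / ereal \<delta>) \<longlongrightarrow> ereal (sensitivity \<alpha>)) (at_right 0)"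
proof (rule order_tendstoI)
  have pos: "\<forall>\<^sub>F \<delta> in at_right (0::real). \<delta> > 0" by (rule eventually_at_right_less)
  fix a
  {
    assume "a < ereal (sensitivity \<alpha>)"
    then obtain c where c: "a < ereal c" "c < sensitivity \<alpha>" by (metis ereal_dense2 less_ereal.simps(1))
    show "\<forall>\<^sub>F \<delta> in at_right 0. a < (V_mart p N K \<kappa> f \<delta> - ereal (cost \<alpha>)) / ereal \<delta>"
      using lower_bound[OF N \<alpha> opt' c(2)] pos
    proof eventually_elim
      case (elim \<delta>)
      \<comment> \<open>The perturbed value may still be infinite here, but the bound leaves only
        the sign that does no harm; the same holds for the other estimate.\<close>
      have "ereal c \<le> (V_mart p N K \<kappa> f \<delta> - ereal (cost \<alpha>)) / ereal \<delta>"
        using elim by (cases "V_mart p N K \<kappa> f \<delta>") (auto simp: field_simps)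
      then show ?case using c(1) by (rule less_le_trans[rotated])
    qed
  next
    assume "ereal (sensitivity \<alpha>) < a"
    then obtain c where c: "ereal c < a" "sensitivity \<alpha> < c" by (metis ereal_dense2 less_ereal.simps(1))
    show "\<forall>\<^sub>F \<delta> in at_right 0. (V_mart p N K \<kappa> f \<delta> - ereal (cost \<alpha>)) / ereal \<delta> < a"
      using upper_bound[OF \<alpha> c(2)] pos
    proof eventually_elim
      case (elim \<delta>)
      have "(V_mart p N K \<kappa> f \<delta> - ereal (cost \<alpha>)) / ereal \<delta> \<le> ereal c"
        using elim by (cases "V_mart p N K \<kappa> f \<delta>") (auto simp: field_simps)
      then show ?case using c(1) by (rule le_less_trans)
    qed
  }
qed

lemma optimal_controls_iff:
  "\<alpha> \<in> optimal_controls N K \<mu> f \<longleftrightarrow> \<alpha> \<in> controls K N \<and> (\<forall>\<beta>\<in>controls K N. cost \<alpha> \<le> cost \<beta>)"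
  by (auto simp: optimal_controls_def is_arg_min_def cost_def not_less)

lemma V_zero_eq:
  assumes "\<alpha> \<in> controls K N" "\<forall>\<beta>\<in>controls K N. cost \<alpha> \<le> cost \<beta>"
  shows "V_zero N K \<mu> f = ereal (cost \<alpha>)"
  unfolding V_zero_def cost_def[symmetric]
  using assms by (intro antisym INF_lower INF_greatest) auto

end

theorem corollary5p3:
  fixes N :: nat and p q C C' \<epsilon>0 :: real and K :: "real set"
    and \<mu> :: "(nat \<Rightarrow> real) measure"
    and \<kappa> :: "nat \<Rightarrow> (nat \<Rightarrow> real) \<Rightarrow> real measure"
    and f :: "(nat \<Rightarrow> real) \<Rightarrow> (nat \<Rightarrow> real) \<Rightarrow> real"
    and \<epsilon> :: "(nat \<Rightarrow> real) \<Rightarrow> real"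
  assumes N: "N \<ge> 1"
    and p: "p > 1" and q: "q = p / (p - 1)"
    and K: "compact K"
    and mu: "\<mu> \<in> Pp p N"
    and disint: "disintegration N \<mu> \<kappa>"
    and cont: "succ_Wp_continuous p N \<kappa>"
    and mart: "martingale_measure N \<mu> \<kappa>"
    and growth: "\<forall>t\<in>{1..<N}. \<forall>x\<in>space (Rn t).
      (\<integral>\<^sup>+ z. ennreal (pnorm p {t+1..N} z powr p) \<partial>(cond_path \<kappa> t (N - t) x))
        \<le> ennreal (C' * (1 + pnorm p {1..t} x powr p))"
    and lsc: "lower_semicontinuous_on (space (Rn N) \<times> Kn K N) (\<lambda>(x, a). f x a)"
    and f_diff: "\<forall>x\<in>space (Rn N). \<forall>a\<in>Kn K N.
      \<exists>G. has_gradient_within N (\<lambda>x. f x a) G x (space (Rn N))"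
    and grad_cont: "continuous_on (space (Rn N) \<times> Kn K N) (\<lambda>(x, a). grad_x N f x a)"
    and C: "C > 0" and eps0: "\<epsilon>0 > 0"
    and grad_bound: "\<forall>x\<in>space (Rn N). \<forall>a\<in>Kn K N.
      pnorm p {1..N} (grad_x N f x a) \<le> C * (1 + pnorm p {1..N} x powr (p - 1 - \<epsilon>0))"
    and convex: "\<forall>x\<in>spt \<mu>. strongly_convex_on p N K (\<epsilon> x) (f x)"
    and eps: "AE x in \<mu>. \<epsilon> x > 0"
  shows "((\<lambda>\<delta>. (V_mart p N K \<kappa> f \<delta> - V_zero N K \<mu> f) / ereal \<delta>) \<longlongrightarrow>
    enn2ereal (INF \<alpha>\<in>optimal_controls N K \<mu> f.
      (INF l1::real. Lnorm q (distr \<mu> borel (\<lambda>x. x 1))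
         (\<lambda>x1. (\<integral>x. partial 1 f x (\<alpha> x) \<partial>(cond_path \<kappa> 1 (N - 1) (origin0(1 := x1)))) + l1))
      + (\<Sum>t=2..N. \<integral>\<^sup>+ x'. (INF lt::real. Lnorm q (\<kappa> (t - 1) x')
           (\<lambda>xt. (\<integral>x. partial t f x (\<alpha> x) \<partial>(cond_path \<kappa> t (N - t) (x'(t := xt)))) + lt))
         \<partial>(distr \<mu> (Rn (t - 1)) (first_coords (t - 1))))))
    (at_right 0)"
proof (cases "K = {}")
  \<comment> \<open>Without any control both values and the infimum over the empty set of minimizers
    are infinite. In the extended reals the difference of two positive infinities is again positive
    infinity, so the quotient has this constant value.\<close>
  case True
  have Kn: "Kn K N = {}" using N True by (auto simp: PiE_eq_empty_iff)
  have c: "controls K N = {}" using Kn space_Rn_nonempty[of N] by (auto simp: controls_def)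
  have j: "joint_controls K N = {}" using Kn space_Rn_nonempty[of N] by (auto simp: joint_controls_def)
  have o: "optimal_controls N K \<mu> f = {}" using c by (simp add: optimal_controls_def is_arg_min_def)
  have "\<forall>\<^sub>F \<delta> in at_right 0. \<infinity> = (V_mart p N K \<kappa> f \<delta> - V_zero N K \<mu> f) / ereal \<delta>"
    using eventually_at_right_less[of "0::real"]
    by eventually_elim (simp add: V_mart_def V_zero_def c j top_ereal_def)
  then show ?thesis
    unfolding o by (intro tendsto_eventually) (auto elim!: eventually_mono)
next
  case False
  interpret kernels N \<kappa>
    by unfold_locales (use disint in \<open>simp add: disintegration_def\<close>)
  have \<mu>: "\<mu> = law N" using disint by (simp add: disintegration_def law_def)
  interpret control_problem p q N K f C \<epsilon>0 \<kappa> \<epsilon>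
  proof (intro control_problem.intro smooth_cost.intro conjugate_exponents.intro smooth_cost_axioms.intro
      control_problem_axioms.intro kernels_axioms)
    show "(\<integral>\<^sup>+ x. ennreal (pnorm p {1..N} x powr p) \<partial>law N) < \<infinity>"
    proof -
      have "(\<integral>\<^sup>+ x. ennreal (pnorm p {1..N} x powr p) \<partial>\<mu>) < \<infinity>" using mu by (simp add: Pp_def)
      then show ?thesis unfolding \<mu> .
    qed
    show "\<forall>x\<in>spt (law N). strongly_convex_on p N K (\<epsilon> x) (f x)" "AE x in law N. \<epsilon> x > 0"
      using convex eps unfolding \<mu> .
    show "p > 1" by (rule p)
    show "q = p / (p - 1)" by (rule q)
    show "compact K" by (rule K)
    show "\<forall>x\<in>space (Rn N). \<forall>a\<in>Kn K N. \<exists>G. has_gradient_within N (\<lambda>x. f x a) G x (space (Rn N))"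
      by (rule f_diff)
    show "continuous_on (space (Rn N) \<times> Kn K N) (\<lambda>(x, a). grad_x N f x a)" by (rule grad_cont)
    show "C > 0" by (rule C)
    show "\<epsilon>0 > 0" by (rule eps0)
    show "\<forall>x\<in>space (Rn N). \<forall>a\<in>Kn K N.
        pnorm p {1..N} (grad_x N f x a) \<le> C * (1 + pnorm p {1..N} x powr (p - 1 - \<epsilon>0))"
      by (rule grad_bound)
    show "lower_semicontinuous_on (space (Rn N) \<times> Kn K N) (\<lambda>(x, a). f x a)" by (rule lsc)
  qed
  obtain \<alpha> where \<alpha>: "\<alpha> \<in> controls K N" "\<forall>\<beta>\<in>controls K N. cost \<alpha> \<le> cost \<beta>"
    using ex_optimal[OF N False] by blast
  \<comment> \<open>Every minimizer yields a limit of the same quotient, equal to its own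
    sensitivity. By uniqueness of limits all minimizers have the same sensitivity, and the infimum
    over them is one over a constant.\<close>
  have eq: "sensitivity \<alpha>' = sensitivity \<alpha>" if "\<alpha>' \<in> optimal_controls N K (law N) f" for \<alpha>'
  proof -
    have \<alpha>': "\<alpha>' \<in> controls K N" "\<forall>\<beta>\<in>controls K N. cost \<alpha>' \<le> cost \<beta>"
      using that by (auto simp: optimal_controls_iff)
    then have "cost \<alpha>' = cost \<alpha>" using \<alpha> by (intro antisym) auto
    then show ?thesis
      using tendsto_unique[OF _ quotient_tendsto[OF N \<alpha>'] quotient_tendsto[OF N \<alpha>, folded \<open>cost \<alpha>' = cost \<alpha>\<close>]]
      by simp
  qed
  have opt: "\<alpha> \<in> optimal_controls N K (law N) f" using \<alpha> by (simp add: optimal_controls_iff)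
  \<comment> \<open>Phrased for an abstract F, so that the long expression of the goal is matched
    only once, by \<open>sensitivity_eq\<close>.\<close>
  have lim: "((\<lambda>\<delta>. (V_mart p N K \<kappa> f \<delta> - V_zero N K (law N) f) / ereal \<delta>) \<longlongrightarrow>
      enn2ereal (INF \<alpha>'\<in>optimal_controls N K (law N) f. F \<alpha>')) (at_right 0)"
    if F: "\<And>\<alpha>'. \<alpha>' \<in> optimal_controls N K (law N) f \<Longrightarrow> F \<alpha>' = ennreal (sensitivity \<alpha>')" for F
  proof -
    have "(INF \<alpha>'\<in>optimal_controls N K (law N) f. F \<alpha>')
        = (INF \<alpha>'\<in>optimal_controls N K (law N) f. ennreal (sensitivity \<alpha>))"
      by (rule INF_cong[OF refl]) (simp only: F eq)
    also have "\<dots> = ennreal (sensitivity \<alpha>)"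
      using opt by (intro INF_const) blast
    finally have "(INF \<alpha>'\<in>optimal_controls N K (law N) f. F \<alpha>') = ennreal (sensitivity \<alpha>)" .
    then show ?thesis
      using quotient_tendsto[OF N \<alpha>] by (simp only: V_zero_eq[OF \<alpha>] enn2ereal_ennreal[OF sensitivity_nonneg])
  qed
  have ctrl: "\<alpha>' \<in> controls K N" if "\<alpha>' \<in> optimal_controls N K (law N) f" for \<alpha>'
    using that by (simp only: optimal_controls_iff)
  show ?thesis
    unfolding \<mu> by (rule lim, rule sensitivity_eq[OF ctrl N])
qed

end
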